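(* Let $\varphi:(0,\infty)\to[-\pi/2,\pi/2)$ be measurable with $\sin\varphi\in L^2(0,\infty)$, let $$H_d(x)=\begin{pmatrix}\sin^2\varphi(x)&0\\0&\cos^2\varphi(x)\end{pmatrix},$$ and let $$B=\liminf_{x\to\infty}\,x\int_x^\infty\sin^2\varphi(t)\,dt\in[0,\infty].$$ Then $$M(H_d)\le\frac{1}{2\sqrt B},$$ where $M(H_d)\in[0,\infty]$ denotes the smallest absolute value of a point of the essential spectrum of the canonical system with coefficient function $H_d$ (and $1/\sqrt B$ is read as $\infty$ if $B=0$ and as $0$ if $B=\infty$).
   Context: A canonical system is a differential equation $Ju'(x)=-zH(x)u(x)$ on $x\in[0,\infty)$ with $J=\begin{pmatrix}0&-1\\1&0\end{pmatrix}$, where $H(x)\in\mathbb{R}^{2\times2}$ is locally integrable with $H(x)\ge0$ (symmetric, positive semidefinite) and $\operatorname{tr}H(x)=1$ for almost every $x$. The boundary condition $u_2(0)=0$ is imposed at $x=0$. The system together with this boundary condition generates a self-adjoint relation $\mathcal S$ on the Hilbert space $L^2_H(0,\infty)=\{f:(0,\infty)\to\mathbb{C}^2:\int_0^\infty f^*(x)H(x)f(x)\,dx<\infty\}$ (functions identified if their difference has norm zero): $\mathcal S$ consists of all pairs $(f,h)$ of elements of $L^2_H(0,\infty)$ such that $f$ has a locally absolutely continuous representative on $[0,\infty)$, again denoted $f$, with $Jf'=-Hh$ almost everywhere and $f_2(0)=0$. After dividing out the multi-valued part $\{h:(0,h)\in\mathcal S\}$, i.e. restricting to its orthogonal complement,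 one obtains a self-adjoint operator; its essential spectrum is denoted $\sigma_{ess}(H)$. Define $M(H)=\min\{|t|:t\in\sigma_{ess}(H)\}$, with $M(H)=\infty$ if $\sigma_{ess}(H)=\emptyset$; here this is applied to $H=H_d$. *)

theory Defs
  imports "HOL-Analysis.Analysis"
begin

text \<open>A coefficient function is a map \<open>H :: real \<Rightarrow> real^2^2\<close> of which only the values on \<open>{0<..}\<close>
  matter. Elements of \<open>L\<^sup>2\<^sub>H(0,\<infinity>)\<close> are represented by functions \<open>real \<Rightarrow> complex^2\<close>, again only
  looked at on \<open>{0<..}\<close>, and equality of elements is the relation \<open>L2H_eq\<close>.\<close>

definition J :: "complex^2^2" where
  "J = vector [vector [0, -1], vector [1, 0]]"

definition cplx_mat :: "real^2^2 \<Rightarrow> complex^2^2" where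
  "cplx_mat A = map_matrix complex_of_real A"

text \<open>\<open>u\<^sup>* A v\<close>, conjugate-linear in \<open>u\<close>.\<close>

definition herm_form :: "real^2^2 \<Rightarrow> complex^2 \<Rightarrow> complex^2 \<Rightarrow> complex" where
  "herm_form A u v = (\<Sum>i\<in>UNIV. cnj (u $ i) * (cplx_mat A *v v) $ i)"

definition L2H :: "(real \<Rightarrow> real^2^2) \<Rightarrow> (real \<Rightarrow> complex^2) set" where
  "L2H H = {f. f \<in> borel_measurable (lebesgue_on {0<..}) \<and>
               integrable (lebesgue_on {0<..}) (\<lambda>x. herm_form (H x) (f x) (f x))}"

definition L2H_inner :: "(real \<Rightarrow> real^2^2) \<Rightarrow> (real \<Rightarrow> complex^2) \<Rightarrow> (real \<Rightarrow> complex^2) \<Rightarrow> complex" where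
  "L2H_inner H f g = (LINT x|lebesgue_on {0<..}. herm_form (H x) (f x) (g x))"

definition L2H_norm :: "(real \<Rightarrow> real^2^2) \<Rightarrow> (real \<Rightarrow> complex^2) \<Rightarrow> real" where
  "L2H_norm H f = sqrt (Re (L2H_inner H f f))"

text \<open>Membership of both sides is part of the relation: for \<open>f - g\<close> outside \<open>L2H H\<close> the integral
  defining the norm would be 0 by convention.\<close>

definition L2H_eq :: "(real \<Rightarrow> real^2^2) \<Rightarrow> (real \<Rightarrow> complex^2) \<Rightarrow> (real \<Rightarrow> complex^2) \<Rightarrow> bool" where
  "L2H_eq H f g \<longleftrightarrow> f \<in> L2H H \<and> g \<in> L2H H \<and> L2H_norm H (\<lambda>x. f x - g x) = 0"

text \<open>The usual \<open>\<epsilon>\<close>-\<open>\<delta>\<close> definition of absolute continuity; a division is a finite family of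
  non-overlapping compact intervals \<open>k = {Inf k..Sup k}\<close>.\<close>

definition abs_cont_on :: "real set \<Rightarrow> (real \<Rightarrow> 'a::real_normed_vector) \<Rightarrow> bool" where
  "abs_cont_on S f \<longleftrightarrow>
     (\<forall>\<epsilon>>0. \<exists>\<delta>>0. \<forall>d T. d division_of T \<and> T \<subseteq> S \<and> (\<Sum>k\<in>d. Sup k - Inf k) < \<delta> \<longrightarrow>
        (\<Sum>k\<in>d. norm (f (Sup k) - f (Inf k))) < \<epsilon>)"

definition loc_abs_cont :: "(real \<Rightarrow> 'a::real_normed_vector) \<Rightarrow> bool" where
  "loc_abs_cont f \<longleftrightarrow> (\<forall>b>0. abs_cont_on {0..b} f)"

definition canonical_relation ::
  "(real \<Rightarrow> real^2^2) \<Rightarrow> ((real \<Rightarrow> complex^2) \<times> (real \<Rightarrow> complex^2)) set" where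
  "canonical_relation H = {(f, h). f \<in> L2H H \<and> h \<in> L2H H \<and>
     (\<exists>f0. L2H_eq H f f0 \<and> loc_abs_cont f0 \<and>
        (AE x in lebesgue_on {0<..}. \<exists>d. (f0 has_vector_derivative d) (at x) \<and>
            J *v d = - (cplx_mat (H x) *v h x)) \<and>
        f0 0 $ 2 = 0)}"

definition multivalued_part :: "(real \<Rightarrow> real^2^2) \<Rightarrow> (real \<Rightarrow> complex^2) set" where
  "multivalued_part H = {h. (\<lambda>x. 0, h) \<in> canonical_relation H}"

text \<open>The Hilbert space in which the operator part of the relation acts.\<close>

definition operator_space :: "(real \<Rightarrow> real^2^2) \<Rightarrow> (real \<Rightarrow> complex^2) set" where
  "operator_space H = {g \<in> L2H H. \<forall>h\<in>multivalued_part H. L2H_inner H h g = 0}"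

definition operator_part ::
  "(real \<Rightarrow> real^2^2) \<Rightarrow> ((real \<Rightarrow> complex^2) \<times> (real \<Rightarrow> complex^2)) set" where
  "operator_part H = {(f, h) \<in> canonical_relation H. f \<in> operator_space H \<and> h \<in> operator_space H}"

text \<open>\<open>z\<close> is in the resolvent set iff \<open>A - z\<close>, with \<open>A\<close> the operator part, maps the domain of \<open>A\<close>
  onto the operator space and has a bounded inverse; the bound contains injectivity.\<close>

definition resolvent_set :: "(real \<Rightarrow> real^2^2) \<Rightarrow> complex set" where
  "resolvent_set H = {z.
     (\<forall>g\<in>operator_space H. \<exists>(f, h)\<in>operator_part H. L2H_eq H (\<lambda>x. h x - z *s f x) g) \<and>
     (\<exists>C. \<forall>(f, h)\<in>operator_part H. L2H_norm H f \<le> C * L2H_norm H (\<lambda>x. h x - z *s f x))}"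

definition canonical_spectrum :: "(real \<Rightarrow> real^2^2) \<Rightarrow> complex set" where
  "canonical_spectrum H = - resolvent_set H"

definition eigenspace :: "(real \<Rightarrow> real^2^2) \<Rightarrow> complex \<Rightarrow> (real \<Rightarrow> complex^2) set" where
  "eigenspace H z = {f. (f, \<lambda>x. z *s f x) \<in> operator_part H}"

text \<open>Isolated points of the spectrum that are eigenvalues of finite multiplicity.\<close>

definition discrete_spectrum :: "(real \<Rightarrow> real^2^2) \<Rightarrow> complex set" where
  "discrete_spectrum H = {z. z isolated_in canonical_spectrum H \<and>
     (\<exists>f\<in>eigenspace H z. L2H_norm H f \<noteq> 0) \<and>
     (\<exists>F. finite F \<and> F \<subseteq> eigenspace H z \<and>
        (\<forall>f\<in>eigenspace H z. \<exists>c. L2H_eq H f (\<lambda>x. \<Sum>g\<in>F. c g *s g x)))}"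

definition essential_spectrum :: "(real \<Rightarrow> real^2^2) \<Rightarrow> complex set" where
  "essential_spectrum H = canonical_spectrum H - discrete_spectrum H"

definition min_abs_ess :: "(real \<Rightarrow> real^2^2) \<Rightarrow> ereal" where
  "min_abs_ess H = (if essential_spectrum H = {} then \<infinity>
     else (LEAST r. r \<in> (\<lambda>t. ereal (cmod t)) ` essential_spectrum H))"

definition H_diag :: "(real \<Rightarrow> real) \<Rightarrow> real \<Rightarrow> real^2^2" where
  "H_diag \<phi> x = vector [vector [(sin (\<phi> x))\<^sup>2, 0], vector [0, (cos (\<phi> x))\<^sup>2]]"

definition ereal_sqrt :: "ereal \<Rightarrow> ereal" where
  "ereal_sqrt b = (if b = \<infinity> then \<infinity> else ereal (sqrt (real_of_ereal b)))"

end

theory Submission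
  imports Defs "HOL-Library.Function_Algebras"
begin

text \<open>Write \<open>p = sin\<^sup>2 \<phi>\<close> and \<open>q = cos\<^sup>2 \<phi> = 1 - p\<close>. For \<open>f = (f\<^sub>1, f\<^sub>2)\<close> and \<open>h = (h\<^sub>1, h\<^sub>2)\<close> the equation
  \<open>J f' = - H h\<close> splits into \<open>f\<^sub>1' = - q h\<^sub>2\<close> and \<open>f\<^sub>2' = p h\<^sub>1\<close>, so a pair \<open>((u, 0), (0, - w))\<close> belongs to the
  relation as soon as \<open>u' = q w\<close>. Its two norms are \<open>\<integral> p u\<^sup>2\<close> and \<open>\<integral> q w\<^sup>2\<close>. If \<open>x P(x) \<ge> c\<close> for all large
  \<open>x\<close>, where \<open>P(x)\<close> is the integral of \<open>p\<close> over \<open>(x, \<infinity>)\<close>, take almost extremal functions of Hardy's inequality: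
  \<open>u\<close> grows like \<open>sqrt x\<close> on a long interval \<open>[a, b]\<close> and is then brought back to \<open>0\<close> so slowly that this
  costs nothing. Since \<open>q\<close> is \<open>1\<close> up to the integrable function \<open>p\<close>, the second integral is about
  \<open>log (b / a) / 4\<close>, and an integration by parts, \<open>\<integral> p u\<^sup>2 = \<integral> P (u\<^sup>2)'\<close>, shows that the first one is at least
  about \<open>c log (b / a)\<close>. Hence for every \<open>\<mu>\<close> with \<open>\<mu>\<^sup>2 c > 1/4\<close> there are pairs \<open>(f, h)\<close> in the relation with
  \<open>\<parallel>h\<parallel> \<le> \<mu> \<parallel>f\<parallel> \<noteq> 0\<close> and with supports as far out as we please (\<open>test_pair\<close>). Combining pairs with
  disjoint supports makes \<open>f\<close> orthogonal to any given finite set (\<open>orthogonal_test_pair\<close>).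

  Such pairs force essential spectrum in every disc around \<open>0\<close> of radius \<open>\<nu> > \<mu>\<close>. This holds for every
  symmetric relation \<open>S\<close> in a Hilbert space, with operator part \<open>A\<close> (\<open>ess_near_zero\<close>). Suppose the disc
  contains none. The spectrum is closed, so the disc then contains only finitely many spectral points, all
  isolated eigenvalues of finite multiplicity; let \<open>V\<close> be the orthogonal complement of their eigenvectors,
  which is a space of finite codimension. At each point \<open>z\<close> of \<open>[- \<nu>, \<nu>]\<close> the operator \<open>A - z\<close> is bounded below
  on \<open>V\<close>: this is clear in the resolvent set, and \<open>isolated_bounded_below\<close> proves it at an isolated point of
  the spectrum. By \<open>gap_bound\<close>, pointwise lower bounds on an interval around \<open>m\<close> combine into
  \<open>\<parallel>(A - m) u\<parallel> \<ge> \<delta> \<parallel>u\<parallel>\<close> on \<open>V\<close>, where \<open>\<delta>\<close> is the half-length of the interval. With \<open>m\<close> close to \<open>0\<close> this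
  contradicts the existence of a test pair in \<open>V\<close>. The proofs replace the spectral theorem by the remark
  that a vector at which a bounded symmetric operator \<open>B\<close> almost attains its norm \<open>\<beta>\<close> is almost annihilated
  by \<open>B\<^sup>2 - \<beta>\<^sup>2 = (B - \<beta>) (B + \<beta>)\<close>.

  The canonical relation is symmetric because the boundary terms \<open>f\<^sub>1 g\<^sub>2\<close> at infinity vanish: \<open>f\<^sub>1\<close> grows at
  most like \<open>sqrt x\<close>, so a nonzero limit would make \<open>\<bar>g\<^sub>2\<bar>\<^sup>2\<close> at least of order \<open>1 / x\<close>, which is not integrable
  against \<open>q\<close> (\<open>form_identity\<close>). Finally the essential spectrum is closed, so the infimum of its absolute
  values is attained and the bounds \<open>\<nu>\<close> may be let tend to \<open>1 / (2 sqrt B)\<close>.\<close>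

section \<open>Absolutely continuous functions of one variable\<close>

lemma division_of_interval_ends:
  assumes "d division_of T" "T \<subseteq> {a..b::real}" "k \<in> d"
  obtains u v where "k = {u..v}" "Inf k = u" "Sup k = v" "a \<le> u" "u \<le> v" "v \<le> b"
proof -
  obtain u v where uv: "k = {u..v}" using division_ofD(4)[OF assms(1,3)] by (auto simp: cbox_interval)
  have "k \<noteq> {}" "k \<subseteq> {a..b}" using division_ofD(2,3)[OF assms(1,3)] assms(2) by auto
  then show ?thesis using that[of u v] uv by auto
qed

text \<open>Sums, products, constants and images under bounded linear maps of absolutely continuous functions are all
  covered by this one comparison of increments.\<close>

lemma abs_cont_on_by_modulus:
  fixes f :: "real \<Rightarrow> 'a::real_normed_vector" and g :: "real \<Rightarrow> 'b::real_normed_vector" and h :: "real \<Rightarrow> 'c::real_normed_vector"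
  assumes g: "abs_cont_on {a..b} g" and h: "abs_cont_on {a..b} h" and C: "C > 0"
    and le: "\<And>u v. \<lbrakk>a \<le> u; u \<le> v; v \<le> b\<rbrakk> \<Longrightarrow> norm (f v - f u) \<le> C * (norm (g v - g u) + norm (h v - h u))"
  shows "abs_cont_on {a..b} f"
  unfolding abs_cont_on_def
proof (intro allI impI)
  fix \<epsilon> :: real assume "\<epsilon> > 0"
  then have e: "\<epsilon> / (2 * C) > 0" using C by simp
  obtain \<delta>1 where \<delta>1: "\<delta>1 > 0" "\<And>d T. \<lbrakk>d division_of T; T \<subseteq> {a..b}; (\<Sum>k\<in>d. Sup k - Inf k) < \<delta>1\<rbrakk>
      \<Longrightarrow> (\<Sum>k\<in>d. norm (g (Sup k) - g (Inf k))) < \<epsilon> / (2 * C)"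
    using g e unfolding abs_cont_on_def by meson
  obtain \<delta>2 where \<delta>2: "\<delta>2 > 0" "\<And>d T. \<lbrakk>d division_of T; T \<subseteq> {a..b}; (\<Sum>k\<in>d. Sup k - Inf k) < \<delta>2\<rbrakk>
      \<Longrightarrow> (\<Sum>k\<in>d. norm (h (Sup k) - h (Inf k))) < \<epsilon> / (2 * C)"
    using h e unfolding abs_cont_on_def by meson
  have main: "(\<Sum>k\<in>d. norm (f (Sup k) - f (Inf k))) < \<epsilon>"
    if dT: "d division_of T" "T \<subseteq> {a..b}" and s: "(\<Sum>k\<in>d. Sup k - Inf k) < min \<delta>1 \<delta>2" for d T
  proof -
    have "(\<Sum>k\<in>d. norm (f (Sup k) - f (Inf k))) \<le> (\<Sum>k\<in>d. C * (norm (g (Sup k) - g (Inf k)) + norm (h (Sup k) - h (Inf k))))"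
    proof (rule sum_mono)
      fix k assume "k \<in> d"
      from division_of_interval_ends[OF dT this] obtain u v where "Inf k = u" "Sup k = v" "a \<le> u" "u \<le> v" "v \<le> b" .
      then show "norm (f (Sup k) - f (Inf k)) \<le> C * (norm (g (Sup k) - g (Inf k)) + norm (h (Sup k) - h (Inf k)))"
        using le by simp
    qed
    also have "\<dots> = C * ((\<Sum>k\<in>d. norm (g (Sup k) - g (Inf k))) + (\<Sum>k\<in>d. norm (h (Sup k) - h (Inf k))))"
      by (simp add: sum.distrib flip: sum_distrib_left)
    also have "\<dots> < C * (\<epsilon> / (2 * C) + \<epsilon> / (2 * C))"
      using \<delta>1(2)[OF dT] \<delta>2(2)[OF dT] s C by (intro mult_strict_left_mono add_strict_mono) auto
    also have "\<dots> = \<epsilon>" using C by simp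
    finally show ?thesis .
  qed
  show "\<exists>\<delta>>0. \<forall>d T. d division_of T \<and> T \<subseteq> {a..b} \<and> (\<Sum>k\<in>d. Sup k - Inf k) < \<delta> \<longrightarrow>
        (\<Sum>k\<in>d. norm (f (Sup k) - f (Inf k))) < \<epsilon>"
    by (intro exI[of _ "min \<delta>1 \<delta>2"] conjI allI impI; (elim conjE)?; (rule main)?) (use \<delta>1(1) \<delta>2(1) in auto)
qed

lemma abs_cont_on_ident: "abs_cont_on {a..b} (\<lambda>x::real. x)"
  unfolding abs_cont_on_def
proof (intro allI impI)
  fix \<epsilon> :: real assume e: "\<epsilon> > 0"
  have main: "(\<Sum>k\<in>d. norm (Sup k - Inf k)) < \<epsilon>"
    if dT: "d division_of T" "T \<subseteq> {a..b}" and s: "(\<Sum>k\<in>d. Sup k - Inf k) < \<epsilon>" for d T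
  proof -
    have "(\<Sum>k\<in>d. norm (Sup k - Inf k)) = (\<Sum>k\<in>d. Sup k - Inf k)"
    proof (rule sum.cong)
      fix k assume "k \<in> d"
      from division_of_interval_ends[OF dT this] obtain u v where "Inf k = u" "Sup k = v" "u \<le> v" .
      then show "norm (Sup k - Inf k) = Sup k - Inf k" by simp
    qed simp
    then show ?thesis using s by simp
  qed
  show "\<exists>\<delta>>0. \<forall>d T. d division_of T \<and> T \<subseteq> {a..b} \<and> (\<Sum>k\<in>d. Sup k - Inf k) < \<delta> \<longrightarrow>
        (\<Sum>k\<in>d. norm (Sup k - Inf k)) < \<epsilon>"
    by (intro exI[of _ \<epsilon>] conjI allI impI e; elim conjE; rule main)
qed

lemma abs_cont_on_continuous:
  fixes f :: "real \<Rightarrow> 'a::real_normed_vector"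
  assumes f: "abs_cont_on {a..b} f"
  shows "continuous_on {a..b} f"
  unfolding continuous_on_iff
proof (intro ballI allI impI)
  fix x e :: real assume x: "x \<in> {a..b}" and e: "e > 0"
  obtain \<delta> where \<delta>: "\<delta> > 0" "\<And>d T. \<lbrakk>d division_of T; T \<subseteq> {a..b}; (\<Sum>k\<in>d. Sup k - Inf k) < \<delta>\<rbrakk>
      \<Longrightarrow> (\<Sum>k\<in>d. norm (f (Sup k) - f (Inf k))) < e"
    using f e unfolding abs_cont_on_def by meson
  have "dist (f y) (f x) < e" if y: "y \<in> {a..b}" "dist y x < \<delta>" for y
  proof -
    have le: "min x y \<le> max x y" by simp
    have div: "{{min x y..max x y}} division_of {min x y..max x y}"
      using division_of_self[of "min x y" "max x y"] le by (simp add: cbox_interval)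
    have "(\<Sum>k\<in>{{min x y..max x y}}. Sup k - Inf k) < \<delta>"
      using y(2) le by (auto simp: dist_real_def min_def max_def)
    from \<delta>(2)[OF div _ this] x y have "norm (f (max x y) - f (min x y)) < e" using le by (simp add: min_def max_def split: if_splits)
    then show ?thesis by (auto simp: dist_norm min_def max_def norm_minus_commute split: if_splits)
  qed
  then show "\<exists>d>0. \<forall>x'\<in>{a..b}. dist x' x < d \<longrightarrow> dist (f x') (f x) < e" using \<delta>(1) by blast
qed

lemma loc_abs_cont_linear:
  assumes f: "loc_abs_cont f" and L: "bounded_linear L"
  shows "loc_abs_cont (\<lambda>x. L (f x))"
  unfolding loc_abs_cont_def
proof (intro allI impI)
  fix b :: real assume b: "b > 0"
  interpret L: bounded_linear L by (rule L)
  obtain K where K: "K > 0" "\<And>x. norm (L x) \<le> norm x * K" using L.pos_bounded by blast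
  have f': "abs_cont_on {0..b} f" using f b by (simp add: loc_abs_cont_def)
  show "abs_cont_on {0..b} (\<lambda>x. L (f x))"
  proof (rule abs_cont_on_by_modulus[OF f' f' K(1)])
    fix u v
    have "norm (L (f v) - L (f u)) \<le> K * norm (f v - f u)" using K(2)[of "f v - f u"] by (simp add: L.diff mult.commute)
    also have "\<dots> \<le> K * (norm (f v - f u) + norm (f v - f u))" using K by (intro mult_left_mono) auto
    finally show "norm (L (f v) - L (f u)) \<le> K * (norm (f v - f u) + norm (f v - f u))" .
  qed
qed

lemma loc_abs_cont_add:
  assumes "loc_abs_cont f" "loc_abs_cont g"
  shows "loc_abs_cont (\<lambda>x. f x + g x)"
  unfolding loc_abs_cont_def
proof (intro allI impI)
  fix b :: real assume b: "b > 0"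
  show "abs_cont_on {0..b} (\<lambda>x. f x + g x)"
  proof (rule abs_cont_on_by_modulus[of _ _ f g 1])
    fix u v
    have "(f v + g v) - (f u + g u) = (f v - f u) + (g v - g u)" by simp
    then show "norm ((f v + g v) - (f u + g u)) \<le> 1 * (norm (f v - f u) + norm (g v - g u))"
      by (metis mult_1 norm_triangle_ineq)
  qed (use assms b in \<open>auto simp: loc_abs_cont_def\<close>)
qed

lemma loc_abs_cont_mult:
  fixes f g :: "real \<Rightarrow> 'a::real_normed_algebra"
  assumes "loc_abs_cont f" "loc_abs_cont g"
  shows "loc_abs_cont (\<lambda>x. f x * g x)"
  unfolding loc_abs_cont_def
proof (intro allI impI)
  fix b :: real assume b: "b > 0"
  have fg: "abs_cont_on {0..b} f" "abs_cont_on {0..b} g" using assms b by (auto simp: loc_abs_cont_def)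
  have "bounded (f ` {0..b})" "bounded (g ` {0..b})"
    using fg by (auto intro!: compact_imp_bounded compact_continuous_image abs_cont_on_continuous)
  then obtain C1 C2 where C: "C1 > 0" "C2 > 0" "\<And>x. x \<in> {0..b} \<Longrightarrow> norm (f x) \<le> C1" "\<And>x. x \<in> {0..b} \<Longrightarrow> norm (g x) \<le> C2"
    unfolding bounded_pos by (metis imageI)
  show "abs_cont_on {0..b} (\<lambda>x. f x * g x)"
  proof (rule abs_cont_on_by_modulus[OF fg])
    show "max C1 C2 > 0" using C by simp
    fix u v :: real assume uv: "0 \<le> u" "u \<le> v" "v \<le> b"
    have "f v * g v - f u * g u = (f v - f u) * g v + f u * (g v - g u)" by (simp add: algebra_simps)
    then have "norm (f v * g v - f u * g u) \<le> norm ((f v - f u) * g v) + norm (f u * (g v - g u))"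
      by (metis norm_triangle_ineq)
    also have "\<dots> \<le> norm (f v - f u) * norm (g v) + norm (f u) * norm (g v - g u)"
      by (intro add_mono norm_mult_ineq)
    also have "\<dots> \<le> norm (f v - f u) * max C1 C2 + max C1 C2 * norm (g v - g u)"
      using C(3)[of u] C(4)[of v] C(1) uv by (intro add_mono mult_mono) auto
    finally show "norm (f v * g v - f u * g u) \<le> max C1 C2 * (norm (f v - f u) + norm (g v - g u))"
      by (simp add: algebra_simps)
  qed
qed

lemma loc_abs_cont_const: "loc_abs_cont (\<lambda>x. c)"
  unfolding loc_abs_cont_def
  by (intro allI impI abs_cont_on_by_modulus[OF abs_cont_on_ident abs_cont_on_ident, of 1]) auto

text \<open>The fundamental theorem of calculus for the Henstock-Kurzweil integral. The derivative is replaced by \<open>0\<close>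
  on the null set \<open>N\<close>. A gauge that is fine enough at the points of differentiability controls the intervals
  tagged outside \<open>N\<close>. The intervals tagged in \<open>N\<close> are forced into an open set of measure less than \<open>\<delta>\<close>, so
  that absolute continuity makes their total increment small.\<close>

lemma abs_cont_on_integral:
  fixes f :: "real \<Rightarrow> 'a::real_normed_vector"
  assumes ab: "a \<le> b" and ac: "abs_cont_on {a..b} f" and N: "negligible N"
    and der: "\<And>x. x \<in> {a..b} - N \<Longrightarrow> (f has_vector_derivative g x) (at x within {a..b})"
  shows "(g has_integral (f b - f a)) {a..b}"
proof -
  define h where "h x = (if x \<in> N then 0 else g x)" for x
  have "(h has_integral (f b - f a)) {a..b}"
    unfolding has_integral_real
  proof (intro allI impI)
    fix e :: real assume e: "e > 0"
    define e1 where "e1 = e / (2 * (b - a + 1))"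
    have e1: "e1 > 0" "e1 * (b - a) < e / 2" using e ab by (auto simp: e1_def field_simps)
    obtain \<delta> where \<delta>: "\<delta> > 0" "\<And>d T. \<lbrakk>d division_of T; T \<subseteq> {a..b}; (\<Sum>k\<in>d. Sup k - Inf k) < \<delta>\<rbrakk>
        \<Longrightarrow> (\<Sum>k\<in>d. norm (f (Sup k) - f (Inf k))) < e / 2"
      using ac e unfolding abs_cont_on_def by (meson half_gt_zero)
    have "N \<in> sets lebesgue" using N by (simp add: negligible_imp_sets)
    then obtain U where U: "open U" "N \<subseteq> U" "U - N \<in> lmeasurable" "emeasure lebesgue (U - N) < ennreal \<delta>"
      using sets_lebesgue_outer_open \<delta>(1) by blast
    have U_meas: "U \<in> lmeasurable" "measure lebesgue U < \<delta>"
    proof -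
      have NN: "N \<in> lmeasurable" "measure lebesgue N = 0" using N by (auto simp: negligible_iff_measure)
      have eq: "U = (U - N) \<union> N" using U(2) by auto
      show U1: "U \<in> lmeasurable" using fmeasurable.Un[OF U(3) NN(1)] eq by simp
      have "measure lebesgue U \<le> measure lebesgue (U - N) + measure lebesgue N"
        using measure_Un_le[of "U - N" lebesgue N] U(3) NN(1) eq by auto
      moreover have "measure lebesgue (U - N) < \<delta>"
        using U(3,4) \<delta>(1) by (simp add: emeasure_eq_measure2 ennreal_less_iff)
      ultimately show "measure lebesgue U < \<delta>" using NN by simp
    qed
    have "\<exists>d>0. x \<in> {a..b} - N \<longrightarrow> (\<forall>y\<in>{a..b}. \<bar>y - x\<bar> < d \<longrightarrow>
       norm (f y - f x - (y - x) *\<^sub>R g x) \<le> e1 * \<bar>y - x\<bar>)" for x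
    proof (cases "x \<in> {a..b} - N")
      case True
      from der[OF this] e1 show ?thesis
        unfolding has_vector_derivative_def has_derivative_within_alt by (auto simp: norm_minus_commute)
    qed (auto intro: exI[of _ 1])
    then obtain d where d: "\<And>x. d x > 0" "\<And>x y. \<lbrakk>x \<in> {a..b} - N; y \<in> {a..b}; \<bar>y - x\<bar> < d x\<rbrakk> \<Longrightarrow>
       norm (f y - f x - (y - x) *\<^sub>R g x) \<le> e1 * \<bar>y - x\<bar>"
      by metis
    define \<gamma> where "\<gamma> x = (if x \<in> N then U else ball x (d x))" for x
    have gauge: "gauge \<gamma>" using U d by (auto simp: gauge_def \<gamma>_def)
    have main: "norm ((\<Sum>(x, K)\<in>p. measure lborel K *\<^sub>R h x) - (f b - f a)) < e"
      if p: "p tagged_division_of {a..b}" "\<gamma> fine p" for p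
    proof -
      have finp: "finite p" using p(1) by blast
      define D where "D K = f (Sup K) - f (Inf K)" for K
      have K: "\<exists>u v. K = {u..v} \<and> u \<le> x \<and> x \<le> v \<and> a \<le> u \<and> v \<le> b" if xK: "(x, K) \<in> p" for x K
      proof -
        obtain u v where uv: "K = {u..v}" using tagged_division_ofD(4)[OF p(1) xK] by (auto simp: cbox_interval)
        have "x \<in> {u..v}" "{u..v} \<subseteq> {a..b}" using tagged_division_ofD(2,3)[OF p(1) xK] uv by auto
        then have "u \<le> x \<and> x \<le> v \<and> a \<le> u \<and> v \<le> b" by auto
        with uv show ?thesis by blast
      qed
      define p1 where "p1 = {t \<in> p. fst t \<in> N}"
      define p2 where "p2 = {t \<in> p. fst t \<notin> N}"
      have split: "p = p1 \<union> p2" "p1 \<inter> p2 = {}" "finite p1" "finite p2" using finp by (auto simp: p1_def p2_def)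
      have "(\<Sum>(x, K)\<in>p. D K) = f b - f a"
        using additive_tagged_division_1[OF ab p(1), of f] by (simp add: D_def)
      then have "norm ((\<Sum>(x, K)\<in>p. measure lborel K *\<^sub>R h x) - (f b - f a)) = norm (\<Sum>(x, K)\<in>p. measure lborel K *\<^sub>R h x - D K)"
        by (simp add: sum_subtractf case_prod_unfold)
      also have "\<dots> \<le> (\<Sum>(x, K)\<in>p. norm (measure lborel K *\<^sub>R h x - D K))"
        by (simp add: case_prod_unfold norm_sum)
      also have "\<dots> = (\<Sum>(x, K)\<in>p1. norm (measure lborel K *\<^sub>R h x - D K)) + (\<Sum>(x, K)\<in>p2. norm (measure lborel K *\<^sub>R h x - D K))"
        by (subst split(1), rule sum.union_disjoint) (use split in auto)
      also have "(\<Sum>(x, K)\<in>p1. norm (measure lborel K *\<^sub>R h x - D K)) < e / 2"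
      proof -
        have part: "p1 tagged_partial_division_of {a..b}"
          using tagged_partial_division_subset[of p "{a..b}" p1] p(1) by (auto simp: tagged_division_of_def p1_def)
        have tag: "p1 tagged_division_of \<Union>(snd ` p1)"
          by (rule tagged_partial_division_of_Union_self[OF part])
        have div: "(snd ` p1) division_of \<Union>(snd ` p1)" by (rule division_of_tagged_division[OF tag])
        have sub: "\<Union>(snd ` p1) \<subseteq> {a..b}" using tagged_partial_division_ofD(3)[OF part] by force
        have "(\<Sum>K\<in>snd ` p1. Sup K - Inf K) = (\<Sum>K\<in>snd ` p1. measure lebesgue K)"
        proof (rule sum.cong)
          fix K assume "K \<in> snd ` p1"
          then obtain u v where "K = {u..v}" "u \<le> v" using K by (force simp: p1_def)
          then show "Sup K - Inf K = measure lebesgue K" by simp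
        qed simp
        also have "\<dots> = measure lebesgue (\<Union>(snd ` p1))" by (rule content_division[OF div])
        also have "\<dots> \<le> measure lebesgue U"
        proof (rule measure_mono_fmeasurable)
          show "\<Union>(snd ` p1) \<subseteq> U" using p(2) by (fastforce simp: fine_def \<gamma>_def p1_def)
          show "\<Union>(snd ` p1) \<in> sets lebesgue" using lmeasurable_division[OF div] by auto
        qed (rule U_meas)
        also have "\<dots> < \<delta>" by (rule U_meas)
        finally have "(\<Sum>K\<in>snd ` p1. norm (f (Sup K) - f (Inf K))) < e / 2"
          using \<delta>(2)[OF div sub] by simp
        moreover have "(\<Sum>(x, K)\<in>p1. norm (measure lborel K *\<^sub>R h x - D K)) = (\<Sum>(x, K)\<in>p1. if K = {} then 0 else norm (f (Sup K) - f (Inf K)))"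
          using K by (intro sum.cong) (force simp: p1_def h_def D_def norm_minus_commute)+
        moreover have "(\<Sum>(x, K)\<in>p1. if K = {} then 0 else norm (f (Sup K) - f (Inf K)))
            = (\<Sum>K\<in>snd ` p1. if K = {} then 0 else norm (f (Sup K) - f (Inf K)))"
          by (rule sum.over_tagged_division_lemma[OF tag]) (auto simp: box_real cbox_interval not_less)
        moreover have "\<dots> = (\<Sum>K\<in>snd ` p1. norm (f (Sup K) - f (Inf K)))"
          using K by (intro sum.cong) (force simp: p1_def)+
        ultimately show ?thesis by linarith
      qed
      also have "(\<Sum>(x, K)\<in>p2. norm (measure lborel K *\<^sub>R h x - D K)) \<le> (\<Sum>(x, K)\<in>p2. e1 * measure lborel K)"
      proof (rule sum_mono, clarify)
        fix x K assume xK: "(x, K) \<in> p2"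
        then have xp: "(x, K) \<in> p" "x \<notin> N" by (auto simp: p2_def)
        obtain u v where uv: "K = {u..v}" "u \<le> x" "x \<le> v" "a \<le> u" "v \<le> b" using K[OF xp(1)] by blast
        have sub: "K \<subseteq> ball x (d x)" using fineD[OF p(2) xp(1)] xp(2) by (simp add: \<gamma>_def)
        have "u \<in> K" "v \<in> K" using uv by auto
        with sub have "u \<in> ball x (d x)" "v \<in> ball x (d x)" by blast+
        then have "\<bar>u - x\<bar> < d x" "\<bar>v - x\<bar> < d x" by (auto simp: dist_real_def abs_minus_commute)
        then have bd: "norm (f u - f x - (u - x) *\<^sub>R g x) \<le> e1 * \<bar>u - x\<bar>" "norm (f v - f x - (v - x) *\<^sub>R g x) \<le> e1 * \<bar>v - x\<bar>"
          by - (rule d(2); use uv xp in simp)+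
        have eq: "measure lborel K *\<^sub>R h x - D K = (f u - f x - (u - x) *\<^sub>R g x) - (f v - f x - (v - x) *\<^sub>R g x)"
          using uv xp by (simp add: h_def D_def algebra_simps)
        have "norm (measure lborel K *\<^sub>R h x - D K) \<le> e1 * \<bar>u - x\<bar> + e1 * \<bar>v - x\<bar>"
          unfolding eq using bd norm_triangle_ineq4[of "f u - f x - (u - x) *\<^sub>R g x" "f v - f x - (v - x) *\<^sub>R g x"] by linarith
        also have "\<dots> = e1 * measure lborel K" using uv by (simp add: algebra_simps)
        finally show "norm (measure lborel K *\<^sub>R h x - D K) \<le> e1 * measure lborel K" .
      qed
      also have "\<dots> \<le> (\<Sum>(x, K)\<in>p. e1 * measure lborel K)"
        using split e1 by (intro sum_mono2) auto
      also have "\<dots> = e1 * (b - a)"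
      proof -
        have "(\<Sum>(x, K)\<in>p. measure lborel K) = b - a"
          using additive_content_tagged_division[of p a b] p(1) ab by (simp add: cbox_interval)
        then show ?thesis by (simp add: case_prod_unfold flip: sum_distrib_left)
      qed
      finally show ?thesis using e1 by linarith
    qed
    show "\<exists>\<gamma>. gauge \<gamma> \<and> (\<forall>\<D>. \<D> tagged_division_of {a..b} \<and> \<gamma> fine \<D> \<longrightarrow>
        norm ((\<Sum>(x, K)\<in>\<D>. measure lborel K *\<^sub>R h x) - (f b - f a)) < e)" by (intro exI[of _ \<gamma>] conjI allI impI gauge; elim conjE; rule main)
  qed
  then show ?thesis by (rule has_integral_spike[OF N, rotated]) (auto simp: h_def)
qed

section \<open>Integrals on the half-line and Lebesgue differentiation\<close>

text \<open>Let \<open>E \<epsilon>\<close> be the set where difference quotients stay \<open>\<epsilon>\<close> away from \<open>f\<close>. Its points are covered, in the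
  sense of Vitali, by intervals on which \<open>\<epsilon>\<close> times the length is at most the error of a one-point Riemann sum.
  Finitely many disjoint ones form a partial tagged division, so Henstock's lemma bounds the sum of
  these errors, hence the total length, by an arbitrarily small number.\<close>

lemma Lebesgue_differentiation:
  fixes f :: "real \<Rightarrow> real"
  assumes f: "f integrable_on {a..b}"
  shows "negligible {x \<in> {a<..<b}. \<not> ((\<lambda>u. integral {a..u} f) has_vector_derivative f x) (at x)}"
proof -
  define F where "F u = integral {a..u} f" for u
  define E where "E \<epsilon> = {x \<in> {a<..<b}. \<forall>d>0. \<exists>y\<in>{a<..<b}. y \<noteq> x \<and> \<bar>y - x\<bar> < d \<and> \<bar>F y - F x - (y - x) * f x\<bar> > \<epsilon> * \<bar>y - x\<bar>}" for \<epsilon>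
  have neg: "negligible (E \<epsilon>)" if \<epsilon>: "\<epsilon> > 0" for \<epsilon>
    unfolding negligible_outer_le
  proof (intro allI impI)
    fix e :: real assume e: "e > 0"
    have f': "f integrable_on cbox a b" using f by (simp add: cbox_interval)
    from Henstock_lemma[OF f', of "\<epsilon> * e"] \<epsilon> e obtain \<gamma> where \<gamma>: "gauge \<gamma>"
      "\<And>p. \<lbrakk>p tagged_partial_division_of (cbox a b); \<gamma> fine p\<rbrakk> \<Longrightarrow>
             sum (\<lambda>(x,k). norm (measure lborel k *\<^sub>R f x - integral k f)) p < \<epsilon> * e" by auto
    define I where "I = (\<lambda>t::real\<times>real. {min (fst t) (snd t)..max (fst t) (snd t)})"
    define K where "K = {t. fst t \<in> {a<..<b} \<and> snd t \<in> {a<..<b} \<and> fst t \<noteq> snd t \<and> I t \<subseteq> \<gamma> (fst t) \<and>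
       \<bar>F (snd t) - F (fst t) - (snd t - fst t) * f (fst t)\<bar> > \<epsilon> * \<bar>snd t - fst t\<bar>}"
    define c where "c = (\<lambda>t::real\<times>real. (fst t + snd t) / 2)"
    define r where "r = (\<lambda>t::real\<times>real. \<bar>snd t - fst t\<bar> / 2)"
    have cb: "cball (c t) (r t) = I t" for t
      by (auto simp: c_def r_def I_def cball_def dist_real_def abs_if min_def max_def field_simps)
    have r0: "r t > 0" if "t \<in> K" for t using that by (auto simp: K_def r_def)
    have cover: "\<exists>t. t \<in> K \<and> x \<in> cball (c t) (r t) \<and> r t < d" if x: "x \<in> E \<epsilon>" and d: "d > 0" for x d
    proof -
      obtain d' where d': "d' > 0" "ball x d' \<subseteq> \<gamma> x"
        using \<gamma>(1) unfolding gauge_def by (meson openE)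
      obtain y where y: "y \<in> {a<..<b}" "y \<noteq> x" "\<bar>y - x\<bar> < min d d'" "\<bar>F y - F x - (y - x) * f x\<bar> > \<epsilon> * \<bar>y - x\<bar>"
        using x d d' unfolding E_def by (auto dest!: spec[of _ "min d d'"])
      have "\<bar>y - x\<bar> < d'" using y(3) by simp
      then have "I (x, y) \<subseteq> ball x d'" by (auto simp: I_def dist_real_def min_def max_def split: if_splits)
      then have "(x, y) \<in> K" using y x d' by (auto simp: K_def E_def)
      moreover have "x \<in> cball (c (x, y)) (r (x, y))" unfolding cb by (auto simp: I_def)
      moreover have "r (x, y) < d" using y(3) by (auto simp: r_def)
      ultimately show ?thesis by blast
    qed
    obtain C where C: "countable C" "C \<subseteq> K"
      "pairwise (\<lambda>i j. disjnt (cball (c i) (r i)) (cball (c j) (r j))) C"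
      "negligible (E \<epsilon> - (\<Union>i \<in> C. cball (c i) (r i)))"
      using Vitali_covering_theorem_cballs[of K r "E \<epsilon>" c, OF r0 cover] by blast
    have fin_bound: "measure lebesgue (\<Union>\<E>) \<le> e" if \<E>: "\<E> \<subseteq> I ` C" "finite \<E>" for \<E>
    proof -
      obtain C' where C': "C' \<subseteq> C" "finite C'" "\<E> = I ` C'" using \<E> finite_subset_image by metis
      define p where "p = (\<lambda>t. (fst t, I t)) ` C'"
      have disj: "I t \<inter> I t' = {}" if "t \<in> C'" "t' \<in> C'" "t \<noteq> t'" for t t'
        using C(3) that C'(1) unfolding cb pairwise_def disjnt_def by blast
      have ne: "fst t \<in> I t" for t by (auto simp: I_def)
      have inj: "inj_on (\<lambda>t. (fst t, I t)) C'"
        by (rule inj_onI) (metis Pair_inject disj ne IntI empty_iff)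
      have part: "p tagged_partial_division_of (cbox a b)"
        unfolding tagged_partial_division_of_def
      proof (intro conjI allI impI)
        show "finite p" using C' by (simp add: p_def)
        fix x1 K1 assume "(x1, K1) \<in> p"
        then obtain t where t: "t \<in> C'" "x1 = fst t" "K1 = I t" by (auto simp: p_def)
        then have tK: "t \<in> K" using C'(1) C(2) by auto
        show "x1 \<in> K1" using t ne by simp
        show "K1 \<subseteq> cbox a b" using t tK by (auto simp: K_def I_def cbox_interval)
        show "\<exists>a b. K1 = cbox a b" using t by (auto simp: I_def cbox_interval)
      next
        fix x1 K1 x2 K2 assume "(x1, K1) \<in> p \<and> (x2, K2) \<in> p \<and> (x1, K1) \<noteq> (x2, K2)"
        then obtain t t' where "t \<in> C'" "t' \<in> C'" "K1 = I t" "K2 = I t'" "t \<noteq> t'" by (auto simp: p_def)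
        then have "K1 \<inter> K2 = {}" using disj by blast
        then show "interior K1 \<inter> interior K2 = {}" using interior_subset by blast
      qed
      have fine: "\<gamma> fine p" using C'(1) C(2) by (fastforce simp: fine_def p_def K_def)
      have "\<epsilon> * measure lebesgue (\<Union>\<E>) \<le> \<epsilon> * (\<Sum>t\<in>C'. measure lborel (I t))"
      proof -
        have "measure lebesgue (\<Union>\<E>) \<le> (\<Sum>t\<in>C'. measure lebesgue (I t))"
          unfolding C'(3) using C'(2) by (intro measure_UNION_le) (auto simp: I_def)
        also have "\<dots> = (\<Sum>t\<in>C'. measure lborel (I t))" by (simp add: I_def)
        finally show ?thesis using \<epsilon> by (intro mult_left_mono) auto
      qed
      also have "\<dots> = (\<Sum>t\<in>C'. \<epsilon> * measure lborel (I t))" by (simp add: sum_distrib_left)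
      also have "\<dots> \<le> (\<Sum>t\<in>C'. norm (measure lborel (I t) *\<^sub>R f (fst t) - integral (I t) f))"
      proof (rule sum_mono)
        fix t assume "t \<in> C'"
        then have tK: "t \<in> K" using C'(1) C(2) by auto
        obtain x y where t: "t = (x, y)" by (cases t)
        have xy: "x \<in> {a<..<b}" "y \<in> {a<..<b}" "x \<noteq> y" "\<bar>F y - F x - (y - x) * f x\<bar> > \<epsilon> * \<bar>y - x\<bar>"
          using tK by (auto simp: K_def t)
        have FF: "F v - F u = integral {u..v} f" if "a \<le> u" "u \<le> v" "v \<le> b" for u v
        proof -
          have "f integrable_on {a..v}" by (rule integrable_subinterval_real[OF f]) (use that in auto)
          from Henstock_Kurzweil_Integration.integral_combine[OF that(1,2) this] show ?thesis by (simp add: F_def)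
        qed
        have "norm (measure lborel (I t) *\<^sub>R f (fst t) - integral (I t) f) = \<bar>F y - F x - (y - x) * f x\<bar>"
        proof (cases "x < y")
          case True
          then show ?thesis using FF[of x y] xy by (simp add: t I_def abs_minus_commute)
        next
          case False
          then have "y < x" using xy by simp
          then show ?thesis using FF[of y x] xy by (simp add: t I_def algebra_simps)
        qed
        moreover have "measure lborel (I t) = \<bar>y - x\<bar>" using xy by (cases "x \<le> y") (simp_all add: t I_def)
        ultimately show "\<epsilon> * measure lborel (I t) \<le> norm (measure lborel (I t) *\<^sub>R f (fst t) - integral (I t) f)"
          using xy(4) by simp
      qed
      also have "\<dots> = sum (\<lambda>(x,k). norm (measure lborel k *\<^sub>R f x - integral k f)) p"
        unfolding p_def by (subst sum.reindex[OF inj]) simp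
      also have "\<dots> < \<epsilon> * e" by (rule \<gamma>(2)[OF part fine])
      finally show ?thesis using \<epsilon> by simp
    qed
    have cI: "countable (I ` C)" using C(1) by simp
    have mI: "D \<in> lmeasurable" if "D \<in> I ` C" for D using that by (auto simp: I_def)
    let ?U = "\<Union>(I ` C)" and ?N = "E \<epsilon> - (\<Union>i \<in> C. cball (c i) (r i))"
    have U: "?U \<in> lmeasurable" "measure lebesgue ?U \<le> e"
      using fmeasurable_Union_bound[OF cI mI fin_bound] measure_Union_bound[OF cI mI fin_bound] by auto
    have N: "?N \<in> lmeasurable" "measure lebesgue ?N = 0" using C(4) by (auto simp: negligible_iff_measure)
    show "\<exists>T. E \<epsilon> \<subseteq> T \<and> T \<in> lmeasurable \<and> measure lebesgue T \<le> e"
    proof (intro exI conjI)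
      show "E \<epsilon> \<subseteq> ?U \<union> ?N" by (auto simp: cb)
      show "?U \<union> ?N \<in> lmeasurable" by (rule fmeasurable.Un[OF U(1) N(1)])
      show "measure lebesgue (?U \<union> ?N) \<le> e"
        using measure_Un_le[of ?U lebesgue ?N] U N by auto
    qed
  qed
  have "{x \<in> {a<..<b}. \<not> (F has_vector_derivative f x) (at x)} \<subseteq> (\<Union>n. E (1 / real (Suc n)))"
  proof
    fix x assume "x \<in> {x \<in> {a<..<b}. \<not> (F has_vector_derivative f x) (at x)}"
    then have x: "x \<in> {a<..<b}" "\<not> (F has_vector_derivative f x) (at x)" by auto
    have "\<exists>\<epsilon>>0. \<forall>d>0. \<exists>y. \<bar>y - x\<bar> < d \<and> \<bar>F y - F x - (y - x) * f x\<bar> > \<epsilon> * \<bar>y - x\<bar>"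
    proof (rule ccontr)
      assume "\<not> ?thesis"
      then have "\<forall>\<epsilon>>0. \<exists>d>0. \<forall>y. \<bar>y - x\<bar> < d \<longrightarrow> \<bar>F y - F x - (y - x) * f x\<bar> \<le> \<epsilon> * \<bar>y - x\<bar>"
        by (meson not_less)
      then have "(F has_vector_derivative f x) (at x)"
        unfolding has_vector_derivative_def has_derivative_within_alt[where s = UNIV, simplified]
        by (auto simp: bounded_linear_mult_left)
      with x show False by blast
    qed
    then obtain \<epsilon> where \<epsilon>: "\<epsilon> > 0" "\<And>d. d > 0 \<Longrightarrow> \<exists>y. \<bar>y - x\<bar> < d \<and> \<bar>F y - F x - (y - x) * f x\<bar> > \<epsilon> * \<bar>y - x\<bar>" by blast
    obtain n where n: "1 / real (Suc n) < \<epsilon>" using \<epsilon>(1) nat_approx_posE by blast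
    have "x \<in> E (1 / real (Suc n))"
      unfolding E_def
    proof (intro CollectI conjI allI impI x)
      fix d :: real assume "d > 0"
      then have "min d (min (x - a) (b - x)) > 0" using x by auto
      from \<epsilon>(2)[OF this] obtain y where y: "\<bar>y - x\<bar> < min d (min (x - a) (b - x))" "\<bar>F y - F x - (y - x) * f x\<bar> > \<epsilon> * \<bar>y - x\<bar>" by blast
      have "1 / real (Suc n) * \<bar>y - x\<bar> \<le> \<epsilon> * \<bar>y - x\<bar>" using n by (intro mult_right_mono) auto
      moreover have "y \<noteq> x" using y(2) by auto
      ultimately show "\<exists>y\<in>{a<..<b}. y \<noteq> x \<and> \<bar>y - x\<bar> < d \<and> 1 / real (Suc n) * \<bar>y - x\<bar> < \<bar>F y - F x - (y - x) * f x\<bar>"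
        using y x by (intro bexI[of _ y]) (auto simp: abs_if split: if_splits)
    qed
    then show "x \<in> (\<Union>n. E (1 / real (Suc n)))" by blast
  qed
  moreover have "negligible (\<Union>n. E (1 / real (Suc n)))"
    by (intro negligible_countable_Union) (auto intro: neg)
  ultimately show ?thesis unfolding F_def by (rule negligible_subset[rotated])
qed

abbreviation half_line :: "real measure" where "half_line \<equiv> lebesgue_on {0<..}"

lemma AE_half_line_iff: "(AE x in half_line. P x) \<longleftrightarrow> negligible {x. x > 0 \<and> \<not> P x}"
proof -
  have "(AE x in half_line. P x) \<longleftrightarrow> (AE x in lebesgue. x > 0 \<longrightarrow> P x)"
    by (subst AE_restrict_space_iff) auto
  also have "\<dots> \<longleftrightarrow> {x. \<not> (x > 0 \<longrightarrow> P x)} \<in> null_sets lebesgue"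
    by (rule eventually_ae_filter[THEN trans]) (auto intro: null_sets_completion_subset)
  also have "{x. \<not> (x > 0 \<longrightarrow> P x)} = {x. x > 0 \<and> \<not> P x}" by auto
  finally show ?thesis by (simp add: negligible_iff_null_sets)
qed

lemma loc_abs_cont_has_integral:
  fixes f :: "real \<Rightarrow> 'a::real_normed_vector"
  assumes f: "loc_abs_cont f" and der: "AE x in half_line. (f has_vector_derivative g x) (at x)"
    and x: "x \<ge> 0"
  shows "(g has_integral (f x - f 0)) {0..x}"
proof (cases "x = 0")
  case True
  then show ?thesis using has_integral_refl(2)[of g 0] by (simp add: cbox_interval)
next
  case False
  then have "x > 0" using x by simp
  let ?N = "insert 0 {x. x > 0 \<and> \<not> (f has_vector_derivative g x) (at x)}"
  show ?thesis
  proof (rule abs_cont_on_integral[of _ _ _ ?N])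
    show "negligible ?N" using der unfolding AE_half_line_iff by (simp add: negligible_insert)
    show "abs_cont_on {0..x} f" using f \<open>x > 0\<close> by (simp add: loc_abs_cont_def)
    fix y assume "y \<in> {0..x} - ?N"
    then show "(f has_vector_derivative g y) (at y within {0..x})"
      by (auto intro: has_vector_derivative_at_within)
  qed (rule x)
qed

lemma half_line_integrable_upto:
  fixes g :: "real \<Rightarrow> 'a::euclidean_space"
  assumes "integrable half_line g"
  shows "integrable half_line (\<lambda>y. indicator {..x} y *\<^sub>R g y)"
proof -
  have "{0<..x} \<in> sets half_line" by (auto simp: sets_restrict_space_iff)
  then have "integrable half_line (\<lambda>y. indicator {0<..x} y *\<^sub>R g y)"
    using assms by (rule integrable_mult_indicator)
  then show ?thesis
    by (rule Bochner_Integration.integrable_cong[OF refl, THEN iffD1, rotated]) (auto simp: indicator_def)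
qed

lemma half_line_has_integral_upto:
  fixes g :: "real \<Rightarrow> 'a::euclidean_space"
  assumes "integrable half_line g"
  shows "(g has_integral (LINT y|half_line. indicator {..x} y *\<^sub>R g y)) {0..x}"
proof -
  have "integrable half_line (\<lambda>y. indicator {..x} y *\<^sub>R g y)"
    using assms by (rule half_line_integrable_upto)
  then have "((\<lambda>y. indicator {..x} y *\<^sub>R g y) has_integral (LINT y|half_line. indicator {..x} y *\<^sub>R g y)) {0<..}"
    by (rule has_integral_integral_lebesgue_on) simp
  moreover have "(\<lambda>y. indicator {..x} y *\<^sub>R g y) = (\<lambda>y. if y \<in> {..x} then g y else 0)"
    by (auto simp: fun_eq_iff)
  ultimately have "((\<lambda>y. if y \<in> {..x} then g y else 0) has_integral (LINT y|half_line. indicator {..x} y *\<^sub>R g y)) {0<..}"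
    by (simp only:)
  then have "(g has_integral (LINT y|half_line. indicator {..x} y *\<^sub>R g y)) ({..x} \<inter> {0<..})"
    by (simp only: has_integral_restrict_Int)
  then show ?thesis
  proof (rule has_integral_spike_set_eq[THEN iffD1, rotated 2])
    show "negligible {y \<in> ({..x} \<inter> {0<..}) - {0..x}. g y \<noteq> 0}" by (rule negligible_subset[of "{}"]) auto
    show "negligible {y \<in> {0..x} - ({..x} \<inter> {0<..}). g y \<noteq> 0}" by (rule negligible_subset[of "{0}"]) auto
  qed
qed

lemma half_line_integral_tendsto:
  fixes g :: "real \<Rightarrow> 'a::euclidean_space"
  assumes g: "integrable half_line g"
  shows "((\<lambda>x. integral {0..x} g) \<longlongrightarrow> integral\<^sup>L half_line g) at_top"
proof -
  have "((\<lambda>x. LINT y|half_line. indicator {..x} y *\<^sub>R g y) \<longlongrightarrow> integral\<^sup>L half_line g) at_top"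
  proof (rule integral_dominated_convergence_at_top)
    show "integrable half_line (\<lambda>x. norm (g x))" using g by (rule integrable_norm)
    show "g \<in> borel_measurable half_line" using g by auto
    show "(\<lambda>y. indicator {..x} y *\<^sub>R g y) \<in> borel_measurable half_line" for x :: real
      by (rule borel_measurable_integrable[OF half_line_integrable_upto[OF g]])
    show "\<forall>\<^sub>F x in at_top. AE y in half_line. norm (indicator {..x} y *\<^sub>R g y) \<le> norm (g y)"
      by (intro always_eventually allI AE_I2) (auto simp: indicator_def)
    show "AE y in half_line. ((\<lambda>x. indicator {..x} y *\<^sub>R g y) \<longlongrightarrow> g y) at_top"
    proof (rule AE_I2)
      fix y :: real
      have "\<forall>\<^sub>F x in at_top. indicator {..x} y *\<^sub>R g y = g y"
        using eventually_ge_at_top[of y] by eventually_elim auto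
      then show "((\<lambda>x. indicator {..x} y *\<^sub>R g y) \<longlongrightarrow> g y) at_top" by (rule tendsto_eventually)
    qed
  qed
  then show ?thesis using half_line_has_integral_upto[OF g, THEN integral_unique] by simp
qed

lemma has_integral_inverse:
  assumes "0 < a" "a \<le> b"
  shows "((\<lambda>x. 1 / x) has_integral (ln b - ln a)) {a..b::real}"
  using assms by (intro fundamental_theorem_of_calculus)
    (auto intro!: derivative_eq_intros simp: has_real_derivative_iff_has_vector_derivative[symmetric])

lemma has_integral_inverse_sqrt:
  assumes "0 < a" "a \<le> b"
  shows "((\<lambda>x. 1 / (2 * sqrt x)) has_integral (sqrt b - sqrt a)) {a..b::real}"
  using assms by (intro fundamental_theorem_of_calculus)
    (auto intro!: derivative_eq_intros simp: has_real_derivative_iff_has_vector_derivative[symmetric] field_simps)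

lemma has_integral_inverse_sqrt_cubed:
  assumes "0 < a" "a \<le> b"
  shows "((\<lambda>x. 1 / (x * sqrt x)) has_integral (2 / sqrt a - 2 / sqrt b)) {a..b::real}"
proof -
  have "((\<lambda>x. 1 / (x * sqrt x)) has_integral ((- 2 / sqrt b) - (- 2 / sqrt a))) {a..b}"
    using assms by (intro fundamental_theorem_of_calculus)
      (auto intro!: derivative_eq_intros simp: has_real_derivative_iff_has_vector_derivative[symmetric] field_simps)
  then show ?thesis by simp
qed

lemma half_line_bounded_integrable:
  fixes g :: "real \<Rightarrow> real"
  assumes g: "g \<in> borel_measurable half_line" and C: "\<And>x. x > 0 \<Longrightarrow> \<bar>g x\<bar> \<le> C" and z: "\<And>x. x > b \<Longrightarrow> g x = 0"
  shows "integrable half_line g"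
proof (rule Bochner_Integration.integrable_bound)
  have "{0<..b} \<in> sets half_line" by (auto simp: sets_restrict_space_iff)
  moreover have "emeasure half_line {0<..b} < \<infinity>"
  proof (cases "0 \<le> b")
    case True
    then show ?thesis by (subst emeasure_restrict_space) auto
  next
    case False
    then have "{0<..b} = {}" by auto
    then show ?thesis by simp
  qed
  ultimately show "integrable half_line (\<lambda>x. C * indicator {0<..b} x)"
    by (intro integrable_mult_right integrable_real_indicator) auto
  have C0: "C \<ge> 0" using C[of 1] abs_ge_zero[of "g 1"] by linarith
  show "AE x in half_line. norm (g x) \<le> norm (C * indicator {0<..b} x)"
    using C C0 z by (intro AE_I2) (auto simp: indicator_def not_le)
qed (rule g)

lemma half_line_indefinite_integral:
  fixes g :: "real \<Rightarrow> real"
  assumes g: "integrable half_line g"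
  shows "AE x in half_line. ((\<lambda>u. integral {0..u} g) has_vector_derivative g x) (at x)"
proof -
  have "negligible {x \<in> {0<..<real n}. \<not> ((\<lambda>u. integral {0..u} g) has_vector_derivative g x) (at x)}" for n
    using half_line_has_integral_upto[OF g] by (intro Lebesgue_differentiation) blast
  then have "negligible (\<Union>n. {x \<in> {0<..<real n}. \<not> ((\<lambda>u. integral {0..u} g) has_vector_derivative g x) (at x)})"
    by (intro negligible_countable_Union) auto
  then show ?thesis
    unfolding AE_half_line_iff
  proof (rule negligible_subset)
    show "{x. 0 < x \<and> \<not> ((\<lambda>u. integral {0..u} g) has_vector_derivative g x) (at x)}
       \<subseteq> (\<Union>n. {x \<in> {0<..<real n}. \<not> ((\<lambda>u. integral {0..u} g) has_vector_derivative g x) (at x)})"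
      using reals_Archimedean2 by (auto simp: greaterThanLessThan_iff)
  qed
qed

lemma half_line_integral_diff:
  fixes g :: "real \<Rightarrow> real"
  assumes g: "integrable half_line g" and xy: "0 \<le> x" "x \<le> y"
  shows "(g has_integral (integral {0..y} g - integral {0..x} g)) {x..y}"
proof -
  have i: "g integrable_on {0..y}" using half_line_has_integral_upto[OF g] by blast
  then have "g integrable_on {x..y}" by (rule integrable_subinterval_real) (use xy in auto)
  moreover have "integral {0..x} g + integral {x..y} g = integral {0..y} g"
    by (rule Henstock_Kurzweil_Integration.integral_combine[OF xy i])
  ultimately show ?thesis by (simp add: has_integral_iff)
qed

lemma half_line_integral_Lipschitz:
  fixes g :: "real \<Rightarrow> real"
  assumes g: "integrable half_line g" and C: "\<And>x. x \<ge> 0 \<Longrightarrow> \<bar>g x\<bar> \<le> C" and xy: "0 \<le> x" "x \<le> y"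
  shows "\<bar>integral {0..y} g - integral {0..x} g\<bar> \<le> C * (y - x)"
proof -
  have "C \<ge> 0" using C[of 0] by simp
  then show ?thesis
    using has_integral_bound_real[OF _ _ half_line_integral_diff[OF g xy], of C "{}"] C xy by auto
qed

lemma half_line_integral_abs_cont:
  fixes g :: "real \<Rightarrow> real"
  assumes g: "integrable half_line g" and C: "\<And>x. x \<ge> 0 \<Longrightarrow> \<bar>g x\<bar> \<le> C"
  shows "loc_abs_cont (\<lambda>x. integral {0..x} g)"
  unfolding loc_abs_cont_def
proof (intro allI impI)
  fix b :: real
  show "abs_cont_on {0..b} (\<lambda>x. integral {0..x} g)"
  proof (rule abs_cont_on_by_modulus[OF abs_cont_on_ident abs_cont_on_ident, of "C + 1"])
    show "C + 1 > 0" using C[of 0] by simp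
    fix u v :: real assume uv: "0 \<le> u" "u \<le> v" "v \<le> b"
    have "\<bar>integral {0..v} g - integral {0..u} g\<bar> \<le> C * (v - u)"
      by (rule half_line_integral_Lipschitz[OF g C uv(1,2)])
    also have "\<dots> \<le> (C + 1) * (norm (v - u) + norm (v - u))"
      using uv C[of 0] by (intro mult_mono) auto
    finally show "norm (integral {0..v} g - integral {0..u} g) \<le> (C + 1) * (norm (v - u) + norm (v - u))" by simp
  qed
qed

section \<open>The essential spectrum of a symmetric relation\<close>

text \<open>Elements of the space are representatives, and vectors of norm zero are not identified: this matches the
  description of \<open>L\<^sup>2\<^sub>H\<close> by functions. Equality of classes is the relation \<open>\<doteq>\<close> below.\<close>

locale semi_inner_space = module sc
  for sc :: "complex \<Rightarrow> 'v \<Rightarrow> 'v::ab_group_add" (infixr "\<odot>" 75) +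
  fixes Y :: "'v set" and ip :: "'v \<Rightarrow> 'v \<Rightarrow> complex"
  assumes Y_subspace: "subspace Y"
    and ip_add: "\<lbrakk>x \<in> Y; y \<in> Y; z \<in> Y\<rbrakk> \<Longrightarrow> ip x (y + z) = ip x y + ip x z"
    and ip_scale: "\<lbrakk>x \<in> Y; y \<in> Y\<rbrakk> \<Longrightarrow> ip x (c \<odot> y) = c * ip x y"
    and ip_cnj: "\<lbrakk>x \<in> Y; y \<in> Y\<rbrakk> \<Longrightarrow> ip y x = cnj (ip x y)"
    and ip_pos: "x \<in> Y \<Longrightarrow> Re (ip x x) \<ge> 0"
begin

definition nrm :: "'v \<Rightarrow> real" where "nrm x = sqrt (Re (ip x x))"

lemma Y_simps [simp, intro]:
  "0 \<in> Y" "\<lbrakk>x \<in> Y; y \<in> Y\<rbrakk> \<Longrightarrow> x + y \<in> Y" "\<lbrakk>x \<in> Y; y \<in> Y\<rbrakk> \<Longrightarrow> x - y \<in> Y" "x \<in> Y \<Longrightarrow> c \<odot> x \<in> Y"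
  "x \<in> Y \<Longrightarrow> - x \<in> Y"
  using Y_subspace subspace_0 subspace_add subspace_diff subspace_scale subspace_neg by auto

lemma nrm_nonneg [simp]: "nrm x \<ge> 0" if "x \<in> Y"
  using that by (simp add: nrm_def ip_pos)

lemma ip_self: "x \<in> Y \<Longrightarrow> ip x x = of_real ((nrm x)\<^sup>2)"
  using ip_cnj[of x x] ip_pos[of x] by (auto simp: nrm_def complex_eq_iff)

lemma nrm_sq: "x \<in> Y \<Longrightarrow> (nrm x)\<^sup>2 = Re (ip x x)"
  by (simp add: nrm_def ip_pos)

lemma ip_zero [simp]: "x \<in> Y \<Longrightarrow> ip x 0 = 0" "x \<in> Y \<Longrightarrow> ip 0 x = 0"
proof -
  show "ip x 0 = 0" if "x \<in> Y" for x using ip_scale[of x 0 0] that by simp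
  then show "ip 0 x = 0" if "x \<in> Y" using ip_cnj[of x 0] that by simp
qed

lemma ip_diff: "\<lbrakk>x \<in> Y; y \<in> Y; z \<in> Y\<rbrakk> \<Longrightarrow> ip x (y - z) = ip x y - ip x z"
  using ip_add[of x "y - z" z] by simp

lemma ip_add_left: "\<lbrakk>x \<in> Y; y \<in> Y; z \<in> Y\<rbrakk> \<Longrightarrow> ip (x + y) z = ip x z + ip y z"
  using ip_cnj[of z "x + y"] ip_cnj[of z x] ip_cnj[of z y] ip_add[of z x y] by simp

lemma ip_diff_left: "\<lbrakk>x \<in> Y; y \<in> Y; z \<in> Y\<rbrakk> \<Longrightarrow> ip (x - y) z = ip x z - ip y z"
  using ip_add_left[of "x - y" y z] by simp

lemma ip_scale_left: "\<lbrakk>x \<in> Y; y \<in> Y\<rbrakk> \<Longrightarrow> ip (c \<odot> x) y = cnj c * ip x y"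
  using ip_cnj[of y "c \<odot> x"] ip_cnj[of y x] ip_scale[of y x c] by simp

lemma ip_sum: "\<lbrakk>x \<in> Y; \<And>g. g \<in> F \<Longrightarrow> y g \<in> Y\<rbrakk> \<Longrightarrow> ip x (\<Sum>g\<in>F. y g) = (\<Sum>g\<in>F. ip x (y g))"
proof (induction F rule: infinite_finite_induct)
  case (insert a F)
  have "(\<Sum>g\<in>F. y g) \<in> Y"
    using insert.prems by (intro subspace_sum[OF Y_subspace]) auto
  then show ?case using insert by (simp add: ip_add)
qed auto

lemma nrm_scale: "x \<in> Y \<Longrightarrow> nrm (c \<odot> x) = cmod c * nrm x"
proof -
  assume x: "x \<in> Y"
  have "ip (c \<odot> x) (c \<odot> x) = (cnj c * c) * ip x x"
    using x by (simp add: ip_scale ip_scale_left)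
  also have "\<dots> = of_real ((cmod c * nrm x)\<^sup>2)"
    using x by (simp add: ip_self power_mult_distrib complex_norm_square flip: of_real_power)
  finally have "(nrm (c \<odot> x))\<^sup>2 = (cmod c * nrm x)\<^sup>2" using x by (simp add: nrm_sq)
  then show ?thesis using x by (simp add: power2_eq_iff_nonneg)
qed

lemma nrm_minus [simp]: "x \<in> Y \<Longrightarrow> nrm (- x) = nrm x"
  using nrm_scale[of x "-1"] by simp

lemma nrm_le_zero_iff [simp]: "x \<in> Y \<Longrightarrow> nrm x \<le> 0 \<longleftrightarrow> nrm x = 0"
  using nrm_nonneg[of x] by linarith

lemma nrm_minus_commute: "\<lbrakk>x \<in> Y; y \<in> Y\<rbrakk> \<Longrightarrow> nrm (x - y) = nrm (y - x)"
  using nrm_scale[of "y - x" "-1"] by simp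

lemma nrm_diff_sq: "\<lbrakk>x \<in> Y; y \<in> Y\<rbrakk> \<Longrightarrow> (nrm (x - y))\<^sup>2 = (nrm x)\<^sup>2 + (nrm y)\<^sup>2 - 2 * Re (ip x y)"
  using ip_cnj[of x y] by (simp add: nrm_sq ip_diff ip_diff_left)

lemma nrm_add_sq: "\<lbrakk>x \<in> Y; y \<in> Y\<rbrakk> \<Longrightarrow> (nrm (x + y))\<^sup>2 = (nrm x)\<^sup>2 + (nrm y)\<^sup>2 + 2 * Re (ip x y)"
  using ip_cnj[of x y] by (simp add: nrm_sq ip_add ip_add_left)

lemma Cauchy_Schwarz: assumes x: "x \<in> Y" and y: "y \<in> Y" shows "cmod (ip x y) \<le> nrm x * nrm y"
proof (cases "ip x y = 0")
  case True
  then show ?thesis using x y by simp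
next
  case False
  define c where "c = ip x y"
  have c: "(cmod c)\<^sup>2 > 0" using False c_def by simp
  have key: "0 \<le> (nrm x)\<^sup>2 - 2 * t * (cmod c)\<^sup>2 + t\<^sup>2 * (cmod c)\<^sup>2 * (nrm y)\<^sup>2" for t :: real
  proof -
    have "Re (ip x ((of_real t * cnj c) \<odot> y)) = Re (of_real t * (cnj c * c))"
      using x y by (simp add: ip_scale c_def mult_ac)
    also have "cnj c * c = of_real ((cmod c)\<^sup>2)"
      by (simp add: complex_norm_square mult.commute flip: of_real_power)
    also have "Re (of_real t * of_real ((cmod c)\<^sup>2)) = t * (cmod c)\<^sup>2" by simp
    finally show ?thesis
      using nrm_diff_sq[of x "(of_real t * cnj c) \<odot> y"] x y zero_le_power2[of "nrm (x - (of_real t * cnj c) \<odot> y)"]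
      by (simp add: nrm_scale norm_mult power_mult_distrib mult_ac)
  qed
  have N: "nrm y > 0"
  proof (rule ccontr)
    assume "\<not> ?thesis" then have "nrm y = 0" using nrm_nonneg[OF y] by linarith
    with key[of "((nrm x)\<^sup>2 + 1) / (2 * (cmod c)\<^sup>2)"] show False using c by (simp add: field_simps)
  qed
  have "0 \<le> (nrm x)\<^sup>2 - (cmod c)\<^sup>2 / (nrm y)\<^sup>2"
    using key[of "1 / (nrm y)\<^sup>2"] N by (simp add: field_simps power2_eq_square)
  then have "(cmod c)\<^sup>2 \<le> (nrm x * nrm y)\<^sup>2" using N by (simp add: field_simps)
  then show ?thesis using x y c_def by (simp add: power2_le_iff_abs_le)
qed

lemma nrm_triangle: assumes "x \<in> Y" "y \<in> Y" shows "nrm (x + y) \<le> nrm x + nrm y"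
proof -
  have "(nrm (x + y))\<^sup>2 \<le> (nrm x + nrm y)\<^sup>2"
    using Cauchy_Schwarz[OF assms] complex_Re_le_cmod[of "ip x y"] assms
    by (simp add: nrm_add_sq power2_sum)
  then show ?thesis using assms by (simp add: power2_le_iff_abs_le)
qed

lemma nrm_triangle_diff: assumes "x \<in> Y" "y \<in> Y" shows "nrm (x - y) \<le> nrm x + nrm y"
  using nrm_triangle[of x "(-1) \<odot> y"] assms by (simp add: nrm_scale)

lemma nrm_triangle3: assumes "x \<in> Y" "y \<in> Y" "z \<in> Y" shows "nrm (x - z) \<le> nrm (x - y) + nrm (y - z)"
  using nrm_triangle[of "x - y" "y - z"] assms by simp

lemma nrm_zero [simp]: "nrm 0 = 0"
  by (simp add: nrm_def)

definition eqv :: "'v \<Rightarrow> 'v \<Rightarrow> bool" (infix "\<doteq>" 50)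
  where "x \<doteq> y \<longleftrightarrow> x \<in> Y \<and> y \<in> Y \<and> nrm (x - y) = 0"

lemma eqv_refl [simp]: "x \<in> Y \<Longrightarrow> x \<doteq> x" by (simp add: eqv_def)

lemma eqv_sym: "x \<doteq> y \<Longrightarrow> y \<doteq> x"
  using nrm_minus_commute by (auto simp: eqv_def)

lemma eqv_trans [trans]: "x \<doteq> y \<Longrightarrow> y \<doteq> z \<Longrightarrow> x \<doteq> z"
  using nrm_triangle3[of x y z] nrm_le_zero_iff[of "x - z"] by (auto simp: eqv_def)

lemma eqv_ip: assumes "x \<doteq> y" "z \<in> Y" shows "ip z x = ip z y" "ip x z = ip y z"
proof -
  have "cmod (ip z (x - y)) \<le> 0"
    using Cauchy_Schwarz[of z "x - y"] assms by (auto simp: eqv_def)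
  then show *: "ip z x = ip z y" using assms by (simp add: ip_diff eqv_def)
  show "ip x z = ip y z" using * assms ip_cnj[of z x] ip_cnj[of z y] by (auto simp: eqv_def)
qed

lemma eqv_nrm: "x \<doteq> y \<Longrightarrow> nrm x = nrm y"
  using eqv_ip[of x y x] eqv_ip[of x y y] by (auto simp: nrm_def eqv_def)

lemma eqv_add: assumes "x \<doteq> y" "x' \<doteq> y'" shows "x + x' \<doteq> y + y'"
proof -
  have "nrm ((x - y) + (x' - y')) \<le> 0"
    using nrm_triangle[of "x - y" "x' - y'"] assms by (auto simp: eqv_def)
  then have "nrm ((x - y) + (x' - y')) = 0" using assms by (subst (asm) nrm_le_zero_iff) (auto simp: eqv_def)
  moreover have "(x + x') - (y + y') = (x - y) + (x' - y')" by simp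
  ultimately have "nrm ((x + x') - (y + y')) = 0" by (simp only:)
  then show ?thesis using assms by (auto simp: eqv_def)
qed

lemma eqv_scale: "x \<doteq> y \<Longrightarrow> c \<odot> x \<doteq> c \<odot> y"
  using nrm_scale[of "x - y" c] by (simp add: eqv_def scale_right_diff_distrib)

lemma eqv_diff: assumes "x \<doteq> y" "x' \<doteq> y'" shows "x - x' \<doteq> y - y'"
  using eqv_add[OF assms(1) eqv_scale[OF assms(2), of "-1"]] by simp

lemma eqvI:  "\<lbrakk>x \<in> Y; y \<in> Y; nrm (x - y) \<le> 0\<rbrakk> \<Longrightarrow> x \<doteq> y"
  by (simp add: eqv_def)

end

text \<open>The resolvent iteration and the projection onto an eigenspace below converge geometrically, so completeness
  is stated for sequences of this kind.\<close>

locale semi_hilbert = semi_inner_space +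
  assumes geometric_complete:
    "\<lbrakk>\<And>n. u n \<in> Y; 0 \<le> \<rho>; \<rho> < 1; \<And>n. nrm (u (Suc n) - u n) \<le> K * \<rho> ^ n\<rbrakk>
     \<Longrightarrow> \<exists>v\<in>Y. (\<lambda>n. nrm (u n - v)) \<longlonglongrightarrow> 0"

text \<open>A symmetric linear relation on \<open>Y\<close>, invariant under change of representatives. Below, \<open>mul\<close> is its
  multi-valued part, \<open>A\<close> its operator part, acting in the orthogonal complement \<open>X\<close> of \<open>mul\<close>, and \<open>rho\<close>,
  \<open>spec\<close>, \<open>disc\<close>, \<open>ess\<close> are the resolvent set and the spectra of \<open>A\<close>.\<close>

locale symmetric_relation = semi_hilbert +
  fixes S
  assumes S_Y: "(f, h) \<in> S \<Longrightarrow> f \<in> Y \<and> h \<in> Y"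
    and S_zero: "(0, 0) \<in> S"
    and S_add: "\<lbrakk>(f, h) \<in> S; (g, k) \<in> S\<rbrakk> \<Longrightarrow> (f + g, h + k) \<in> S"
    and S_scale: "(f, h) \<in> S \<Longrightarrow> (c \<odot> f, c \<odot> h) \<in> S"
    and S_cong: "\<lbrakk>(f, h) \<in> S; f \<doteq> f'; h \<doteq> h'\<rbrakk> \<Longrightarrow> (f', h') \<in> S"
    and S_sym: "\<lbrakk>(f, h) \<in> S; (g, k) \<in> S\<rbrakk> \<Longrightarrow> ip f k = ip h g"
begin

definition mul where "mul = {h. (0, h) \<in> S}"
definition X where "X = {g \<in> Y. \<forall>h\<in>mul. ip h g = 0}"
definition A where "A = {(f, h) \<in> S. f \<in> X \<and> h \<in> X}"
definition rho where "rho = {z. (\<forall>g\<in>X. \<exists>(f, h)\<in>A. h - z \<odot> f \<doteq> g) \<and>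
     (\<exists>C. \<forall>(f, h)\<in>A. nrm f \<le> C * nrm (h - z \<odot> f))}"
definition spec where "spec = - rho"
definition eig where "eig z = {f. (f, z \<odot> f) \<in> A}"
definition disc where "disc = {z. z isolated_in spec \<and> (\<exists>f\<in>eig z. nrm f \<noteq> 0) \<and>
     (\<exists>F. finite F \<and> F \<subseteq> eig z \<and> (\<forall>f\<in>eig z. \<exists>c. f \<doteq> (\<Sum>g\<in>F. c g \<odot> g)))}"
definition ess where "ess = spec - disc"

lemma S_diff: "\<lbrakk>(f, h) \<in> S; (g, k) \<in> S\<rbrakk> \<Longrightarrow> (f - g, h - k) \<in> S"
  using S_add[of f h "(-1) \<odot> g" "(-1) \<odot> k"] S_scale[of g k "-1"] by simp

lemma mul_Y: "h \<in> mul \<Longrightarrow> h \<in> Y"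
  using S_Y by (auto simp: mul_def)

lemma X_Y: "x \<in> X \<Longrightarrow> x \<in> Y" by (simp add: X_def)

lemma X_simps [simp, intro]:
  "0 \<in> X" "\<lbrakk>x \<in> X; y \<in> X\<rbrakk> \<Longrightarrow> x + y \<in> X" "\<lbrakk>x \<in> X; y \<in> X\<rbrakk> \<Longrightarrow> x - y \<in> X" "x \<in> X \<Longrightarrow> c \<odot> x \<in> X"
  by (auto simp: X_def ip_add ip_diff ip_scale mul_Y)

lemma X_cong: "x \<in> X \<Longrightarrow> x \<doteq> y \<Longrightarrow> y \<in> X"
  using eqv_ip(1)[of x y] mul_Y by (auto simp: X_def eqv_def)

text \<open>If \<open>(0, k)\<close> and \<open>(f, h)\<close> belong to \<open>S\<close>, symmetry gives \<open>ip k f = ip 0 h = 0\<close>.\<close>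

lemma S_dom_X: "(f, h) \<in> S \<Longrightarrow> f \<in> X"
  using S_sym[of 0 _ f h] S_Y[of f h] by (auto simp: X_def mul_def)

lemma X_complete:
  assumes u: "\<And>n. u n \<in> X" and "0 \<le> \<rho>" "\<rho> < 1"
    and "\<And>n. nrm (u (Suc n) - u n) \<le> c * \<rho> ^ n"
  obtains v where "v \<in> X" "(\<lambda>n. nrm (u n - v)) \<longlonglongrightarrow> 0"
proof -
  have "\<exists>v\<in>Y. (\<lambda>n. nrm (u n - v)) \<longlonglongrightarrow> 0"
    using geometric_complete[of u \<rho> c] assms X_Y by auto
  then obtain v where v: "v \<in> Y" and lim: "(\<lambda>n. nrm (u n - v)) \<longlonglongrightarrow> 0" by blast
  have "ip h v = 0" if h: "h \<in> mul" for h
  proof -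
    have "cmod (ip h v) \<le> nrm h * nrm (u n - v)" for n
    proof -
      have "ip h (u n) = 0" using u h by (auto simp: X_def)
      then have "ip h (u n - v) = - ip h v"
        using X_Y[OF u[of n]] v h by (simp add: ip_diff mul_Y)
      then show ?thesis using Cauchy_Schwarz[of h "u n - v"] X_Y[OF u[of n]] v h by (simp add: mul_Y)
    qed
    moreover have "(\<lambda>n. nrm h * nrm (u n - v)) \<longlonglongrightarrow> nrm h * 0"
      by (intro tendsto_intros lim)
    ultimately have "cmod (ip h v) \<le> 0"
      by (intro LIMSEQ_le_const[of _ "0"]) auto
    then show ?thesis by simp
  qed
  then show ?thesis using that v lim by (auto simp: X_def)
qed

declare X_Y [simp, intro]

lemma A_X: "(f, h) \<in> A \<Longrightarrow> f \<in> X \<and> h \<in> X" by (auto simp: A_def)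

lemma A_S: "(f, h) \<in> A \<Longrightarrow> (f, h) \<in> S" by (auto simp: A_def)

lemma A_add: "\<lbrakk>(f, h) \<in> A; (g, k) \<in> A\<rbrakk> \<Longrightarrow> (f + g, h + k) \<in> A"
  by (auto simp: A_def S_add)

lemma A_diff: "\<lbrakk>(f, h) \<in> A; (g, k) \<in> A\<rbrakk> \<Longrightarrow> (f - g, h - k) \<in> A"
  by (auto simp: A_def S_diff)

lemma A_scale: "(f, h) \<in> A \<Longrightarrow> (c \<odot> f, c \<odot> h) \<in> A"
  by (auto simp: A_def S_scale)

lemma A_cong: "\<lbrakk>(f, h) \<in> A; f \<doteq> f'; h \<doteq> h'\<rbrakk> \<Longrightarrow> (f', h') \<in> A"
  unfolding A_def using S_cong X_cong by blast

lemma rho_solve: assumes "z \<in> rho" "g \<in> X" obtains f h where "(f, h) \<in> A" "h - z \<odot> f \<doteq> g"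
  using assms unfolding rho_def by blast

lemma rho_bound: assumes "z \<in> rho"
  obtains C where "C > 0" "\<And>f h. (f, h) \<in> A \<Longrightarrow> nrm f \<le> C * nrm (h - z \<odot> f)"
proof -
  obtain C where C: "\<And>f h. (f, h) \<in> A \<Longrightarrow> nrm f \<le> C * nrm (h - z \<odot> f)"
    using assms unfolding rho_def by blast
  have "nrm f \<le> max C 1 * nrm (h - z \<odot> f)" if "(f, h) \<in> A" for f h
    using C[OF that] A_X[OF that] by (smt (verit) mult_right_mono nrm_nonneg X_Y X_simps)
  then show ?thesis using that[of "max C 1"] by auto
qed

text \<open>The equation \<open>(A - w) f = g\<close> is \<open>(A - z) f = g + (w - z) f\<close>, and \<open>v \<mapsto> (A - z)\<^sup>-\<^sup>1 (g + (w - z) v)\<close> is a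
  contraction with factor \<open>1/2\<close>. Its fixed point \<open>v\<close> is equivalent to an
  element of the domain of \<open>A\<close>, namely the image of \<open>v\<close> under this map.\<close>

lemma rho_nbhd:
  assumes z: "z \<in> rho" and C: "C > 0" "\<And>f h. (f, h) \<in> A \<Longrightarrow> nrm f \<le> C * nrm (h - z \<odot> f)"
    and w: "2 * C * cmod (w - z) \<le> 1"
  shows "w \<in> rho"
proof -
  have bound: "nrm f \<le> 2 * C * nrm (h - w \<odot> f)" if fh: "(f, h) \<in> A" for f h
  proof -
    have X: "f \<in> Y" "h \<in> Y" using A_X[OF fh] by auto
    have "nrm (h - z \<odot> f) = nrm ((h - w \<odot> f) + (w - z) \<odot> f)"
      by (simp add: scale_left_diff_distrib)
    also have "\<dots> \<le> nrm (h - w \<odot> f) + cmod (w - z) * nrm f"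
      using nrm_triangle[of "h - w \<odot> f" "(w - z) \<odot> f"] X by (simp add: nrm_scale)
    finally have le: "nrm (h - z \<odot> f) \<le> nrm (h - w \<odot> f) + cmod (w - z) * nrm f" .
    have "nrm f \<le> C * (nrm (h - w \<odot> f) + cmod (w - z) * nrm f)"
      using order_trans[OF C(2)[OF fh] mult_left_mono[OF le]] C(1) by simp
    moreover have "2 * (C * (cmod (w - z) * nrm f)) \<le> nrm f"
      using mult_right_mono[OF w nrm_nonneg[OF X(1)]] by (simp add: mult_ac)
    ultimately show ?thesis by (simp add: algebra_simps)
  qed
  have onto: "\<exists>(f, h)\<in>A. h - w \<odot> f \<doteq> g" if g: "g \<in> X" for g
  proof -
    have "\<forall>v\<in>X. \<exists>p. p \<in> A \<and> snd p - z \<odot> fst p \<doteq> g + (w - z) \<odot> v"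
    proof
      fix v assume "v \<in> X"
      then have "g + (w - z) \<odot> v \<in> X" using g by simp
      from rho_solve[OF z this] obtain f h where "(f, h) \<in> A" "h - z \<odot> f \<doteq> g + (w - z) \<odot> v" .
      then show "\<exists>p. p \<in> A \<and> snd p - z \<odot> fst p \<doteq> g + (w - z) \<odot> v" by (intro exI[of _ "(f, h)"]) simp
    qed
    from bchoice[OF this] obtain T where T: "\<And>v. v \<in> X \<Longrightarrow> T v \<in> A"
      "\<And>v. v \<in> X \<Longrightarrow> snd (T v) - z \<odot> fst (T v) \<doteq> g + (w - z) \<odot> v" by auto
    have contr: "2 * nrm (fst (T v) - fst (T v')) \<le> nrm (v - v')" if v: "v \<in> X" "v' \<in> X" for v v'
    proof -
      have "(fst (T v) - fst (T v'), snd (T v) - snd (T v')) \<in> A"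
        using A_diff T(1) v by simp
      then have "nrm (fst (T v) - fst (T v')) \<le> C * nrm (snd (T v) - snd (T v') - z \<odot> (fst (T v) - fst (T v')))"
        by (rule C(2))
      also have "snd (T v) - snd (T v') - z \<odot> (fst (T v) - fst (T v')) \<doteq> (g + (w - z) \<odot> v) - (g + (w - z) \<odot> v')"
        using eqv_diff[OF T(2)[OF v(1)] T(2)[OF v(2)]] by (simp add: scale_right_diff_distrib algebra_simps)
      then have "nrm (snd (T v) - snd (T v') - z \<odot> (fst (T v) - fst (T v'))) = nrm ((w - z) \<odot> (v - v'))"
        by (simp add: eqv_nrm scale_right_diff_distrib)
      also have "2 * (C * nrm ((w - z) \<odot> (v - v'))) \<le> nrm (v - v')"
        using mult_right_mono[OF w nrm_nonneg[of "v - v'"]] v by (simp add: nrm_scale mult_ac)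
      finally show ?thesis by linarith
    qed
    have TX: "fst (T v) \<in> X" if "v \<in> X" for v using T(1)[OF that] A_X by (cases "T v") auto
    define u where "u n = ((\<lambda>v. fst (T v)) ^^ n) 0" for n
    have uX: "u n \<in> X" for n by (induction n) (auto simp: u_def TX)
    have "nrm (u (Suc n) - u n) \<le> nrm (u 1 - u 0) * (1/2) ^ n" for n
    proof (induction n)
      case (Suc n)
      have "2 * nrm (u (Suc (Suc n)) - u (Suc n)) \<le> nrm (u (Suc n) - u n)"
        using contr[OF uX uX, of "Suc n" n] by (simp add: u_def)
      with Suc show ?case by simp
    qed simp
    then obtain v where v: "v \<in> X" and lim: "(\<lambda>n. nrm (u n - v)) \<longlonglongrightarrow> 0"
      using X_complete[of u "1/2" "nrm (u 1 - u 0)"] uX by auto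
    have "nrm (fst (T v) - v) \<le> nrm (u n - v) + nrm (u (Suc n) - v)" for n
    proof -
      have "nrm (fst (T v) - v) \<le> nrm (fst (T v) - u (Suc n)) + nrm (u (Suc n) - v)"
        using nrm_triangle3 TX[OF v] uX v by auto
      also have "nrm (fst (T v) - u (Suc n)) = nrm (fst (T (u n)) - fst (T v))"
        using nrm_minus_commute[OF X_Y[OF TX[OF v]] X_Y[OF uX[of "Suc n"]]] by (simp add: u_def)
      also have "\<dots> \<le> nrm (u n - v)"
        using contr[OF uX[of n] v] nrm_nonneg[OF X_Y[OF X_simps(3)[OF TX[OF uX[of n]] TX[OF v]]]]
        by linarith
      finally show ?thesis by linarith
    qed
    moreover have "(\<lambda>n. nrm (u n - v) + nrm (u (Suc n) - v)) \<longlonglongrightarrow> 0 + 0"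
      by (intro tendsto_add lim LIMSEQ_Suc)
    ultimately have "nrm (fst (T v) - v) \<le> 0 + 0"
      by (intro LIMSEQ_le_const[of _ "0 + 0"]) auto
    then have fixp: "fst (T v) \<doteq> v" using TX[OF v] v by (intro eqvI) auto
    have "snd (T v) - z \<odot> fst (T v) - (w - z) \<odot> fst (T v) \<doteq> (g + (w - z) \<odot> v) - (w - z) \<odot> v"
      by (intro eqv_diff T(2) v eqv_scale fixp)
    then have "snd (T v) - w \<odot> fst (T v) \<doteq> g" by (simp add: scale_left_diff_distrib)
    then show ?thesis using T(1)[OF v] by (intro bexI[of _ "T v"]) auto
  qed
  show ?thesis unfolding rho_def using bound onto by auto
qed

lemma closed_spec: "closed spec"
proof -
  have "open rho"
    unfolding open_dist
  proof
    fix z assume z: "z \<in> rho"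
    from rho_bound[OF z] obtain C where C: "C > 0" "\<And>f h. (f, h) \<in> A \<Longrightarrow> nrm f \<le> C * nrm (h - z \<odot> f)" by blast
    have "\<forall>w. dist w z < 1 / (2 * C) \<longrightarrow> w \<in> rho"
      using rho_nbhd[OF z C] C(1) by (auto simp: dist_norm field_simps)
    then show "\<exists>e>0. \<forall>w. dist w z < e \<longrightarrow> w \<in> rho" using C(1) by (intro exI[of _ "1 / (2 * C)"]) auto
  qed
  then show ?thesis by (simp add: spec_def closed_Compl)
qed

text \<open>A limit point of the essential spectrum lies in the closed set \<open>spec\<close> and is not isolated there.\<close>

lemma closed_ess: "closed ess"
  unfolding closed_limpt
proof (intro allI impI)
  fix z assume "z islimpt ess"
  then have l: "z islimpt spec" unfolding ess_def by (meson Diff_subset islimpt_subset)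
  then have "z \<in> spec" using closed_spec closed_limpt by blast
  moreover have "z \<notin> disc" using l by (auto simp: disc_def isolated_in_islimpt_iff)
  ultimately show "z \<in> ess" by (simp add: ess_def)
qed

text \<open>The part of \<open>X\<close> orthogonal to \<open>G\<close>; it is invariant under the resolvents when \<open>G\<close> consists of eigenvectors.\<close>

definition perp where "perp G = {x \<in> X. \<forall>e\<in>G. ip e x = 0}"

lemma perp_X: "x \<in> perp G \<Longrightarrow> x \<in> X" by (simp add: perp_def)

lemma perp_cong: "\<lbrakk>G \<subseteq> Y; x \<in> perp G; x \<doteq> y\<rbrakk> \<Longrightarrow> y \<in> perp G"
  using X_cong[of x y] eqv_ip(1)[of x y] unfolding perp_def by (simp add: subset_iff)

lemma perp_add: "\<lbrakk>G \<subseteq> Y; x \<in> perp G; y \<in> perp G\<rbrakk> \<Longrightarrow> x + y \<in> perp G"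
  by (simp add: perp_def ip_add subset_iff)

lemma perp_scale: "\<lbrakk>G \<subseteq> Y; x \<in> perp G\<rbrakk> \<Longrightarrow> c \<odot> x \<in> perp G"
  by (simp add: perp_def ip_scale subset_iff)

text \<open>Let \<open>B\<close> be the inverse of \<open>A - m\<close> on \<open>perp G\<close> and \<open>b\<close> the best constant in \<open>\<parallel>B g\<parallel> \<le> b \<parallel>g\<parallel>\<close>; the claim is
  \<open>b \<le> 1 / \<delta>\<close>. Otherwise \<open>m + 1 / b\<close> and \<open>m - 1 / b\<close> are within \<open>\<delta>\<close> of \<open>m\<close>. The lower bounds of \<open>A\<close> at these two points
  are lower bounds of \<open>B - b\<close> and \<open>B + b\<close> on \<open>perp G\<close>. Hence \<open>B\<^sup>2 - b\<^sup>2\<close> is bounded below there as well. But symmetry of \<open>B\<close> gives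
  \<open>\<parallel>(B\<^sup>2 - b\<^sup>2) g\<parallel>\<^sup>2 \<le> b\<^sup>2 (b\<^sup>2 \<parallel>g\<parallel>\<^sup>2 - \<parallel>B g\<parallel>\<^sup>2)\<close>, so \<open>\<parallel>B g\<parallel>\<^sup>2\<close> stays below \<open>b\<^sup>2 \<parallel>g\<parallel>\<^sup>2\<close> by a fixed fraction of
  \<open>\<parallel>g\<parallel>\<^sup>2\<close>, contradicting the choice of \<open>b\<close>.\<close>

lemma gap_bound:
  fixes m \<delta> :: real
  assumes m: "of_real m \<in> rho" and G: "\<And>e. e \<in> G \<Longrightarrow> \<exists>z. e \<in> eig z"
    and \<delta>: "\<delta> > 0"
    and bb: "\<And>t. \<lbrakk>t \<noteq> 0; \<bar>t\<bar> < \<delta>\<rbrakk> \<Longrightarrow>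
      \<exists>C. \<forall>(a, b)\<in>A. a \<in> perp G \<longrightarrow> nrm a \<le> C * nrm (b - of_real (m + t) \<odot> a)"
    and uk: "(u, k) \<in> A" "k - of_real m \<odot> u \<in> perp G"
  shows "\<delta> * nrm u \<le> nrm (k - of_real m \<odot> u)"
proof -
  define P where "P \<beta> \<longleftrightarrow> 0 \<le> \<beta> \<and> (\<forall>(u, k)\<in>A. k - of_real m \<odot> u \<in> perp G \<longrightarrow> nrm u \<le> \<beta> * nrm (k - of_real m \<odot> u))" for \<beta>
  obtain C where C: "C > 0" "\<And>f h. (f, h) \<in> A \<Longrightarrow> nrm f \<le> C * nrm (h - of_real m \<odot> f)"
    using rho_bound[OF m] by blast
  have GY: "G \<subseteq> Y" using G A_X by (auto simp: eig_def)
  have "P C" using C by (auto simp: P_def)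
  define b where "b = Inf (Collect P)"
  have bdd: "bdd_below (Collect P)" by (auto simp: P_def intro: bdd_belowI[of _ 0])
  have b0: "b \<ge> 0" unfolding b_def using \<open>P C\<close> by (intro cInf_greatest) (auto simp: P_def)
  have Pb: "nrm u \<le> b * nrm (k - of_real m \<odot> u)" if uk: "(u, k) \<in> A" "k - of_real m \<odot> u \<in> perp G" for u k
  proof (rule ccontr)
    assume neg: "\<not> ?thesis"
    let ?g = "nrm (k - of_real m \<odot> u)"
    have g: "?g > 0"
    proof (rule ccontr)
      assume "\<not> ?g > 0"
      then have "?g = 0" using nrm_nonneg[OF X_Y[OF perp_X[OF uk(2)]]] by linarith
      then have "nrm u \<le> 0" using C(2)[OF uk(1)] by simp
      then show False using neg \<open>?g = 0\<close> by simp
    qed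
    then have "b < nrm u / ?g" using neg by (simp add: field_simps)
    then obtain \<beta> where "P \<beta>" "\<beta> < nrm u / ?g" unfolding b_def using \<open>P C\<close> cInf_lessD[of "Collect P"] by blast
    then show False using uk g by (auto simp: P_def field_simps)
  qed
  have "b \<le> 1 / \<delta>"
  proof (rule ccontr)
    assume "\<not> b \<le> 1 / \<delta>"
    then have "1 / \<delta> < b" by simp
    moreover from this have "b > 0" using \<delta> by (meson divide_pos_pos less_trans zero_less_one)
    ultimately have b: "b > 0" "1 / b < \<delta>" using \<delta> by (auto simp: field_simps)
    obtain C1 where C1: "\<And>a c. \<lbrakk>(a, c) \<in> A; a \<in> perp G\<rbrakk> \<Longrightarrow> nrm a \<le> C1 * nrm (c - of_real (m + 1 / b) \<odot> a)"
      using bb[of "1 / b"] b by auto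
    obtain C2 where C2: "\<And>a c. \<lbrakk>(a, c) \<in> A; a \<in> perp G\<rbrakk> \<Longrightarrow> nrm a \<le> C2 * nrm (c - of_real (m + - 1 / b) \<odot> a)"
      using bb[of "- 1 / b"] b by auto
    \<comment> \<open>\<open>B = (A - m)\<^sup>-\<^sup>1\<close> preserves \<open>perp G\<close>\<close>
    have inv: "u \<in> perp G" if uk: "(u, k) \<in> A" "k - of_real m \<odot> u \<in> perp G" for u k
    proof -
      have "ip e u = 0" if e: "e \<in> G" for e
      proof -
        obtain z where z: "(e, z \<odot> e) \<in> A" using G[OF e] by (auto simp: eig_def)
        have Y: "e \<in> Y" "u \<in> Y" "k \<in> Y" using A_X[OF z] A_X[OF uk(1)] by auto
        have "ip e k = cnj z * ip e u" using S_sym[OF A_S[OF z] A_S[OF uk(1)]] Y by (simp add: ip_scale_left)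
        moreover have "ip e (k - of_real m \<odot> u) = 0" using uk(2) e by (simp add: perp_def)
        then have "ip e k = of_real m * ip e u" using Y by (simp add: ip_diff ip_scale)
        ultimately have *: "ip e u = 0 \<or> cnj z = of_real m" by auto
        show ?thesis
        proof (cases "z = of_real m")
          case True
          then have "nrm e \<le> 0" using C(2)[OF z] by simp
          then have "e \<doteq> 0" using Y by (simp add: eqv_def)
          then show ?thesis using eqv_ip(2)[of e 0 u] Y by simp
        next
          case False
          then have "cnj z \<noteq> of_real m" by (metis complex_cnj_cnj complex_cnj_complex_of_real)
          with * show ?thesis by blast
        qed
      qed
      then show ?thesis using A_X[OF uk(1)] by (auto simp: perp_def)
    qed
    \<comment> \<open>lower bounds for \<open>B - b\<close> (\<open>s = 1\<close>) and \<open>B + b\<close> (\<open>s = -1\<close>) from those of \<open>A\<close> at \<open>m + s / b\<close>; here \<open>a = B w\<close>\<close>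
    have lower: "nrm w \<le> (1 / b) * (1 + C' / b) * nrm (a - (s * b) \<odot> w)"
      if w: "(a, c) \<in> A" "c - of_real m \<odot> a \<doteq> w" "w \<in> perp G" and s: "s = 1 \<or> s = (-1::complex)"
        and C': "C' \<ge> 0" "nrm a \<le> C' * nrm (c - (of_real m + s / b) \<odot> a)" for w a c s C'
    proof -
      have Y: "w \<in> Y" "a \<in> Y" "c \<in> Y" using w A_X[OF w(1)] perp_X by auto
      have ss: "s * s = 1" "cmod s = 1" using s by auto
      have 1: "nrm (c - (of_real m + s / b) \<odot> a) = nrm (a - (s * b) \<odot> w) / b"
      proof -
        have "c - (of_real m + s / b) \<odot> a = (c - of_real m \<odot> a) - (s / b) \<odot> a"
          by (simp add: scale_left_distrib)
        also have "\<dots> \<doteq> w - (s / b) \<odot> a" using w(2) Y by (intro eqv_diff) auto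
        also have "w - (s / b) \<odot> a = (- s / b) \<odot> (a - (s * b) \<odot> w)"
          using ss b by (simp add: scale_right_diff_distrib)
        finally show ?thesis using Y ss b by (simp add: eqv_nrm nrm_scale norm_divide)
      qed
      have "nrm w = nrm ((s / b) \<odot> a + (- s / b) \<odot> (a - (s * b) \<odot> w))"
        using ss b by (simp add: scale_right_diff_distrib)
      also have "\<dots> \<le> nrm a / b + nrm (a - (s * b) \<odot> w) / b"
        using nrm_triangle[of "(s / b) \<odot> a" "(- s / b) \<odot> (a - (s * b) \<odot> w)"] Y ss b
        by (simp add: nrm_scale norm_divide)
      also have "\<dots> \<le> (C' * (nrm (a - (s * b) \<odot> w) / b)) / b + nrm (a - (s * b) \<odot> w) / b"
        using C'(2) b unfolding 1 by (intro add_mono divide_right_mono) auto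
      finally show ?thesis using b by (simp add: field_simps)
    qed
    define K1 where "K1 = (1 / b) * (1 + max C1 0 / b)"
    define K2 where "K2 = (1 / b) * (1 + max C2 0 / b)"
    have K: "K1 > 0" "K2 > 0" unfolding K1_def K2_def
      by (intro mult_pos_pos add_pos_nonneg divide_nonneg_pos; use b in simp)+
    have improve: "(nrm u)\<^sup>2 \<le> (b\<^sup>2 - 1 / (K1 * K2 * b)\<^sup>2) * (nrm (k - of_real m \<odot> u))\<^sup>2"
      if uk: "(u, k) \<in> A" "k - of_real m \<odot> u \<in> perp G" for u k
    proof -
      define g where "g = k - of_real m \<odot> u"
      have uG: "u \<in> perp G" and gG: "g \<in> perp G" using inv[OF uk] uk(2) by (auto simp: g_def)
      obtain v l where v: "(v, l) \<in> A" "l - of_real m \<odot> v \<doteq> u"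
        using rho_solve[OF m perp_X[OF uG]] by blast
      have Y: "u \<in> Y" "k \<in> Y" "g \<in> Y" "v \<in> Y" "l \<in> Y"
        using A_X[OF v(1)] A_X[OF uk(1)] perp_X[OF gG] by auto
      have lG: "l - of_real m \<odot> v \<in> perp G"
        by (rule perp_cong[OF GY uG eqv_sym[OF v(2)]])
      have vG: "v \<in> perp G" by (rule inv[OF v(1) lG])
      have gv: "ip v g = of_real ((nrm u)\<^sup>2)"
      proof -
        have "ip v g = ip v k - of_real m * ip v u" using Y by (simp add: g_def ip_diff ip_scale)
        also have "ip v k = ip l u" by (rule S_sym[OF A_S[OF v(1)] A_S[OF uk(1)]])
        also have "ip l u - of_real m * ip v u = ip (l - of_real m \<odot> v) u"
          using Y by (simp add: ip_diff_left ip_scale_left)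
        also have "\<dots> = ip u u" using v(2) Y by (simp add: eqv_ip(2))
        finally show ?thesis using Y by (simp add: ip_self)
      qed
      have 1: "(nrm (v - of_real (b\<^sup>2) \<odot> g))\<^sup>2 \<le> b\<^sup>2 * (b\<^sup>2 * (nrm g)\<^sup>2 - (nrm u)\<^sup>2)"
      proof -
        have "nrm v \<le> b * nrm u" using Pb[OF v(1) lG] eqv_nrm[OF v(2)] by simp
        then have "(nrm v)\<^sup>2 \<le> b\<^sup>2 * (nrm u)\<^sup>2" using Y by (metis power_mono nrm_nonneg power_mult_distrib)
        moreover have "(nrm (v - of_real (b\<^sup>2) \<odot> g))\<^sup>2 = (nrm v)\<^sup>2 + (b\<^sup>2 * nrm g)\<^sup>2 - 2 * (b\<^sup>2 * (nrm u)\<^sup>2)"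
          using nrm_diff_sq[of v "of_real (b\<^sup>2) \<odot> g"] Y gv
          by (simp add: nrm_scale ip_scale norm_power flip: of_real_power of_real_mult)
        ultimately show ?thesis by (simp add: power_mult_distrib algebra_simps power2_eq_square)
      qed
      \<comment> \<open>\<open>(B - b) w = (B\<^sup>2 - b\<^sup>2) g\<close> for \<open>w = (B + b) g\<close>, as \<open>u = B g\<close> and \<open>v = B u\<close>\<close>
      define w where "w = u + of_real b \<odot> g"
      have wG: "w \<in> perp G" unfolding w_def by (intro perp_add perp_scale GY uG gG)
      have Bw: "(v + of_real b \<odot> u, l + of_real b \<odot> k) \<in> A" by (intro A_add A_scale v uk)
      have Bw2: "(l + of_real b \<odot> k) - of_real m \<odot> (v + of_real b \<odot> u) \<doteq> w"
      proof -
        have "(l + of_real b \<odot> k) - of_real m \<odot> (v + of_real b \<odot> u) = (l - of_real m \<odot> v) + of_real b \<odot> g"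
          by (simp add: g_def scale_right_distrib scale_right_diff_distrib algebra_simps)
        then show ?thesis using eqv_add[OF v(2) eqv_refl[of "of_real b \<odot> g"]] Y by (simp only: w_def Y_simps)
      qed
      have BwG: "v + of_real b \<odot> u \<in> perp G" by (intro perp_add perp_scale GY uG vG)
      have C1': "nrm a \<le> max C1 0 * nrm (c - (of_real m + 1 / of_real b) \<odot> a)"
        if "(a, c) \<in> A" "a \<in> perp G" for a c
        using C1[OF that] A_X[OF that(1)] mult_right_mono[of C1 "max C1 0" "nrm (c - of_real (m + 1 / b) \<odot> a)"]
        by simp
      have C2': "nrm a \<le> max C2 0 * nrm (c - (of_real m + - 1 / of_real b) \<odot> a)"
        if "(a, c) \<in> A" "a \<in> perp G" for a c
        using C2[OF that] A_X[OF that(1)] mult_right_mono[of C2 "max C2 0" "nrm (c - of_real (m + - 1 / b) \<odot> a)"]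
        by simp
      have "nrm w \<le> K1 * nrm ((v + of_real b \<odot> u) - (1 * of_real b) \<odot> w)"
        unfolding K1_def by (intro lower[OF Bw Bw2 wG] C1'[OF Bw BwG]) auto
      also have "(v + of_real b \<odot> u) - (1 * of_real b) \<odot> w = v - of_real (b\<^sup>2) \<odot> g"
        by (simp add: w_def scale_right_distrib power2_eq_square)
      finally have 2: "nrm w \<le> K1 * nrm (v - of_real (b\<^sup>2) \<odot> g)" .
      have "nrm g \<le> K2 * nrm (u - (- 1 * of_real b) \<odot> g)"
        unfolding K2_def using Y by (intro lower[OF uk(1) _ gG] C2'[OF uk(1) uG]) (auto simp: g_def)
      also have "u - (- 1 * of_real b) \<odot> g = w" by (simp add: w_def)
      finally have "nrm g \<le> K2 * (K1 * nrm (v - of_real (b\<^sup>2) \<odot> g))"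
        using 2 K by (meson mult_left_mono order_less_imp_le order_trans)
      then have "(nrm g)\<^sup>2 \<le> (K2 * K1)\<^sup>2 * (nrm (v - of_real (b\<^sup>2) \<odot> g))\<^sup>2"
        using Y by (metis mult.assoc power_mono nrm_nonneg power_mult_distrib)
      also have "\<dots> \<le> (K2 * K1)\<^sup>2 * (b\<^sup>2 * (b\<^sup>2 * (nrm g)\<^sup>2 - (nrm u)\<^sup>2))"
        by (intro mult_left_mono 1) auto
      also have "\<dots> = (b\<^sup>2 * (nrm g)\<^sup>2 - (nrm u)\<^sup>2) * (K1 * K2 * b)\<^sup>2"
        by (simp add: power_mult_distrib mult_ac)
      finally have le: "(nrm g)\<^sup>2 \<le> (b\<^sup>2 * (nrm g)\<^sup>2 - (nrm u)\<^sup>2) * (K1 * K2 * b)\<^sup>2" .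
      have "(K1 * K2 * b)\<^sup>2 > 0" using K b by (simp only: zero_less_power mult_pos_pos)
      from pos_divide_le_eq[OF this, THEN iffD2, OF le]
      have "(nrm g)\<^sup>2 / (K1 * K2 * b)\<^sup>2 \<le> b\<^sup>2 * (nrm g)\<^sup>2 - (nrm u)\<^sup>2" .
      then show ?thesis unfolding g_def by (simp add: left_diff_distrib)
    qed
    define d where "d = b\<^sup>2 - 1 / (K1 * K2 * b)\<^sup>2"
    have "(K1 * K2 * b)\<^sup>2 > 0" using K b by (simp only: zero_less_power mult_pos_pos)
    then have d: "d < b\<^sup>2" by (simp add: d_def del: zero_less_power2)
    have b2: "nrm u \<le> sqrt (max 0 d) * nrm (k - of_real m \<odot> u)"
      if "(u, k) \<in> A" "k - of_real m \<odot> u \<in> perp G" for u k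
    proof (rule power2_le_imp_le)
      have "(nrm u)\<^sup>2 \<le> d * (nrm (k - of_real m \<odot> u))\<^sup>2"
        unfolding d_def by (rule improve[OF that])
      also have "\<dots> \<le> max 0 d * (nrm (k - of_real m \<odot> u))\<^sup>2"
        by (intro mult_right_mono) auto
      finally show "(nrm u)\<^sup>2 \<le> (sqrt (max 0 d) * nrm (k - of_real m \<odot> u))\<^sup>2"
        by (simp add: power_mult_distrib)
      show "0 \<le> sqrt (max 0 d) * nrm (k - of_real m \<odot> u)"
        using perp_X[OF that(2)] by simp
    qed
    then have "P (sqrt (max 0 d))" by (auto simp: P_def)
    then have "b \<le> sqrt (max 0 d)" unfolding b_def using bdd by (intro cInf_lower) auto
    moreover have "sqrt (max 0 d) < b"
      using b d by (intro real_less_lsqrt) auto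
    ultimately show False by simp
  qed
  then have "nrm u \<le> (1 / \<delta>) * nrm (k - of_real m \<odot> u)"
    using Pb[OF uk] mult_right_mono[of b "1 / \<delta>" "nrm (k - of_real m \<odot> u)"] perp_X[OF uk(2)] by auto
  then show ?thesis using \<delta> by (simp add: field_simps)
qed

text \<open>Put \<open>s = r / 2\<close>. Applied at \<open>z0 + s\<close> and \<open>z0 - s\<close>, \<open>gap_bound\<close> shows \<open>2 s \<bar>ip ((A - z0) u) u\<bar> \<le> \<parallel>(A - z0) u\<parallel>\<^sup>2\<close>.
  For the bounded symmetric operator \<open>D = (A - z0) (A - z0 - s)\<^sup>-\<^sup>1 = 1 + s (A - z0 - s)\<^sup>-\<^sup>1\<close> this says that
  \<open>2 ip (D g) g\<close> lies between \<open>\<parallel>D g\<parallel>\<^sup>2\<close> and \<open>3 \<parallel>D g\<parallel>\<^sup>2\<close>. The form of \<open>D\<close> is therefore nonnegative, \<open>D\<close> is bounded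
  below on its range, and \<open>1 - D / 2\<close> is a strict contraction there. Hence the powers of \<open>1 - D / 2\<close> applied
  to \<open>g\<close> converge to a vector in the kernel of \<open>D\<close>, which is the eigenspace, at distance at most a constant
  times \<open>\<parallel>D g\<parallel>\<close> from \<open>g\<close>. A vector orthogonal to the eigenspace is no longer than this distance.\<close>

lemma isolated_bounded_below:
  fixes z0 r :: real
  assumes r: "r > 0" and iso: "\<And>t. \<lbrakk>t \<noteq> 0; \<bar>t\<bar> < r\<rbrakk> \<Longrightarrow> of_real (z0 + t) \<in> rho"
  shows "\<exists>C. \<forall>(f, h)\<in>A. (\<forall>e\<in>eig (of_real z0). ip e f = 0) \<longrightarrow> nrm f \<le> C * nrm (h - of_real z0 \<odot> f)"
proof -
  define s where "s = r / 2"
  have s: "s > 0" using r by (simp add: s_def)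
  define m where "m = z0 + s"
  have low: "s * nrm u \<le> nrm (k - of_real (z0 + \<sigma>) \<odot> u)" if \<sigma>: "\<sigma> = s \<or> \<sigma> = - s" and uk: "(u, k) \<in> A" for \<sigma> u k
  proof (rule gap_bound[of _ "{}"])
    show "of_real (z0 + \<sigma>) \<in> rho" using \<sigma> s by (intro iso) (auto simp: s_def)
    show "k - of_real (z0 + \<sigma>) \<odot> u \<in> perp {}" using A_X[OF uk] by (simp add: perp_def)
    fix t :: real assume t: "t \<noteq> 0" "\<bar>t\<bar> < s"
    have "of_real (z0 + (\<sigma> + t)) \<in> rho" using \<sigma> t by (intro iso) (auto simp: s_def)
    then show "\<exists>C. \<forall>(a, b)\<in>A. a \<in> perp {} \<longrightarrow> nrm a \<le> C * nrm (b - of_real (z0 + \<sigma> + t) \<odot> a)"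
      unfolding rho_def by (auto simp: add.assoc)
  qed (use s uk in auto)
  have key: "2 * \<bar>s * Re (ip (k - of_real z0 \<odot> u) u)\<bar> \<le> (nrm (k - of_real z0 \<odot> u))\<^sup>2" if uk: "(u, k) \<in> A" for u k
  proof -
    let ?\<kappa> = "k - of_real z0 \<odot> u"
    have Y: "u \<in> Y" "k \<in> Y" using A_X[OF uk] by auto
    have "(nrm ?\<kappa>)\<^sup>2 - 2 * (\<sigma> * Re (ip ?\<kappa> u)) \<ge> 0" if \<sigma>: "\<sigma> = s \<or> \<sigma> = - s" for \<sigma>
    proof -
      have "k - of_real (z0 + \<sigma>) \<odot> u = ?\<kappa> - of_real \<sigma> \<odot> u" by (simp add: scale_left_distrib)
      with low[OF \<sigma> uk] have "s * nrm u \<le> nrm (?\<kappa> - of_real \<sigma> \<odot> u)" by (simp only:)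
      then have "(s * nrm u)\<^sup>2 \<le> (nrm (?\<kappa> - of_real \<sigma> \<odot> u))\<^sup>2"
        using Y s by (intro power_mono) auto
      also have "\<dots> = (nrm ?\<kappa>)\<^sup>2 + (s * nrm u)\<^sup>2 - 2 * (\<sigma> * Re (ip ?\<kappa> u))"
        using Y \<sigma> by (auto simp: nrm_diff_sq nrm_scale ip_scale power_mult_distrib)
      finally show ?thesis by simp
    qed
    from this[of s] this[of "- s"] show ?thesis by (auto simp: abs_if)
  qed
  have m: "of_real m \<in> rho" unfolding m_def using s by (intro iso) (auto simp: s_def)
  have "\<forall>g\<in>X. \<exists>p. p \<in> A \<and> snd p - of_real m \<odot> fst p \<doteq> g"
    using rho_solve[OF m] by (metis fst_conv snd_conv)
  from bchoice[OF this] obtain T where T: "\<And>g. g \<in> X \<Longrightarrow> T g \<in> A"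
    "\<And>g. g \<in> X \<Longrightarrow> snd (T g) - of_real m \<odot> fst (T g) \<doteq> g" by auto
  define R where "R g = fst (T g)" for g
  define D where "D g = snd (T g) - of_real z0 \<odot> fst (T g)" for g
  have TA: "(R g, snd (T g)) \<in> A" if "g \<in> X" for g using T(1)[OF that] by (simp add: R_def)
  have RX: "R g \<in> X" and DX: "D g \<in> X" if "g \<in> X" for g
    using A_X[OF TA[OF that]] by (auto simp: D_def R_def)
  have DR: "D g - of_real s \<odot> R g \<doteq> g" if "g \<in> X" for g
    using T(2)[OF that] by (simp add: D_def R_def m_def scale_left_distrib algebra_simps)
  have D_unique: "k - of_real z0 \<odot> u \<doteq> D g" "u \<doteq> R g"
    if uk: "(u, k) \<in> A" "k - of_real m \<odot> u \<doteq> g" and g: "g \<in> X" for u k g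
  proof -
    have d: "(u - R g, k - snd (T g)) \<in> A" by (rule A_diff[OF uk(1) TA[OF g]])
    have "(k - snd (T g)) - of_real m \<odot> (u - R g) = (k - of_real m \<odot> u) - (snd (T g) - of_real m \<odot> R g)"
      by (simp add: scale_right_diff_distrib algebra_simps)
    also have "\<dots> \<doteq> g - g" using uk(2) T(2)[OF g] unfolding R_def by (rule eqv_diff)
    finally have "nrm ((k - snd (T g)) - of_real m \<odot> (u - R g)) = 0" by (simp add: eqv_nrm)
    then have "s * nrm (u - R g) \<le> 0" using low[of s, OF _ d] by (simp add: m_def)
    then have "nrm (u - R g) \<le> 0" using s by (simp add: mult_le_0_iff)
    then show u: "u \<doteq> R g" using A_X[OF uk(1)] RX[OF g] by (intro eqvI) auto
    have "k - of_real z0 \<odot> u = (k - of_real m \<odot> u) + of_real s \<odot> u"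
      by (simp add: m_def scale_left_distrib algebra_simps)
    also have "\<dots> \<doteq> (D g - of_real s \<odot> R g) + of_real s \<odot> R g"
      by (intro eqv_add eqv_scale u eqv_trans[OF uk(2) eqv_sym[OF DR[OF g]]])
    finally show "k - of_real z0 \<odot> u \<doteq> D g" by simp
  qed
  have D_lin: "D (x - c \<odot> y) \<doteq> D x - c \<odot> D y" if x: "x \<in> X" "y \<in> X" for x y c
  proof -
    have "(snd (T x) - c \<odot> snd (T y)) - of_real z0 \<odot> (R x - c \<odot> R y) \<doteq> D (x - c \<odot> y)"
    proof (rule D_unique)
      show "(R x - c \<odot> R y, snd (T x) - c \<odot> snd (T y)) \<in> A" by (intro A_diff A_scale TA x)
      have "snd (T x) - c \<odot> snd (T y) - of_real m \<odot> (R x - c \<odot> R y)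
          = (snd (T x) - of_real m \<odot> R x) - c \<odot> (snd (T y) - of_real m \<odot> R y)"
        by (simp add: scale_right_diff_distrib algebra_simps)
      also have "\<dots> \<doteq> x - c \<odot> y" unfolding R_def by (intro eqv_diff eqv_scale T x)
      finally show "snd (T x) - c \<odot> snd (T y) - of_real m \<odot> (R x - c \<odot> R y) \<doteq> x - c \<odot> y" .
    qed (use x in auto)
    moreover have "(snd (T x) - c \<odot> snd (T y)) - of_real z0 \<odot> (R x - c \<odot> R y) = D x - c \<odot> D y"
      by (simp add: D_def R_def scale_right_diff_distrib algebra_simps)
    ultimately show ?thesis using eqv_sym by metis
  qed
  have D_form: "(nrm (D g))\<^sup>2 \<le> 2 * Re (ip (D g) g)" "2 * Re (ip (D g) g) \<le> 3 * (nrm (D g))\<^sup>2" if g: "g \<in> X" for g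
  proof -
    have Y: "D g \<in> Y" "R g \<in> Y" "g \<in> Y" using DX RX g by auto
    have "ip (D g) g = ip (D g) (D g - of_real s \<odot> R g)" using eqv_ip(1)[OF DR[OF g]] Y by simp
    then have "Re (ip (D g) g) = (nrm (D g))\<^sup>2 - s * Re (ip (D g) (R g))"
      using Y by (simp add: ip_diff ip_scale nrm_sq)
    moreover have "2 * \<bar>s * Re (ip (D g) (R g))\<bar> \<le> (nrm (D g))\<^sup>2"
      using key[OF TA[OF g]] by (simp add: D_def R_def)
    ultimately show "(nrm (D g))\<^sup>2 \<le> 2 * Re (ip (D g) g)" "2 * Re (ip (D g) g) \<le> 3 * (nrm (D g))\<^sup>2"
      by linarith+
  qed
  have D_sym: "ip (D x) g = ip x (D g)" if x: "x \<in> X" and g: "g \<in> X" for x g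
  proof -
    obtain u k where uk: "T x = (u, k)" by (cases "T x")
    obtain v l where vl: "T g = (v, l)" by (cases "T g")
    have A: "(u, k) \<in> A" "(v, l) \<in> A" using T(1) x g uk vl by metis+
    have Y: "u \<in> Y" "k \<in> Y" "v \<in> Y" "l \<in> Y" using A_X[OF A(1)] A_X[OF A(2)] by auto
    have "ip (D x) g = ip (k - of_real z0 \<odot> u) (l - of_real m \<odot> v)"
      using eqv_ip(1)[OF T(2)[OF g]] X_Y[OF DX[OF x]] by (simp add: D_def uk vl)
    also have "\<dots> = ip (k - of_real m \<odot> u) (l - of_real z0 \<odot> v)"
      using Y S_sym[OF A_S[OF A(1)] A_S[OF A(2)]]
      by (simp add: ip_diff ip_diff_left ip_scale ip_scale_left algebra_simps)
    also have "\<dots> = ip x (D g)"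
      using eqv_ip(2)[OF T(2)[OF x]] X_Y[OF DX[OF g]] by (simp add: D_def uk vl)
    finally show ?thesis .
  qed
  have D_bdd: "nrm (D g) \<le> 2 * nrm g" if g: "g \<in> X" for g
  proof -
    have Y: "R g \<in> Y" "g \<in> Y" using RX g by auto
    have "s * nrm (R g) \<le> nrm g"
      using low[of s, OF _ TA[OF g]] eqv_nrm[OF T(2)[OF g]] by (simp add: m_def R_def)
    moreover have "nrm (D g) = nrm (g + of_real s \<odot> R g)"
      using eqv_add[OF DR[OF g] eqv_refl[of "of_real s \<odot> R g"]] Y by (simp add: eqv_nrm)
    ultimately show ?thesis
      using nrm_triangle[of g "of_real s \<odot> R g"] Y s by (simp add: nrm_scale)
  qed
  \<comment> \<open>nonnegativity of the form of \<open>D\<close> at \<open>g - D g\<close>, where the cross term is \<open>\<parallel>D g\<parallel>\<^sup>2\<close>\<close>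
  have D_range: "(nrm (D g))\<^sup>2 \<le> 3 * (nrm (D (D g)))\<^sup>2" if g: "g \<in> X" for g
  proof -
    define x where "x = D g"
    have X: "x \<in> X" "D x \<in> X" and Y: "x \<in> Y" "g \<in> Y" "D x \<in> Y" using DX g by (auto simp: x_def)
    have "0 \<le> 2 * Re (ip (D (g - 1 \<odot> x)) (g - x))"
      using D_form(1)[of "g - x"] g X by (simp add: order_trans[OF zero_le_power2])
    also have "ip (D (g - 1 \<odot> x)) (g - x) = ip (x - 1 \<odot> D x) (g - x)"
      unfolding x_def using D_lin[OF g DX[OF g], of 1] Y X g by (intro eqv_ip(2)) (auto simp: x_def)
    also have "\<dots> = ip x g - ip x x - ip (D x) g + ip (D x) x"
      using Y by (simp add: ip_diff ip_diff_left)
    also have "ip (D x) g = ip x x" using D_sym[OF X(1) g] by (simp add: x_def)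
    finally have "0 \<le> 2 * Re (ip x g) - 4 * (nrm x)\<^sup>2 + 2 * Re (ip (D x) x)"
      using Y by (simp add: nrm_sq)
    moreover have "2 * Re (ip x g) \<le> 3 * (nrm x)\<^sup>2" using D_form(2)[OF g] by (simp add: x_def)
    ultimately show ?thesis using D_form(2)[OF X(1)] by (simp add: x_def)
  qed
  \<comment> \<open>for \<open>x\<close> in the range of \<open>D\<close>: \<open>\<parallel>x - D x / 2\<parallel>\<^sup>2 \<le> \<parallel>x\<parallel>\<^sup>2 - \<parallel>D x\<parallel>\<^sup>2 / 4 \<le> \<parallel>x\<parallel>\<^sup>2 - \<parallel>x\<parallel>\<^sup>2 / 12\<close>\<close>
  define \<rho> where "\<rho> = sqrt (11 / 12)"
  have \<rho>: "0 \<le> \<rho>" "\<rho> < 1" by (auto simp: \<rho>_def)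
  have contr: "nrm (D g - (1/2) \<odot> D (D g)) \<le> \<rho> * nrm (D g)" if g: "g \<in> X" for g
  proof (rule power2_le_imp_le)
    have X: "D g \<in> X" "D (D g) \<in> X" and Y: "D g \<in> Y" "D (D g) \<in> Y" using DX g by auto
    have "Re (ip (D g) (D (D g))) = Re (ip (D (D g)) (D g))" using ip_cnj[OF Y] by simp
    then have "(nrm (D g - (1/2) \<odot> D (D g)))\<^sup>2 = (nrm (D g))\<^sup>2 + (nrm (D (D g)))\<^sup>2 / 4 - Re (ip (D (D g)) (D g))"
      using Y by (simp add: nrm_diff_sq nrm_scale ip_scale power_divide)
    also have "\<dots> \<le> 11 / 12 * (nrm (D g))\<^sup>2"
      using D_form(1)[OF X(1)] D_range[OF g] by linarith
    finally show "(nrm (D g - (1/2) \<odot> D (D g)))\<^sup>2 \<le> (\<rho> * nrm (D g))\<^sup>2"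
      by (simp add: \<rho>_def power_mult_distrib)
    show "0 \<le> \<rho> * nrm (D g)" using Y \<rho> by simp
  qed
  have near: "\<exists>e\<in>eig (of_real z0). nrm (g - e) \<le> nrm (D g) / (1 - \<rho>)" if g: "g \<in> X" for g
  proof -
    define y where "y n = ((\<lambda>v. v - (1/2) \<odot> D v) ^^ n) g" for n
    have yS: "y (Suc n) = y n - (1/2) \<odot> D (y n)" for n by (simp add: y_def)
    have yX: "y n \<in> X" for n by (induction n) (auto simp: y_def DX g)
    have dn: "nrm (D (y n)) \<le> nrm (D g) * \<rho> ^ n" for n
    proof (induction n)
      case (Suc n)
      have "nrm (D (y (Suc n))) = nrm (D (y n) - (1/2) \<odot> D (D (y n)))"
        unfolding yS by (intro eqv_nrm D_lin yX DX)
      also have "\<dots> \<le> \<rho> * nrm (D (y n))" by (rule contr[OF yX])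
      also have "\<dots> \<le> \<rho> * (nrm (D g) * \<rho> ^ n)" by (rule mult_left_mono[OF Suc \<rho>(1)])
      finally show ?case by (simp add: mult_ac)
    qed (simp add: y_def)
    have step: "nrm (y (Suc n) - y n) \<le> nrm (D g) * \<rho> ^ n" for n
    proof -
      have "y (Suc n) - y n = (- (1/2)) \<odot> D (y n)" by (simp add: yS)
      then have "nrm (y (Suc n) - y n) = nrm (D (y n)) / 2" using X_Y[OF DX[OF yX[of n]]] by (simp add: nrm_scale)
      then show ?thesis using dn[of n] nrm_nonneg[OF X_Y[OF DX[OF yX[of n]]]] by linarith
    qed
    obtain v where v: "v \<in> X" and lim: "(\<lambda>n. nrm (y n - v)) \<longlonglongrightarrow> 0"
      by (rule X_complete[OF yX \<rho> step])
    have far: "nrm (g - y n) \<le> nrm (D g) * (1 - \<rho> ^ n) / (1 - \<rho>)" for n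
    proof (induction n)
      case (Suc n)
      have "nrm (g - y (Suc n)) \<le> nrm (g - y n) + nrm (y (Suc n) - y n)"
        using nrm_triangle3[OF X_Y[OF g] X_Y[OF yX[of n]] X_Y[OF yX[of "Suc n"]]]
          nrm_minus_commute[OF X_Y[OF yX[of n]] X_Y[OF yX[of "Suc n"]]] by simp
      also have "\<dots> \<le> nrm (D g) * (1 - \<rho> ^ n) / (1 - \<rho>) + nrm (D g) * \<rho> ^ n"
        by (intro add_mono Suc step)
      also have "\<dots> = nrm (D g) * (1 - \<rho> ^ Suc n) / (1 - \<rho>)"
        using \<rho> by (simp add: field_simps)
      finally show ?case .
    qed (simp add: y_def)
    have "nrm (g - v) \<le> nrm (D g) / (1 - \<rho>) + nrm (y n - v)" for n
    proof -
      have "nrm (D g) * (1 - \<rho> ^ n) / (1 - \<rho>) \<le> nrm (D g) / (1 - \<rho>)"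
        using \<rho> X_Y[OF DX[OF g]] by (intro divide_right_mono mult_left_le) auto
      then show ?thesis
        using far[of n] nrm_triangle3[OF X_Y[OF g] X_Y[OF yX[of n]] X_Y[OF v]] by linarith
    qed
    moreover have "(\<lambda>n. nrm (D g) / (1 - \<rho>) + nrm (y n - v)) \<longlonglongrightarrow> nrm (D g) / (1 - \<rho>) + 0"
      by (intro tendsto_intros lim)
    ultimately have gv: "nrm (g - v) \<le> nrm (D g) / (1 - \<rho>)"
      using LIMSEQ_le_const by fastforce
    have "nrm (D v) \<le> nrm (D g) * \<rho> ^ n + 2 * nrm (y n - v)" for n
    proof -
      have Y: "D v \<in> Y" "D (y n) \<in> Y" using DX v yX by auto
      have "nrm (D v) = nrm (D (y n) - (D (y n) - 1 \<odot> D v))" by simp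
      also have "\<dots> \<le> nrm (D (y n)) + nrm (D (y n) - 1 \<odot> D v)"
        using Y by (intro nrm_triangle_diff) auto
      also have "nrm (D (y n) - 1 \<odot> D v) = nrm (D (y n - 1 \<odot> v))"
        by (intro eqv_nrm eqv_sym[OF D_lin] yX v)
      also have "\<dots> \<le> 2 * nrm (y n - 1 \<odot> v)" using yX v by (intro D_bdd) auto
      finally show ?thesis using dn[of n] by simp
    qed
    moreover have "(\<lambda>n. nrm (D g) * \<rho> ^ n + 2 * nrm (y n - v)) \<longlonglongrightarrow> nrm (D g) * 0 + 2 * 0"
      using \<rho> by (intro tendsto_intros lim LIMSEQ_power_zero) auto
    ultimately have "nrm (D v) \<le> 0" using LIMSEQ_le_const by fastforce
    then have Dv: "D v \<doteq> 0" using X_Y[OF DX[OF v]] by (simp add: eqv_def)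
    have "snd (T v) \<doteq> of_real z0 \<odot> R v"
      using eqv_add[OF Dv eqv_refl[of "of_real z0 \<odot> R v"]] X_Y[OF RX[OF v]] by (simp add: D_def R_def)
    then have "(R v, of_real z0 \<odot> R v) \<in> A"
      using A_cong[OF TA[OF v]] X_Y[OF RX[OF v]] by simp
    from A_scale[OF this, of "- of_real s"] have e: "(- of_real s) \<odot> R v \<in> eig (of_real z0)"
      by (simp add: eig_def mult.commute)
    have "v \<doteq> D v - of_real s \<odot> R v" by (rule eqv_sym[OF DR[OF v]])
    also have "D v - of_real s \<odot> R v \<doteq> 0 - of_real s \<odot> R v"
      using X_Y[OF RX[OF v]] by (intro eqv_diff Dv eqv_refl) auto
    finally have "g - v \<doteq> g - (- of_real s) \<odot> R v" using g by (intro eqv_diff) auto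
    then show ?thesis using e gv by (intro bexI[of _ "(- of_real s) \<odot> R v"]) (auto simp: eqv_nrm)
  qed
  have "nrm f \<le> 1 / (s * (1 - \<rho>)) * nrm (h - of_real z0 \<odot> f)"
    if fh: "(f, h) \<in> A" and perp: "\<forall>e\<in>eig (of_real z0). ip e f = 0" for f h
  proof -
    have f: "f \<in> X" "h \<in> X" and Y: "f \<in> Y" "h \<in> Y" using A_X[OF fh] by auto
    obtain e where e: "e \<in> eig (of_real z0)" "nrm (f - e) \<le> nrm (D f) / (1 - \<rho>)"
      using near[OF f(1)] by blast
    have eY: "e \<in> Y" using e(1) A_X by (auto simp: eig_def)
    have "ip f e = 0" using perp e(1) ip_cnj[OF eY Y(1)] by simp
    then have "(nrm f)\<^sup>2 \<le> (nrm (f - e))\<^sup>2" using nrm_diff_sq[OF Y(1) eY] by simp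
    then have "nrm f \<le> nrm (f - e)"
      by (rule power2_le_imp_le) (rule nrm_nonneg[OF Y_simps(3)[OF Y(1) eY]])
    moreover have "s * nrm (D f) \<le> nrm (h - of_real z0 \<odot> f)"
    proof -
      have "D f \<doteq> f + of_real s \<odot> R f"
        using eqv_add[OF DR[OF f(1)] eqv_refl[of "of_real s \<odot> R f"]] X_Y[OF RX[OF f(1)]] by simp
      then have "s * nrm (D f) = s * nrm (f + of_real s \<odot> R f)" by (simp add: eqv_nrm)
      also have "\<dots> \<le> nrm ((h + of_real s \<odot> snd (T f)) - of_real m \<odot> (f + of_real s \<odot> R f))"
        using low[of s, OF _ A_add[OF fh A_scale[OF TA[OF f(1)], of "of_real s"]]] by (simp add: m_def)
      also have "(h + of_real s \<odot> snd (T f)) - of_real m \<odot> (f + of_real s \<odot> R f)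
           = (h - of_real m \<odot> f) + of_real s \<odot> (snd (T f) - of_real m \<odot> R f)"
        by (simp add: scale_right_distrib scale_right_diff_distrib algebra_simps)
      also have "nrm \<dots> = nrm ((h - of_real m \<odot> f) + of_real s \<odot> f)"
        unfolding R_def using Y by (intro eqv_nrm eqv_add eqv_scale T(2) f) auto
      also have "(h - of_real m \<odot> f) + of_real s \<odot> f = h - of_real z0 \<odot> f"
        by (simp add: m_def scale_left_distrib algebra_simps)
      finally show ?thesis .
    qed
    ultimately have "nrm f \<le> (nrm (h - of_real z0 \<odot> f) / s) / (1 - \<rho>)"
      using e(2) s \<rho> by (smt (verit) divide_right_mono pos_le_divide_eq mult.commute)
    then show ?thesis by simp
  qed
  then show ?thesis by (intro exI[of _ "1 / (s * (1 - \<rho>))"]) auto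
qed

text \<open>Without essential spectrum in the disc, \<open>gap_bound\<close> gives \<open>(\<nu> - \<eta>) \<parallel>u\<parallel> \<le> \<parallel>(A - m) u\<parallel>\<close> on the complement of
  finitely many eigenvectors, for some \<open>m\<close> in the resolvent set with \<open>0 < m < \<eta>\<close>. A test pair \<open>(f, h)\<close> lies in
  \<open>S\<close> but \<open>h\<close> need not lie in \<open>X\<close>, so the bound is used in dual form: with \<open>u = (A - m)\<^sup>-\<^sup>1 f\<close>, symmetry of \<open>S\<close>
  gives \<open>\<parallel>f\<parallel>\<^sup>2 = ip (h - m f) u \<le> (\<mu> + \<eta>) \<parallel>f\<parallel> \<parallel>u\<parallel>\<close>.\<close>

theorem ess_near_zero:
  assumes \<nu>: "0 \<le> \<mu>" "\<mu> < \<nu>"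
    and test: "\<And>G. \<lbrakk>finite G; G \<subseteq> Y\<rbrakk> \<Longrightarrow> \<exists>(f, h)\<in>S. nrm f \<noteq> 0 \<and> nrm h \<le> \<mu> * nrm f \<and> (\<forall>e\<in>G. ip e f = 0)"
  shows "\<exists>z\<in>ess. cmod z \<le> \<nu>"
proof (rule ccontr)
  assume "\<not> ?thesis"
  then have no_ess: "\<And>z. \<lbrakk>z \<in> spec; cmod z \<le> \<nu>\<rbrakk> \<Longrightarrow> z \<in> disc" by (auto simp: ess_def)
  define Z where "Z = cball 0 \<nu> \<inter> spec"
  have fin: "finite Z"
    unfolding Z_def
  proof (rule finite_not_islimpt_in_compact)
    fix z :: complex assume "z \<in> cball 0 \<nu>"
    then show "\<not> z islimpt spec"
      using no_ess[of z] closed_spec closed_limpt by (auto simp: disc_def isolated_in_islimpt_iff)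
  qed auto
  have "\<forall>z\<in>Z. \<exists>F. finite F \<and> F \<subseteq> eig z \<and> (\<forall>f\<in>eig z. \<exists>c. f \<doteq> (\<Sum>g\<in>F. c g \<odot> g))"
    using no_ess by (auto simp: Z_def disc_def)
  from bchoice[OF this] obtain F where F0: "\<forall>z\<in>Z. finite (F z) \<and> F z \<subseteq> eig z \<and>
    (\<forall>f\<in>eig z. \<exists>c. f \<doteq> (\<Sum>g\<in>F z. c g \<odot> g))" ..
  have F: "finite (F z)" "F z \<subseteq> eig z" "\<forall>f\<in>eig z. \<exists>c. f \<doteq> (\<Sum>g\<in>F z. c g \<odot> g)" if "z \<in> Z" for z
    using bspec[OF F0 that] by blast+
  define G where "G = (\<Union>z\<in>Z. F z)"
  have finG: "finite G" using fin F(1) by (auto simp: G_def)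
  have GE: "\<exists>z. e \<in> eig z" if "e \<in> G" for e using that F(2) by (auto simp: G_def)
  have eig_Y: "e \<in> eig z \<Longrightarrow> e \<in> Y" for e z using A_X by (auto simp: eig_def)
  have GY: "G \<subseteq> Y" using GE eig_Y by blast
  have perp_eig: "ip e a = 0" if z: "z \<in> Z" and e: "e \<in> eig z" and a: "a \<in> perp G" for e z a
  proof -
    have aY: "a \<in> Y" using perp_X[OF a] by auto
    obtain c where c: "e \<doteq> (\<Sum>g\<in>F z. c g \<odot> g)" using F(3)[OF z] e by blast
    have FY: "\<And>g. g \<in> F z \<Longrightarrow> g \<in> Y" using F(2)[OF z] eig_Y by blast
    have "ip a g = 0" if "g \<in> F z" for g
    proof -
      have "ip g a = 0" using a that z by (auto simp: perp_def G_def)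
      then show ?thesis using ip_cnj[OF FY[OF that] aY] by simp
    qed
    then have "ip a e = 0"
      using eqv_ip(1)[OF c aY] FY aY by (simp add: ip_sum ip_scale)
    then show ?thesis using ip_cnj[OF aY eig_Y[OF e]] by simp
  qed
  define \<eta> where "\<eta> = (\<nu> - \<mu>) / 4"
  have \<eta>: "\<eta> > 0" "\<mu> + \<eta> < \<nu> - \<eta>" "\<eta> < \<nu>" using \<nu> by (auto simp: \<eta>_def field_simps)
  have "finite (complex_of_real -` Z)" by (intro finite_vimageI fin inj_of_real)
  then have "infinite ({0<..<\<eta>} - complex_of_real -` Z)"
    using \<eta> by (intro Diff_infinite_finite) auto
  then obtain m where m: "0 < m" "m < \<eta>" "of_real m \<notin> Z"
    by (metis DiffE greaterThanLessThan_iff infinite_imp_nonempty ex_in_conv vimageI2)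
  have m_rho: "of_real m \<in> rho" using m \<eta> by (auto simp: Z_def spec_def)
  have gap: "(\<nu> - \<eta>) * nrm u \<le> nrm (k - of_real m \<odot> u)" if uk: "(u, k) \<in> A" "k - of_real m \<odot> u \<in> perp G" for u k
  proof (rule gap_bound[OF m_rho GE _ _ uk])
    fix t :: real assume t: "t \<noteq> 0" "\<bar>t\<bar> < \<nu> - \<eta>"
    define z where "z = complex_of_real (m + t)"
    have z: "cmod z \<le> \<nu>" unfolding z_def norm_of_real using m t by linarith
    show "\<exists>C. \<forall>(a, b)\<in>A. a \<in> perp G \<longrightarrow> nrm a \<le> C * nrm (b - of_real (m + t) \<odot> a)"
    proof (cases "z \<in> rho")
      case True
      then show ?thesis unfolding z_def rho_def by auto
    next
      case False
      then have zs: "z \<in> spec" "z \<in> Z" using z by (auto simp: spec_def Z_def)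
      with no_ess z have "z isolated_in spec" by (auto simp: disc_def)
      then obtain r where r: "r > 0" "\<And>y. \<lbrakk>y \<in> spec; dist z y < r\<rbrakk> \<Longrightarrow> y = z"
        by (auto simp: isolated_in_dist_Ex_iff)
      have "of_real (m + t + t') \<in> rho" if "t' \<noteq> 0" "\<bar>t'\<bar> < r" for t'
      proof (rule ccontr)
        assume "of_real (m + t + t') \<notin> rho"
        moreover have "dist z (of_real (m + t + t')) < r"
          using that by (simp add: z_def dist_norm flip: of_real_add of_real_diff)
        ultimately have "of_real (m + t + t') = z" using r(2) by (auto simp: spec_def)
        then show False using that unfolding z_def of_real_eq_iff by simp
      qed
      from isolated_bounded_below[OF r(1) this] obtain C where
        C: "\<And>f h. \<lbrakk>(f, h) \<in> A; \<forall>e\<in>eig z. ip e f = 0\<rbrakk> \<Longrightarrow> nrm f \<le> C * nrm (h - z \<odot> f)"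
        unfolding z_def by blast
      then show ?thesis using perp_eig[OF zs(2)] unfolding z_def[symmetric] by blast
    qed
  qed (use \<eta> in auto)
  obtain f h where fh: "(f, h) \<in> S" "nrm f \<noteq> 0" "nrm h \<le> \<mu> * nrm f" "\<forall>e\<in>G. ip e f = 0"
    using test[OF finG GY] by auto
  have fX: "f \<in> X" by (rule S_dom_X[OF fh(1)])
  obtain u k where uk: "(u, k) \<in> A" "k - of_real m \<odot> u \<doteq> f" using rho_solve[OF m_rho fX] .
  have Y: "f \<in> Y" "h \<in> Y" "u \<in> Y" "k \<in> Y" using S_Y[OF fh(1)] A_X[OF uk(1)] by auto
  have "f \<in> perp G" using fX fh(4) by (simp add: perp_def)
  then have "(\<nu> - \<eta>) * nrm u \<le> nrm f"
    using gap[OF uk(1) perp_cong[OF GY _ eqv_sym[OF uk(2)]]] eqv_nrm[OF uk(2)] by simp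
  have fpos: "nrm f > 0" using fh(2) nrm_nonneg[OF Y(1)] by linarith
  have "(nrm f)\<^sup>2 = cmod (ip f f)" using Y by (simp add: ip_self norm_power)
  also have "ip f f = ip f (k - of_real m \<odot> u)" using eqv_ip(1)[OF uk(2) Y(1)] by simp
  also have "\<dots> = ip f k - of_real m * ip f u" using Y by (simp add: ip_diff ip_scale)
  also have "ip f k = ip h u" by (rule S_sym[OF fh(1) A_S[OF uk(1)]])
  also have "ip h u - of_real m * ip f u = ip (h - of_real m \<odot> f) u"
    using Y by (simp add: ip_diff_left ip_scale_left)
  also have "cmod \<dots> \<le> nrm (h - of_real m \<odot> f) * nrm u" using Y by (intro Cauchy_Schwarz) auto
  also have "\<dots> \<le> ((\<mu> + \<eta>) * nrm f) * nrm u"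
  proof (rule mult_right_mono)
    have "nrm (h - of_real m \<odot> f) \<le> nrm h + m * nrm f"
      using nrm_triangle_diff[of h "of_real m \<odot> f"] Y m by (simp add: nrm_scale)
    also have "\<dots> \<le> \<mu> * nrm f + \<eta> * nrm f" using fh(3) m fpos by (intro add_mono mult_right_mono) auto
    finally show "nrm (h - of_real m \<odot> f) \<le> (\<mu> + \<eta>) * nrm f" by (simp add: distrib_right)
  qed (use Y in auto)
  finally have le: "nrm f * nrm f \<le> nrm f * ((\<mu> + \<eta>) * nrm u)" by (simp add: power2_eq_square mult_ac)
  then have 1: "nrm f \<le> (\<mu> + \<eta>) * nrm u" using fpos by (simp only: mult_le_cancel_left_pos)
  have "nrm u \<noteq> 0" using 1 fpos by auto
  then have "nrm u > 0" using nrm_nonneg[OF Y(3)] by linarith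
  then have "(\<mu> + \<eta>) * nrm u < (\<nu> - \<eta>) * nrm u" using \<eta> by (simp only: mult_strict_right_mono)
  then show False using 1 \<open>(\<nu> - \<eta>) * nrm u \<le> nrm f\<close> by linarith
qed

end

section \<open>The Hilbert space of a diagonal canonical system\<close>

lemma herm_form_H_diag:
  "herm_form (H_diag \<phi> x) u v = of_real ((sin (\<phi> x))\<^sup>2) * (cnj (u $ 1) * v $ 1) + of_real ((cos (\<phi> x))\<^sup>2) * (cnj (u $ 2) * v $ 2)"
  by (simp add: herm_form_def cplx_mat_def H_diag_def matrix_vector_mult_def sum_2 map_matrix_def vector_2 algebra_simps)

definition cscale :: "complex \<Rightarrow> (real \<Rightarrow> complex^2) \<Rightarrow> real \<Rightarrow> complex^2" where
  "cscale c f = (\<lambda>x. c *s f x)"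

lemma module_cscale: "module cscale"
  by unfold_locales (auto simp: cscale_def fun_eq_iff vec_eq_iff algebra_simps)

lemma measurable_vec_nth:
  fixes f :: "real \<Rightarrow> complex^2"
  assumes "f \<in> borel_measurable M"
  shows "(\<lambda>x. f x $ i) \<in> borel_measurable M"
  by (rule measurable_compose[OF assms borel_measurable_continuous_onI]) (intro continuous_intros)

lemma measurable_vec_2I:
  fixes f :: "real \<Rightarrow> complex^2"
  assumes "\<And>i. (\<lambda>x. f x $ i) \<in> borel_measurable M"
  shows "f \<in> borel_measurable M"
proof -
  have "(\<lambda>x. f x \<bullet> b) \<in> borel_measurable M" if b: "b \<in> Basis" for b
  proof -
    obtain i c where "b = axis i c" using b unfolding Basis_vec_def by blast
    then show ?thesis using assms by (simp add: inner_axis)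
  qed
  then show ?thesis using borel_measurable_euclidean_space[of f M] by blast
qed

lemma measurable_cnj [measurable (raw)]:
  "f \<in> borel_measurable M \<Longrightarrow> (\<lambda>x. cnj (f x)) \<in> borel_measurable M"
  by (rule measurable_compose[OF _ borel_measurable_continuous_onI]) (auto intro: continuous_intros)

lemma measurable_cscale:
  assumes "f \<in> borel_measurable M"
  shows "cscale c f \<in> borel_measurable M"
  using measurable_vec_nth[OF assms] by (intro measurable_vec_2I) (simp add: cscale_def)

definition cvec2 :: "(real \<Rightarrow> complex) \<Rightarrow> (real \<Rightarrow> complex) \<Rightarrow> real \<Rightarrow> complex^2" where
  "cvec2 a b = (\<lambda>x. axis 1 (a x) + axis 2 (b x))"

lemma cvec2_nth [simp]: "cvec2 a b x $ 1 = a x" "cvec2 a b x $ 2 = b x"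
  by (auto simp: cvec2_def axis_def)

lemma cvec2_eta: "cvec2 (\<lambda>x. f x $ 1) (\<lambda>x. f x $ 2) = f"
  by (auto simp: fun_eq_iff vec_eq_iff forall_2)

lemma bounded_linear_axis: "bounded_linear (axis i :: complex \<Rightarrow> complex^2)"
  by (rule linear_conv_bounded_linear[THEN iffD1]) (auto intro!: linearI simp: axis_def vec_eq_iff)

lemma J_eq_iff: "J *v d = - (cplx_mat (H_diag \<phi> x) *v v) \<longleftrightarrow>
    d $ 1 = - (of_real ((cos (\<phi> x))\<^sup>2) * v $ 2) \<and> d $ 2 = of_real ((sin (\<phi> x))\<^sup>2) * v $ 1"
  by (auto simp: J_def cplx_mat_def H_diag_def matrix_vector_mult_def sum_2 map_matrix_def vector_2 vec_eq_iff forall_2)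

locale diagonal_system =
  fixes \<phi> :: "real \<Rightarrow> real"
  assumes \<phi>_measurable [measurable]: "\<phi> \<in> borel_measurable half_line"
    and sin_integrable: "integrable half_line (\<lambda>x. (sin (\<phi> x))\<^sup>2)"
begin

definition p where "p x = (sin (\<phi> x))\<^sup>2"
definition q where "q x = (cos (\<phi> x))\<^sup>2"
abbreviation H where "H \<equiv> H_diag \<phi>"

lemma pq: "p x \<ge> 0" "q x \<ge> 0" "p x + q x = 1" "p x \<le> 1" "q x \<le> 1"
  by (auto simp: p_def q_def power_le_one_iff abs_square_le_1)

lemma p_meas [measurable]: "p \<in> borel_measurable half_line"
  and q_meas [measurable]: "q \<in> borel_measurable half_line"
  unfolding p_def q_def by measurable

lemma p_int: "integrable half_line p"
  using sin_integrable by (simp add: p_def[abs_def])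

text \<open>The density of the squared norm of \<open>f\<close> in \<open>L\<^sup>2\<^sub>H\<close>.\<close>

definition weight :: "(real \<Rightarrow> complex^2) \<Rightarrow> real \<Rightarrow> real" where
  "weight f x = p x * (cmod (f x $ 1))\<^sup>2 + q x * (cmod (f x $ 2))\<^sup>2"

lemma weight_nonneg [simp]: "weight f x \<ge> 0"
  by (simp add: weight_def pq)

lemma herm_form_eq:
  "herm_form (H x) u v = of_real (p x) * (cnj (u $ 1) * v $ 1) + of_real (q x) * (cnj (u $ 2) * v $ 2)"
  by (simp add: herm_form_H_diag p_def q_def)

lemma herm_form_self: "herm_form (H x) (f x) (f x) = of_real (weight f x)"
  by (simp add: herm_form_eq weight_def complex_norm_square mult.commute flip: of_real_power)

lemma weight_measurable:
  assumes "f \<in> borel_measurable half_line"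
  shows "weight f \<in> borel_measurable half_line"
proof -
  have [measurable]: "(\<lambda>x. f x $ i) \<in> borel_measurable half_line" for i
    by (rule measurable_vec_nth[OF assms])
  show ?thesis unfolding weight_def[abs_def] by measurable
qed

lemma L2H_iff: "f \<in> L2H H \<longleftrightarrow> f \<in> borel_measurable half_line \<and> integrable half_line (weight f)"
  by (simp add: L2H_def herm_form_self complex_of_real_integrable_eq)

lemma L2H_D: assumes "f \<in> L2H H"
  shows "f \<in> borel_measurable half_line" "integrable half_line (weight f)"
    "(\<lambda>x. f x $ i) \<in> borel_measurable half_line"
  using assms measurable_vec_nth[of f half_line i] by (auto simp: L2H_iff)

lemma weight_add_le: "weight (f + g) x \<le> 2 * weight f x + 2 * weight g x"
proof -
  have "(cmod (a + b))\<^sup>2 \<le> 2 * (cmod a)\<^sup>2 + 2 * (cmod b)\<^sup>2" for a b :: complex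
  proof -
    have "(cmod (a + b))\<^sup>2 \<le> (cmod a + cmod b)\<^sup>2" by (intro power_mono norm_triangle_ineq) auto
    also have "\<dots> \<le> 2 * (cmod a)\<^sup>2 + 2 * (cmod b)\<^sup>2"
      using sum_squares_bound[of "cmod a" "cmod b"] by (simp add: power2_sum)
    finally show ?thesis .
  qed
  then have "weight (f + g) x \<le> p x * (2 * (cmod (f x $ 1))\<^sup>2 + 2 * (cmod (g x $ 1))\<^sup>2) + q x * (2 * (cmod (f x $ 2))\<^sup>2 + 2 * (cmod (g x $ 2))\<^sup>2)"
    unfolding weight_def by (intro add_mono mult_left_mono pq) auto
  then show ?thesis by (simp add: weight_def algebra_simps)
qed

lemma L2H_add: assumes "f \<in> L2H H" "g \<in> L2H H" shows "f + g \<in> L2H H"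
proof -
  have m: "f + g \<in> borel_measurable half_line"
    unfolding plus_fun_def using assms by (intro borel_measurable_add) (auto simp: L2H_iff)
  moreover have "integrable half_line (weight (f + g))"
    by (rule Bochner_Integration.integrable_bound[of _ "\<lambda>x. 2 * weight f x + 2 * weight g x"])
       (use assms m weight_add_le in \<open>auto simp: L2H_iff intro!: weight_measurable\<close>)
  ultimately show ?thesis by (simp add: L2H_iff)
qed

lemma weight_cscale: "weight (cscale c f) x = (cmod c)\<^sup>2 * weight f x"
  by (simp add: weight_def cscale_def norm_mult power_mult_distrib algebra_simps)

lemma L2H_cscale: assumes "f \<in> L2H H" shows "cscale c f \<in> L2H H"
proof -
  have "weight (cscale c f) = (\<lambda>x. (cmod c)\<^sup>2 * weight f x)" by (auto simp: weight_cscale)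
  then show ?thesis using assms measurable_cscale by (auto simp: L2H_iff)
qed

lemma herm_form_integrable:
  assumes "f \<in> L2H H" "g \<in> L2H H"
  shows "integrable half_line (\<lambda>x. of_real (p x) * (cnj (f x $ 1) * g x $ 1))" (is "integrable _ ?a")
    and "integrable half_line (\<lambda>x. of_real (q x) * (cnj (f x $ 2) * g x $ 2))" (is "integrable _ ?b")
    and "integrable half_line (\<lambda>x. herm_form (H x) (f x) (g x))"
proof -
  have am: "cmod (cnj a * b) \<le> (cmod a)\<^sup>2 + (cmod b)\<^sup>2" for a b
    using sum_squares_bound[of "cmod a" "cmod b"] mult_nonneg_nonneg[OF norm_ge_zero[of a] norm_ge_zero[of b]]
    unfolding norm_mult complex_mod_cnj by linarith
  have I: "integrable half_line (\<lambda>x. weight f x + weight g x)" using assms by (auto simp: L2H_iff)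
  have [measurable]: "(\<lambda>x. f x $ i) \<in> borel_measurable half_line" "(\<lambda>x. g x $ i) \<in> borel_measurable half_line" for i
    using assms by (auto intro: L2H_D)
  show a: "integrable half_line ?a"
  proof (rule Bochner_Integration.integrable_bound[OF I])
    have "norm (?a x) \<le> norm (weight f x + weight g x)" for x
    proof -
      have "norm (?a x) \<le> p x * ((cmod (f x $ 1))\<^sup>2 + (cmod (g x $ 1))\<^sup>2)"
        using am[of "f x $ 1" "g x $ 1"] pq(1)[of x] by (simp add: norm_mult mult_left_mono)
      also have "\<dots> \<le> weight f x + weight g x" by (simp add: weight_def pq algebra_simps)
      finally show ?thesis by simp
    qed
    then show "AE x in half_line. norm (?a x) \<le> norm (weight f x + weight g x)" by simp
    show "?a \<in> borel_measurable half_line" by measurable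
  qed
  show b: "integrable half_line ?b"
  proof (rule Bochner_Integration.integrable_bound[OF I])
    have "norm (?b x) \<le> norm (weight f x + weight g x)" for x
    proof -
      have "norm (?b x) \<le> q x * ((cmod (f x $ 2))\<^sup>2 + (cmod (g x $ 2))\<^sup>2)"
        using am[of "f x $ 2" "g x $ 2"] pq(2)[of x] by (simp add: norm_mult mult_left_mono)
      also have "\<dots> \<le> weight f x + weight g x" by (simp add: weight_def pq algebra_simps)
      finally show ?thesis by simp
    qed
    then show "AE x in half_line. norm (?b x) \<le> norm (weight f x + weight g x)" by simp
    show "?b \<in> borel_measurable half_line" by measurable
  qed
  show "integrable half_line (\<lambda>x. herm_form (H x) (f x) (g x))"
    unfolding herm_form_eq using a b by (rule Bochner_Integration.integrable_add)
qed

lemma L2H_inner_eq: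
  assumes "f \<in> L2H H" "g \<in> L2H H"
  shows "L2H_inner H f g = (LINT x|half_line. of_real (p x) * (cnj (f x $ 1) * g x $ 1))
     + (LINT x|half_line. of_real (q x) * (cnj (f x $ 2) * g x $ 2))"
  unfolding L2H_inner_def herm_form_eq using herm_form_integrable[OF assms]
  by (intro Bochner_Integration.integral_add)

lemma L2H_inner_self: "L2H_inner H f f = of_real (LINT x|half_line. weight f x)"
  by (simp add: L2H_inner_def herm_form_self)

sublocale semi_inner_space cscale "L2H H" "L2H_inner H"
proof -
  interpret module cscale by (rule module_cscale)
  show "semi_inner_space cscale (L2H H) (L2H_inner H)"
  proof
    have "0 \<in> L2H H" by (simp add: L2H_iff weight_def[abs_def] zero_fun_def)
    then show "subspace (L2H H)" by (simp add: subspace_def L2H_add L2H_cscale)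
  next
    fix x y z assume "x \<in> L2H H" "y \<in> L2H H" "z \<in> L2H H"
    then have "integrable half_line (\<lambda>t. herm_form (H t) (x t) (y t))" "integrable half_line (\<lambda>t. herm_form (H t) (x t) (z t))"
      by (auto intro: herm_form_integrable)
    moreover have "herm_form (H t) (x t) ((y + z) t) = herm_form (H t) (x t) (y t) + herm_form (H t) (x t) (z t)" for t
      by (simp add: herm_form_eq algebra_simps)
    ultimately show "L2H_inner H x (y + z) = L2H_inner H x y + L2H_inner H x z"
      by (simp add: L2H_inner_def)
  next
    fix x y c
    have "herm_form (H t) (x t) (cscale c y t) = c * herm_form (H t) (x t) (y t)" for t
      by (simp add: herm_form_eq cscale_def algebra_simps)
    then show "L2H_inner H x (cscale c y) = c * L2H_inner H x y"
      by (simp add: L2H_inner_def)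
  next
    fix x y
    have "herm_form (H t) (y t) (x t) = cnj (herm_form (H t) (x t) (y t))" for t
      by (simp add: herm_form_eq algebra_simps)
    then show "L2H_inner H y x = cnj (L2H_inner H x y)"
      by (simp add: L2H_inner_def)
  next
    fix x show "Re (L2H_inner H x x) \<ge> 0" by (simp add: L2H_inner_self)
  qed
qed

lemma nrm_eq: "nrm = L2H_norm H"
  by (auto simp: nrm_def L2H_norm_def)

lemma eqv_eq: "eqv = L2H_eq H"
  by (auto simp: eqv_def L2H_eq_def nrm_eq fun_diff_def fun_eq_iff)

lemma nrm_sq_weight: "f \<in> L2H H \<Longrightarrow> (nrm f)\<^sup>2 = (LINT x|half_line. weight f x)"
  by (simp add: nrm_sq L2H_inner_self)

lemma nn_integral_weight: "f \<in> L2H H \<Longrightarrow> (\<integral>\<^sup>+x. weight f x \<partial>half_line) = ennreal ((nrm f)\<^sup>2)"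
  by (subst nn_integral_eq_integral) (auto simp: L2H_iff nrm_sq_weight)

lemma eqv_iff_AE:
  assumes "f \<in> L2H H" "g \<in> L2H H"
  shows "eqv f g \<longleftrightarrow> (AE x in half_line. p x * cmod (f x $ 1 - g x $ 1) = 0 \<and> q x * cmod (f x $ 2 - g x $ 2) = 0)"
proof -
  have fg: "f - g \<in> L2H H" using assms by simp
  have "eqv f g \<longleftrightarrow> (LINT x|half_line. weight (f - g) x) = 0"
    using nrm_sq_weight[OF fg] assms by (auto simp: eqv_def)
  also have "\<dots> \<longleftrightarrow> (AE x in half_line. weight (f - g) x = 0)"
    using L2H_D(2)[OF fg] by (intro integral_nonneg_eq_0_iff_AE) auto
  also have "\<dots> \<longleftrightarrow> (AE x in half_line. p x * cmod (f x $ 1 - g x $ 1) = 0 \<and> q x * cmod (f x $ 2 - g x $ 2) = 0)"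
    by (intro AE_cong) (auto simp: weight_def pq add_nonneg_eq_0_iff)
  finally show ?thesis .
qed

text \<open>A component of weight zero contributes nothing to the density, whether or not it converges.\<close>

lemma weight_limit:
  assumes "p x = 0 \<or> (\<lambda>n. u n $ 1) \<longlonglongrightarrow> v $ 1" "q x = 0 \<or> (\<lambda>n. u n $ 2) \<longlonglongrightarrow> v $ 2"
  shows "(\<lambda>n. weight (\<lambda>_. w - u n) x) \<longlonglongrightarrow> weight (\<lambda>_. w - v) x"
proof -
  have "(\<lambda>n. p x * (cmod (w $ 1 - u n $ 1))\<^sup>2) \<longlonglongrightarrow> p x * (cmod (w $ 1 - v $ 1))\<^sup>2"
    using assms(1) by (cases "p x = 0") (auto intro!: tendsto_intros)
  moreover have "(\<lambda>n. q x * (cmod (w $ 2 - u n $ 2))\<^sup>2) \<longlonglongrightarrow> q x * (cmod (w $ 2 - v $ 2))\<^sup>2"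
    using assms(2) by (cases "q x = 0") (auto intro!: tendsto_intros)
  ultimately show ?thesis by (simp add: weight_def tendsto_add)
qed

text \<open>The Riesz-Fischer argument. If the steps decrease like \<open>s\<^sup>n\<close> in norm, the sum of \<open>s\<^sup>-\<^sup>n\<close> times their densities is
  integrable, so almost everywhere the steps themselves are bounded by a geometric sequence. The components
  then converge wherever their weight is positive, and Fatou's lemma gives convergence in norm.\<close>

lemma L2H_geometric_complete:
  assumes u: "\<And>n. u n \<in> L2H H" and \<rho>: "0 \<le> \<rho>" "\<rho> < 1"
    and step: "\<And>n. nrm (u (Suc n) - u n) \<le> K * \<rho> ^ n"
  shows "\<exists>v\<in>L2H H. (\<lambda>n. nrm (u n - v)) \<longlonglongrightarrow> 0"
proof -
  \<comment> \<open>the ratio is made positive, since it is divided by below\<close>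
  define s where "s = max \<rho> (1/2)"
  have s: "0 < s" "s < 1" "\<rho> \<le> s" using \<rho> by (auto simp: s_def)
  have K: "K \<ge> 0" using order_trans[OF nrm_nonneg[of "u (Suc 0) - u 0"] step[of 0]] u by simp
  have step: "nrm (u (Suc n) - u n) \<le> K * s ^ n" for n
    using step[of n] power_mono[OF s(3) \<rho>(1), of n] mult_left_mono[OF _ K] by (meson order_trans)
  define d where "d n = u (Suc n) - u n" for n
  have d: "d n \<in> L2H H" for n using u by (simp add: d_def)
  have [measurable]: "weight (d n) \<in> borel_measurable half_line" for n
    using L2H_D(2)[OF d] by (rule borel_measurable_integrable)
  have AE_fin: "AE x in half_line. (\<Sum>n. ennreal (weight (d n) x / s ^ n)) \<noteq> \<infinity>"
  proof (rule nn_integral_PInf_AE)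
    have "(\<integral>\<^sup>+x. ennreal (weight (d n) x / s ^ n) \<partial>half_line) \<le> ennreal (K\<^sup>2 * s ^ n)" for n
    proof -
      have "(\<integral>\<^sup>+x. ennreal (weight (d n) x / s ^ n) \<partial>half_line) = (\<integral>\<^sup>+x. ennreal (1 / s ^ n) * ennreal (weight (d n) x) \<partial>half_line)"
        using s by (intro nn_integral_cong) (simp flip: ennreal_mult)
      also have "\<dots> = ennreal (1 / s ^ n) * ennreal ((nrm (d n))\<^sup>2)"
        by (subst nn_integral_cmult) (auto simp: nn_integral_weight[OF d])
      also have "\<dots> = ennreal ((nrm (d n))\<^sup>2 / s ^ n)" using s by (simp flip: ennreal_mult)
      also have "\<dots> \<le> ennreal (K\<^sup>2 * s ^ n)"
      proof (rule ennreal_leI)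
        have "(nrm (d n))\<^sup>2 \<le> (K * s ^ n)\<^sup>2" using step[of n] nrm_nonneg[OF d] by (intro power_mono) (auto simp: d_def)
        then have "(nrm (d n))\<^sup>2 / s ^ n \<le> (K * s ^ n)\<^sup>2 / s ^ n" using s by (intro divide_right_mono) auto
        also have "\<dots> = K\<^sup>2 * s ^ n" using s by (simp add: power2_eq_square)
        finally show "(nrm (d n))\<^sup>2 / s ^ n \<le> K\<^sup>2 * s ^ n" .
      qed
      finally show ?thesis .
    qed
    then have "(\<integral>\<^sup>+x. (\<Sum>n. ennreal (weight (d n) x / s ^ n)) \<partial>half_line) \<le> (\<Sum>n. ennreal (K\<^sup>2 * s ^ n))"
      by (subst nn_integral_suminf) (auto intro!: suminf_le)
    also have "\<dots> = ennreal (\<Sum>n. K\<^sup>2 * s ^ n)"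
      using s by (intro suminf_ennreal2 summable_mult summable_geometric) auto
    also have "\<dots> < \<infinity>" by simp
    finally show "(\<integral>\<^sup>+x. (\<Sum>n. ennreal (weight (d n) x / s ^ n)) \<partial>half_line) \<noteq> \<infinity>" by simp
  qed measurable
  define v :: "real \<Rightarrow> complex^2" where "v x = (\<chi> i. lim (\<lambda>n. u n x $ i))" for x
  have conv: "AE x in half_line. (p x = 0 \<or> (\<lambda>n. u n x $ 1) \<longlonglongrightarrow> v x $ 1) \<and> (q x = 0 \<or> (\<lambda>n. u n x $ 2) \<longlonglongrightarrow> v x $ 2)"
    using AE_fin
  proof eventually_elim
    case (elim x)
    have sm: "summable (\<lambda>n. weight (d n) x / s ^ n)"
      by (rule summable_suminf_not_top) (use elim s in auto)
    obtain B where "\<And>n. norm (weight (d n) x / s ^ n) \<le> B"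
      using summable_imp_Bseq[OF sm] unfolding Bseq_def by blast
    then have B: "weight (d n) x / s ^ n \<le> B" for n
      unfolding real_norm_def by (rule order_trans[OF abs_ge_self])
    have aux: "(\<lambda>n. u n x $ i) \<longlonglongrightarrow> v x $ i" if c: "c > 0" and le: "\<And>n. c * (cmod (d n x $ i))\<^sup>2 \<le> weight (d n) x" for i c
    proof -
      have bd: "cmod (d n x $ i) \<le> sqrt (B / c) * sqrt s ^ n" for n
      proof (rule power2_le_imp_le)
        have le': "c * (cmod (d n x $ i))\<^sup>2 \<le> B * s ^ n"
          using le[of n] B[of n] s by (simp add: pos_divide_le_eq)
        have "B \<ge> 0" using order_trans[OF weight_nonneg[of "d 0" x]] B[of 0] by simp
        then show "(cmod (d n x $ i))\<^sup>2 \<le> (sqrt (B / c) * sqrt s ^ n)\<^sup>2"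
        proof -
          have "(sqrt s ^ n)\<^sup>2 = ((sqrt s)\<^sup>2) ^ n" by (simp only: power_mult[symmetric] mult.commute)
          then have "(sqrt (B / c) * sqrt s ^ n)\<^sup>2 = B * s ^ n / c"
            using s c \<open>B \<ge> 0\<close> by (simp add: power_mult_distrib)
          then show ?thesis using c by (simp add: pos_le_divide_eq mult.commute le')
        qed
        show "0 \<le> sqrt (B / c) * sqrt s ^ n" using \<open>B \<ge> 0\<close> c s by simp
      qed
      have "summable (\<lambda>n. d n x $ i)"
        by (rule summable_comparison_test'[OF summable_mult[OF summable_geometric[of "sqrt s"]], of "0" _ "sqrt (B / c)"]) (use s bd in auto)
      then have "convergent (\<lambda>n. \<Sum>k<n. d k x $ i)" by (simp add: summable_iff_convergent)
      moreover have "(\<Sum>k<n. d k x $ i) = u n x $ i - u 0 x $ i" for n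
        by (induction n) (auto simp: d_def)
      ultimately have "convergent (\<lambda>n. u n x $ i - u 0 x $ i)" by simp
      then have "convergent (\<lambda>n. u n x $ i)"
        using convergent_add[OF _ convergent_const[of "u 0 x $ i"]] by fastforce
      then show ?thesis by (simp add: v_def convergent_LIMSEQ_iff)
    qed
    show ?case
    proof (intro conjI)
      show "p x = 0 \<or> (\<lambda>n. u n x $ 1) \<longlonglongrightarrow> v x $ 1"
        using aux[of "p x" 1] pq(1,2)[of x] by (cases "p x = 0") (auto simp: weight_def)
      show "q x = 0 \<or> (\<lambda>n. u n x $ 2) \<longlonglongrightarrow> v x $ 2"
        using aux[of "q x" 2] pq(1,2)[of x] by (cases "q x = 0") (auto simp: weight_def)
    qed
  qed
  have v_meas: "v \<in> borel_measurable half_line"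
  proof (rule measurable_vec_2I)
    fix i
    have "(\<lambda>x. lim (\<lambda>n. u n x $ i)) \<in> borel_measurable half_line"
      by (rule borel_measurable_lim_metric) (rule L2H_D(3)[OF u])
    then show "(\<lambda>x. v x $ i) \<in> borel_measurable half_line" by (simp add: v_def)
  qed
  have dist: "nrm (u n - u (n + k)) \<le> K * s ^ n / (1 - s)" for n k
  proof -
    have "nrm (u n - u (n + k)) \<le> K * s ^ n * (1 - s ^ k) / (1 - s)"
    proof (induction k)
      case (Suc k)
      have "nrm (u n - u (n + Suc k)) \<le> nrm (u n - u (n + k)) + nrm (u (Suc (n + k)) - u (n + k))"
        using nrm_triangle3[of "u n" "u (n + k)" "u (n + Suc k)"]
          nrm_minus_commute[of "u (n + k)" "u (n + Suc k)"] u by simp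
      also have "\<dots> \<le> K * s ^ n * (1 - s ^ k) / (1 - s) + K * s ^ (n + k)"
        by (intro add_mono Suc step)
      also have "\<dots> = K * s ^ n * (1 - s ^ Suc k) / (1 - s)"
        using s by (simp add: field_simps power_add)
      finally show ?case .
    next
      case 0
      have "nrm (u n - u (n + 0)) = 0" by (metis add_0_right diff_self nrm_zero)
      then show ?case by (simp only: power_0 diff_self mult_zero_right div_0 order_refl)
    qed
    also have "\<dots> \<le> K * s ^ n / (1 - s)" using s K by (intro divide_right_mono mult_left_le) auto
    finally show ?thesis .
  qed
  have fatou: "(\<integral>\<^sup>+x. weight (u n - v) x \<partial>half_line) \<le> ennreal ((K * s ^ n / (1 - s))\<^sup>2)" for n
  proof -
    have "AE x in half_line. ennreal (weight (u n - v) x) = liminf (\<lambda>k. ennreal (weight (u n - u (n + k)) x))"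
      using conv
    proof eventually_elim
      case (elim x)
      then have "(\<lambda>k. weight (\<lambda>_. u n x - u (n + k) x) x) \<longlonglongrightarrow> weight (\<lambda>_. u n x - v x) x"
        by (intro weight_limit) (auto simp: add.commute[of n] intro: LIMSEQ_ignore_initial_segment)
      then have "(\<lambda>k. ennreal (weight (u n - u (n + k)) x)) \<longlonglongrightarrow> ennreal (weight (u n - v) x)"
        by (intro tendsto_ennrealI) (simp add: weight_def)
      from lim_imp_Liminf[OF sequentially_bot this] show ?case by (rule sym)
    qed
    then have "(\<integral>\<^sup>+x. weight (u n - v) x \<partial>half_line) = (\<integral>\<^sup>+x. liminf (\<lambda>k. ennreal (weight (u n - u (n + k)) x)) \<partial>half_line)"
      by (rule nn_integral_cong_AE)
    also have "\<dots> \<le> liminf (\<lambda>k. \<integral>\<^sup>+x. ennreal (weight (u n - u (n + k)) x) \<partial>half_line)"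
    proof (rule nn_integral_liminf)
      fix k
      have "weight (u n - u (n + k)) \<in> borel_measurable half_line"
        by (rule weight_measurable[OF L2H_D(1)]) (use u in simp)
      then show "(\<lambda>x. ennreal (weight (u n - u (n + k)) x)) \<in> borel_measurable half_line" by simp
    qed
    also have "\<dots> \<le> liminf (\<lambda>k. ennreal ((K * s ^ n / (1 - s))\<^sup>2))"
    proof (intro Liminf_mono always_eventually allI)
      fix k
      have "(nrm (u n - u (n + k)))\<^sup>2 \<le> (K * s ^ n / (1 - s))\<^sup>2"
        using dist[of n k] u by (intro power_mono) auto
      then show "(\<integral>\<^sup>+x. ennreal (weight (u n - u (n + k)) x) \<partial>half_line) \<le> ennreal ((K * s ^ n / (1 - s))\<^sup>2)"
        using u by (simp add: nn_integral_weight ennreal_leI)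
    qed
    also have "\<dots> = ennreal ((K * s ^ n / (1 - s))\<^sup>2)" by (simp add: Liminf_const)
    finally show ?thesis .
  qed
  have uv: "u n - v \<in> L2H H" for n
  proof -
    have m: "u n - v \<in> borel_measurable half_line"
      unfolding fun_diff_def using L2H_D(1)[OF u] v_meas by (intro borel_measurable_diff)
    moreover have "integrable half_line (weight (u n - v))"
      using fatou[of n] weight_measurable[OF m]
      by (intro integrableI_bounded) (auto intro: le_less_trans)
    ultimately show ?thesis by (simp add: L2H_iff)
  qed
  have "u 0 - (u 0 - v) \<in> L2H H" by (rule Y_simps(3)[OF u uv])
  moreover have "u 0 - (u 0 - v) = v" by (simp add: fun_eq_iff)
  ultimately have v: "v \<in> L2H H" by (simp only:)
  have "nrm (u n - v) \<le> K * s ^ n / (1 - s)" for n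
  proof (rule power2_le_imp_le)
    show "(nrm (u n - v))\<^sup>2 \<le> (K * s ^ n / (1 - s))\<^sup>2"
      using fatou[of n] by (simp add: nn_integral_weight[OF uv])
  qed (use K s in auto)
  then have bd: "\<forall>\<^sub>F n in sequentially. norm (nrm (u n - v)) \<le> K * s ^ n / (1 - s)"
    using nrm_nonneg[OF uv] by (intro always_eventually allI) (simp only: real_norm_def abs_of_nonneg)
  have "(\<lambda>n. K * s ^ n / (1 - s)) \<longlonglongrightarrow> K * 0 / (1 - s)"
    using s by (intro tendsto_intros LIMSEQ_power_zero) auto
  then have "(\<lambda>n. K * s ^ n / (1 - s)) \<longlonglongrightarrow> 0" by simp
  from Lim_null_comparison[OF bd this] have "(\<lambda>n. nrm (u n - v)) \<longlonglongrightarrow> 0" .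
  with v show ?thesis by blast
qed

sublocale semi_hilbert cscale "L2H H" "L2H_inner H"
  by unfold_locales (rule L2H_geometric_complete)

section \<open>The canonical relation is symmetric\<close>

text \<open>The two scalar equations behind \<open>J f' = - H h\<close>, for the components \<open>a\<close>, \<open>b\<close> of \<open>f\<close>, with the boundary condition.\<close>

definition solves :: "(real \<Rightarrow> complex^2) \<Rightarrow> (real \<Rightarrow> complex) \<Rightarrow> (real \<Rightarrow> complex) \<Rightarrow> bool" where
  "solves h a b \<longleftrightarrow> loc_abs_cont a \<and> loc_abs_cont b \<and> b 0 = 0 \<and>
     (AE x in half_line. (a has_vector_derivative - (of_real (q x) * h x $ 2)) (at x)) \<and>
     (AE x in half_line. (b has_vector_derivative of_real (p x) * h x $ 1) (at x))"

lemma solvesD: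
  assumes "solves h a b"
  shows "loc_abs_cont a" "loc_abs_cont b" "b 0 = 0"
    "AE x in half_line. (a has_vector_derivative - (of_real (q x) * h x $ 2)) (at x)"
    "AE x in half_line. (b has_vector_derivative of_real (p x) * h x $ 1) (at x)"
  using assms by (auto simp: solves_def)

lemma canonical_relation_iff:
  "(f, h) \<in> canonical_relation H \<longleftrightarrow> f \<in> L2H H \<and> h \<in> L2H H \<and> (\<exists>a b. eqv f (cvec2 a b) \<and> solves h a b)"
  (is "?L \<longleftrightarrow> ?fh \<and> ?h \<and> (\<exists>a b. ?P a b)")
proof
  assume ?L
  then obtain f0 where f0: "?fh" "?h" "eqv f f0" "loc_abs_cont f0" "f0 0 $ 2 = 0"
    "AE x in half_line. \<exists>d. (f0 has_vector_derivative d) (at x) \<and> J *v d = - (cplx_mat (H x) *v h x)"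
    by (auto simp: canonical_relation_def eqv_eq)
  have "?P (\<lambda>x. f0 x $ 1) (\<lambda>x. f0 x $ 2)"
    unfolding solves_def
  proof (intro conjI)
    show "eqv f (cvec2 (\<lambda>x. f0 x $ 1) (\<lambda>x. f0 x $ 2))" using f0 by (simp add: cvec2_eta)
    show "loc_abs_cont (\<lambda>x. f0 x $ 1)" "loc_abs_cont (\<lambda>x. f0 x $ 2)"
      by (auto intro!: loc_abs_cont_linear[OF f0(4)] bounded_linear_vec_nth)
    have comp: "((\<lambda>x. f0 x $ i) has_vector_derivative d $ i) (at x)" if "(f0 has_vector_derivative d) (at x)" for i d x
      using bounded_linear.has_vector_derivative[OF bounded_linear_vec_nth that] .
    show "AE x in half_line. ((\<lambda>x. f0 x $ 1) has_vector_derivative - (of_real (q x) * h x $ 2)) (at x)"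
      using f0(6)
    proof eventually_elim
      case (elim x)
      then obtain d where d: "(f0 has_vector_derivative d) (at x)" "J *v d = - (cplx_mat (H x) *v h x)" by blast
      then show ?case using comp[OF d(1), of 1] by (simp only: J_eq_iff q_def)
    qed
    show "AE x in half_line. ((\<lambda>x. f0 x $ 2) has_vector_derivative of_real (p x) * h x $ 1) (at x)"
      using f0(6)
    proof eventually_elim
      case (elim x)
      then obtain d where d: "(f0 has_vector_derivative d) (at x)" "J *v d = - (cplx_mat (H x) *v h x)" by blast
      then show ?case using comp[OF d(1), of 2] by (simp only: J_eq_iff p_def)
    qed
  qed (rule f0)
  then show "?fh \<and> ?h \<and> (\<exists>a b. ?P a b)" using f0(1,2) by blast
next
  assume R: "?fh \<and> ?h \<and> (\<exists>a b. ?P a b)"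
  then obtain a b where P: "eqv f (cvec2 a b)" and ab: "solves h a b" by blast
  note ab = solvesD[OF ab]
  have ax: "bounded_linear (axis i :: complex \<Rightarrow> complex^2)" for i by (rule bounded_linear_axis)
  have "AE x in half_line. \<exists>d. (cvec2 a b has_vector_derivative d) (at x) \<and> J *v d = - (cplx_mat (H x) *v h x)"
    using ab(4,5)
  proof eventually_elim
    case (elim x)
    let ?d = "axis 1 (- (of_real (q x) * h x $ 2)) + axis 2 (of_real (p x) * h x $ 1) :: complex^2"
    have "(cvec2 a b has_vector_derivative ?d) (at x)"
      unfolding cvec2_def
      by (intro has_vector_derivative_add bounded_linear.has_vector_derivative[OF ax] elim)
    moreover have "?d $ 1 = - (of_real (q x) * h x $ 2)" "?d $ 2 = of_real (p x) * h x $ 1"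
      by (auto simp: axis_def)
    then have "J *v ?d = - (cplx_mat (H x) *v h x)" by (simp only: J_eq_iff p_def q_def)
    ultimately show ?case by blast
  qed
  moreover have "loc_abs_cont (cvec2 a b)"
    unfolding cvec2_def using ab by (intro loc_abs_cont_add loc_abs_cont_linear[OF _ ax]) auto
  ultimately show ?L
    using R P ab unfolding canonical_relation_def eqv_eq[symmetric] by (auto intro!: exI[of _ "cvec2 a b"])
qed

lemma solves_add:
  assumes h: "solves h a b" and k: "solves k c d"
  shows "solves (h + k) (\<lambda>x. a x + c x) (\<lambda>x. b x + d x)"
proof -
  have "AE x in half_line. ((\<lambda>x. a x + c x) has_vector_derivative - (of_real (q x) * (h + k) x $ 2)) (at x)"
    using solvesD(4)[OF h] solvesD(4)[OF k]
    by eventually_elim (rule has_vector_derivative_eq_rhs[OF has_vector_derivative_add], assumption+, simp add: algebra_simps)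
  moreover have "AE x in half_line. ((\<lambda>x. b x + d x) has_vector_derivative of_real (p x) * (h + k) x $ 1) (at x)"
    using solvesD(5)[OF h] solvesD(5)[OF k]
    by eventually_elim (rule has_vector_derivative_eq_rhs[OF has_vector_derivative_add], assumption+, simp add: algebra_simps)
  ultimately show ?thesis
    unfolding solves_def using solvesD(1-3)[OF h] solvesD(1-3)[OF k] by (simp add: loc_abs_cont_add)
qed

lemma solves_scale:
  assumes h: "solves h a b"
  shows "solves (cscale z h) (\<lambda>x. z * a x) (\<lambda>x. z * b x)"
proof -
  have "AE x in half_line. ((\<lambda>x. z * a x) has_vector_derivative - (of_real (q x) * cscale z h x $ 2)) (at x)"
    using solvesD(4)[OF h]
    by eventually_elim (rule has_vector_derivative_eq_rhs[OF has_vector_derivative_mult_right], assumption, simp add: cscale_def)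
  moreover have "AE x in half_line. ((\<lambda>x. z * b x) has_vector_derivative of_real (p x) * cscale z h x $ 1) (at x)"
    using solvesD(5)[OF h]
    by eventually_elim (rule has_vector_derivative_eq_rhs[OF has_vector_derivative_mult_right], assumption, simp add: cscale_def)
  ultimately show ?thesis
    unfolding solves_def using solvesD(1-3)[OF h]
    by (auto intro: loc_abs_cont_linear[OF _ bounded_linear_mult_right])
qed

lemma solves_cong:
  assumes h: "solves h a b" and e: "eqv h h'"
  shows "solves h' a b"
proof -
  have L: "h \<in> L2H H" "h' \<in> L2H H" using e by (auto simp: eqv_def)
  have eq: "AE x in half_line. of_real (p x) * h x $ 1 = of_real (p x) * h' x $ 1 \<and> of_real (q x) * h x $ 2 = of_real (q x) * h' x $ 2"
    using e unfolding eqv_iff_AE[OF L] by eventually_elim auto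
  have "AE x in half_line. (a has_vector_derivative - (of_real (q x) * h' x $ 2)) (at x)"
    using solvesD(4)[OF h] eq by eventually_elim auto
  moreover have "AE x in half_line. (b has_vector_derivative of_real (p x) * h' x $ 1) (at x)"
    using solvesD(5)[OF h] eq by eventually_elim auto
  ultimately show ?thesis unfolding solves_def using solvesD(1-3)[OF h] by blast
qed

text \<open>Because \<open>q = 1 - p\<close> and \<open>p\<close> is integrable, \<open>q / x\<close> has a logarithmically divergent integral, just as \<open>1 / x\<close>.\<close>

lemma half_line_log_divergent:
  assumes c: "c > 0" and b: "integrable half_line (\<lambda>x. q x * (cmod (b x))\<^sup>2)"
    and low: "\<And>x. x \<ge> X \<Longrightarrow> c / x \<le> (cmod (b x))\<^sup>2" and X: "X > 0"
  shows False
proof -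
  define B where "B = (LINT x|half_line. q x * (cmod (b x))\<^sup>2) + c / X * (LINT x|half_line. p x)"
  have bound: "c * ln (Y / X) \<le> B" if Y: "Y > X" for Y
  proof -
    have deriv: "((\<lambda>x. c * ln x) has_vector_derivative c / x) (at x within {X..Y})" if "x \<in> {X..Y}" for x
      using that X by (auto intro!: derivative_eq_intros simp: has_real_derivative_iff_has_vector_derivative[symmetric])
    have "((\<lambda>x. c / x) has_integral (c * ln Y - c * ln X)) {X..Y}"
      using Y deriv by (intro fundamental_theorem_of_calculus) auto
    then have hi: "((\<lambda>x. if x \<in> {X..Y} then c / x else 0) has_integral c * ln (Y / X)) {0<..}"
      using X Y by (subst has_integral_restrict) (auto simp: ln_div algebra_simps)
    have I: "integrable half_line (\<lambda>x. q x * (cmod (b x))\<^sup>2 + c / X * p x)"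
      using b p_int by auto
    have "((\<lambda>x. q x * (cmod (b x))\<^sup>2 + c / X * p x) has_integral B) {0<..}"
      using has_integral_integral_lebesgue_on[OF I] b p_int by (simp add: B_def)
    from hi this show ?thesis
    proof (rule has_integral_le)
      fix x :: real assume x: "x \<in> {0<..}"
      show "(if x \<in> {X..Y} then c / x else 0) \<le> q x * (cmod (b x))\<^sup>2 + c / X * p x"
      proof (cases "x \<in> {X..Y}")
        case True
        have "c / x = q x * (c / x) + p x * (c / x)" using pq(3)[of x] by (metis add.commute distrib_right mult_1)
        also have "\<dots> \<le> q x * (cmod (b x))\<^sup>2 + p x * (c / X)"
          using True X c low[of x] pq[of x] by (intro add_mono mult_left_mono divide_left_mono) auto
        finally show ?thesis using True by (simp add: mult.commute)
      next
        case False
        then show ?thesis using pq[of x] c X by auto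
      qed
    qed
  qed
  define Y where "Y = X * exp (\<bar>B\<bar> / c + 1)"
  have "exp (\<bar>B\<bar> / c + 1) > 1" using c by (simp add: add_nonneg_pos)
  then have "Y > X" using X by (simp add: Y_def)
  from bound[OF this] have "c * (\<bar>B\<bar> / c + 1) \<le> B" using X by (simp add: Y_def)
  then have "\<bar>B\<bar> + c \<le> B" using c by (simp add: distrib_left)
  then show False using c by linarith
qed

text \<open>The Cauchy-Schwarz inequality for \<open>\<integral> q \<bar>s\<bar>\<close> over \<open>(0, x)\<close>, in the weak form obtained by integrating
  \<open>q \<bar>s\<bar> \<le> sqrt x (q \<bar>s\<bar>\<^sup>2) + 1 / sqrt x\<close>, where \<open>x\<close> is the fixed right end point.\<close>

lemma sqrt_bound_of_derivative:
  assumes a: "loc_abs_cont a" "AE x in half_line. (a has_vector_derivative - (of_real (q x) * s x)) (at x)"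
    and W: "integrable half_line (\<lambda>x. q x * (cmod (s x))\<^sup>2)"
  obtains C where "C > 0" "\<And>x. x \<ge> 1 \<Longrightarrow> cmod (a x) \<le> C * sqrt x"
proof -
  define w where "w = (LINT x|half_line. q x * (cmod (s x))\<^sup>2)"
  define C where "C = cmod (a 0) + w + 1"
  have w0: "w \<ge> 0" unfolding w_def using pq by (intro Bochner_Integration.integral_nonneg) auto
  have "cmod (a x) \<le> C * sqrt x" if x: "x \<ge> 1" for x
  proof -
    have x0: "x \<ge> 0" "sqrt x \<ge> 1" using x by auto
    have i1: "((\<lambda>x. - (of_real (q x) * s x)) has_integral (a x - a 0)) {0..x}"
      by (rule loc_abs_cont_has_integral[OF a x0(1)])
    define w' where "w' = (LINT y|half_line. indicator {..x} y *\<^sub>R (q y * (cmod (s y))\<^sup>2))"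
    have ww: "w' \<le> w"
      unfolding w'_def w_def using pq
      by (intro integral_mono half_line_integrable_upto W) (auto simp: indicator_def)
    have "((\<lambda>y. sqrt x * (q y * (cmod (s y))\<^sup>2) + 1 / sqrt x) has_integral (sqrt x * w' + 1 / sqrt x * (x - 0))) {0..x}"
      using has_integral_const_real[of "1 / sqrt x" 0 x] x0
      by (intro has_integral_add has_integral_mult_right half_line_has_integral_upto[OF W, of x, folded w'_def])
         (simp add: mult.commute)
    then have i2: "((\<lambda>y. sqrt x * (q y * (cmod (s y))\<^sup>2) + 1 / sqrt x) has_integral (sqrt x * w' + sqrt x)) {0..x}"
      using x0 real_div_sqrt[of x] by simp
    have "cmod (a x - a 0) \<le> sqrt x * w' + sqrt x"
    proof -
      have "norm (integral {0..x} (\<lambda>y. - (of_real (q y) * s y))) \<le> integral {0..x} (\<lambda>y. sqrt x * (q y * (cmod (s y))\<^sup>2) + 1 / sqrt x)"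
      proof (rule integral_norm_bound_integral)
        fix y
        have "cmod (s y) \<le> sqrt x * (cmod (s y))\<^sup>2 + 1 / sqrt x"
        proof -
          have "0 \<le> (sqrt x * cmod (s y) - 1)\<^sup>2 + sqrt x * cmod (s y)" using x0 by simp
          also have "\<dots> = (sqrt x * (cmod (s y))\<^sup>2 + 1 / sqrt x - cmod (s y)) * sqrt x"
            using x0 by (simp add: power2_eq_square algebra_simps)
          finally have "0 \<le> (sqrt x * (cmod (s y))\<^sup>2 + 1 / sqrt x - cmod (s y)) * sqrt x" .
          then show ?thesis using x0 by (simp add: zero_le_mult_iff)
        qed
        then have "q y * cmod (s y) \<le> q y * (sqrt x * (cmod (s y))\<^sup>2 + 1 / sqrt x)"
          by (rule mult_left_mono) (rule pq)
        also have "\<dots> \<le> sqrt x * (q y * (cmod (s y))\<^sup>2) + 1 / sqrt x"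
          using mult_right_mono[OF pq(5)[of y], of "1 / sqrt x"] x0 by (simp add: algebra_simps)
        finally show "norm (- (of_real (q y) * s y)) \<le> sqrt x * (q y * (cmod (s y))\<^sup>2) + 1 / sqrt x"
          using pq(2)[of y] by (simp add: norm_mult)
      qed (use i1 i2 in auto)
      then show ?thesis using i1 i2 by (simp only: integral_unique)
    qed
    then have "cmod (a x - a 0) \<le> sqrt x * w + sqrt x" using mult_left_mono[OF ww, of "sqrt x"] x0 by linarith
    then have "cmod (a x) \<le> cmod (a 0) + (sqrt x * w + sqrt x)"
      using norm_triangle_ineq[of "a 0" "a x - a 0"] by simp
    also have "cmod (a 0) \<le> cmod (a 0) * sqrt x" using x0 by (simp add: mult_left_le_one_le mult_le_cancel_left1)
    finally show ?thesis by (simp add: C_def algebra_simps)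
  qed
  then show ?thesis using that[of C] w0 by (simp add: C_def add_nonneg_pos)
qed

text \<open>By the product rule the difference of the two integrals, taken over \<open>(0, x)\<close>, is \<open>cnj (a x) * b x\<close>, so this
  boundary term has a limit as \<open>x \<rightarrow> \<infinity>\<close>. If the limit were nonzero, the bound \<open>\<bar>a\<bar> \<le> C sqrt x\<close> would force
  \<open>\<bar>b\<bar>\<^sup>2 \<ge> c / x\<close>, contradicting \<open>half_line_log_divergent\<close>.\<close>

lemma form_identity:
  assumes h: "solves h a t" and k: "solves k s b"
    and L2: "cvec2 a t \<in> L2H H" "cvec2 s b \<in> L2H H" "h \<in> L2H H" "k \<in> L2H H"
  shows "(LINT x|half_line. of_real (p x) * (cnj (a x) * k x $ 1)) = (LINT x|half_line. of_real (q x) * (cnj (h x $ 2) * b x))"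
    (is "integral\<^sup>L _ ?f1 = integral\<^sup>L _ ?f2")
proof -
  note a = solvesD(1,4)[OF h] and b = solvesD(2,5,3)[OF k]
  define G where "G x = cnj (a x) * b x" for x
  define g where "g x = ?f1 x - ?f2 x" for x
  have int: "integrable half_line ?f1" "integrable half_line ?f2"
    using herm_form_integrable(1)[OF L2(1,4)] herm_form_integrable(2)[OF L2(3,2)] by auto
  have g: "integrable half_line g" unfolding g_def using int by (rule Bochner_Integration.integrable_diff)
  define L where "L = integral\<^sup>L half_line g"
  have Leq: "L = integral\<^sup>L half_line ?f1 - integral\<^sup>L half_line ?f2"
    unfolding L_def g_def using int by (rule Bochner_Integration.integral_diff)
  have "loc_abs_cont G"
    unfolding G_def by (intro loc_abs_cont_mult loc_abs_cont_linear[OF a(1) bounded_linear_cnj] b)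
  moreover have "AE x in half_line. (G has_vector_derivative g x) (at x)"
    using a(2) b(2)
  proof eventually_elim
    case (elim x)
    show ?case
      unfolding G_def
      by (rule has_vector_derivative_eq_rhs[OF has_vector_derivative_mult[OF bounded_linear.has_vector_derivative[OF bounded_linear_cnj elim(1)] elim(2)]])
         (simp add: g_def algebra_simps)
  qed
  ultimately have "(g has_integral (G x - G 0)) {0..x}" if "x \<ge> 0" for x
    using that by (rule loc_abs_cont_has_integral)
  then have Gx: "integral {0..x} g = G x" if "x \<ge> 0" for x
    using integral_unique that by (fastforce simp: G_def b(3))
  have "(G \<longlongrightarrow> L) at_top"
    unfolding L_def using half_line_integral_tendsto[OF g]
    by (rule Lim_transform_eventually) (rule eventually_mono[OF eventually_ge_at_top[of 0] Gx])
  have "L = 0"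
  proof (rule ccontr)
    assume "L \<noteq> 0"
    then have L0: "cmod L > 0" by simp
    have W: "integrable half_line (\<lambda>x. q x * (cmod (h x $ 2))\<^sup>2)" "integrable half_line (\<lambda>x. q x * (cmod (b x))\<^sup>2)"
      using integrable_norm[OF herm_form_integrable(2)[OF L2(3,3)]] integrable_norm[OF herm_form_integrable(2)[OF L2(2,2)]]
      by (auto simp: norm_mult pq power2_eq_square)
    obtain C where C: "C > 0" "\<And>x. x \<ge> 1 \<Longrightarrow> cmod (a x) \<le> C * sqrt x"
      using sqrt_bound_of_derivative[OF a W(1)] by blast
    have "\<forall>\<^sub>F x in at_top. dist (G x) L < cmod L / 2"
      using \<open>(G \<longlongrightarrow> L) at_top\<close> L0 by (intro tendstoD) auto
    then obtain X0 where X0: "\<And>x. x \<ge> X0 \<Longrightarrow> dist (G x) L < cmod L / 2"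
      by (auto simp: eventually_at_top_linorder)
    show False
    proof (rule half_line_log_divergent[OF _ W(2), of "(cmod L / (2 * C))\<^sup>2" "max X0 1"])
      fix x assume x: "x \<ge> max X0 1"
      have "cmod L - dist (G x) L \<le> cmod (G x)"
        using norm_triangle_ineq[of "G x" "L - G x"] by (simp add: dist_norm norm_minus_commute)
      then have "cmod L / 2 \<le> cmod (G x)" using X0[of x] x by simp
      also have "\<dots> = cmod (a x) * cmod (b x)" by (simp add: G_def norm_mult)
      also have "\<dots> \<le> C * sqrt x * cmod (b x)" using C(2)[of x] x by (intro mult_right_mono) auto
      finally have "cmod L / (2 * C) \<le> sqrt x * cmod (b x)" using C(1) by (simp add: field_simps)
      then have "(cmod L / (2 * C))\<^sup>2 \<le> (sqrt x * cmod (b x))\<^sup>2" using L0 C by (intro power_mono) auto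
      also have "\<dots> = x * (cmod (b x))\<^sup>2" using x by (simp add: power_mult_distrib)
      finally show "(cmod L / (2 * C))\<^sup>2 / x \<le> (cmod (b x))\<^sup>2"
        using x by (simp add: pos_divide_le_eq mult.commute)
    qed (use L0 C in auto)
  qed
  then show ?thesis using Leq by simp
qed

text \<open>Symmetry is two instances of \<open>form_identity\<close>, one pairing \<open>f\<^sub>1\<close> with \<open>g\<^sub>2\<close> and one pairing \<open>g\<^sub>1\<close> with \<open>f\<^sub>2\<close>.\<close>

lemma canonical_relation_symmetric:
  assumes fh: "(f, h) \<in> canonical_relation H" and gk: "(g, k) \<in> canonical_relation H"
  shows "L2H_inner H f k = L2H_inner H h g"
proof -
  obtain a b where ab: "eqv f (cvec2 a b)" "solves h a b" and h: "h \<in> L2H H"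
    using fh unfolding canonical_relation_iff by blast
  obtain c d where cd: "eqv g (cvec2 c d)" "solves k c d" and k: "k \<in> L2H H"
    using gk unfolding canonical_relation_iff by blast
  have cvec2: "cvec2 a b \<in> L2H H" "cvec2 c d \<in> L2H H" using ab(1) cd(1) by (auto simp: eqv_def)
  note 1 = form_identity[OF ab(2) cd(2) cvec2 h k]
  note 2 = form_identity[OF cd(2) ab(2) cvec2(2,1) k h]
  have 3: "(LINT x|half_line. of_real (p x) * (cnj (h x $ 1) * c x)) = (LINT x|half_line. of_real (q x) * (cnj (b x) * k x $ 2))"
    using arg_cong[OF 2, of cnj] by (simp add: mult.commute flip: Bochner_Integration.integral_cnj)
  have "L2H_inner H f k = L2H_inner H (cvec2 a b) k" by (rule eqv_ip(2)[OF ab(1) k])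
  also have "\<dots> = L2H_inner H h (cvec2 c d)"
    using 1 3 by (simp add: L2H_inner_eq cvec2 h k)
  also have "\<dots> = L2H_inner H h g" using eqv_ip(1)[OF cd(1) h] by simp
  finally show ?thesis .
qed

sublocale symmetric_relation cscale "L2H H" "L2H_inner H" "canonical_relation H"
proof
  fix f h assume "(f, h) \<in> canonical_relation H"
  then show "f \<in> L2H H \<and> h \<in> L2H H" by (simp add: canonical_relation_iff)
next
  have "cvec2 (\<lambda>_. 0) (\<lambda>_. 0) = 0" by (simp add: fun_eq_iff vec_eq_iff forall_2)
  then have "eqv 0 (cvec2 (\<lambda>_. 0) (\<lambda>_. 0))" by (simp only: eqv_refl Y_simps)
  moreover have "solves 0 (\<lambda>_. 0) (\<lambda>_. 0)" by (simp add: solves_def loc_abs_cont_const)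
  ultimately show "(0, 0) \<in> canonical_relation H"
    unfolding canonical_relation_iff using Y_simps(1) by blast
next
  fix f h g k assume fh: "(f, h) \<in> canonical_relation H" and gk: "(g, k) \<in> canonical_relation H"
  obtain a b where ab: "f \<in> L2H H" "h \<in> L2H H" "eqv f (cvec2 a b)" "solves h a b"
    using fh unfolding canonical_relation_iff by blast
  obtain c d where cd: "g \<in> L2H H" "k \<in> L2H H" "eqv g (cvec2 c d)" "solves k c d"
    using gk unfolding canonical_relation_iff by blast
  have eq: "cvec2 (\<lambda>x. a x + c x) (\<lambda>x. b x + d x) = cvec2 a b + cvec2 c d"
    by (simp add: fun_eq_iff vec_eq_iff forall_2)
  have "eqv (f + g) (cvec2 (\<lambda>x. a x + c x) (\<lambda>x. b x + d x))"
    unfolding eq by (rule eqv_add[OF ab(3) cd(3)])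
  then show "(f + g, h + k) \<in> canonical_relation H"
    unfolding canonical_relation_iff
    using L2H_add[OF ab(1) cd(1)] L2H_add[OF ab(2) cd(2)] solves_add[OF ab(4) cd(4)] by blast
next
  fix f h z assume fh: "(f, h) \<in> canonical_relation H"
  obtain a b where ab: "f \<in> L2H H" "h \<in> L2H H" "eqv f (cvec2 a b)" "solves h a b"
    using fh unfolding canonical_relation_iff by blast
  have eq: "cvec2 (\<lambda>x. z * a x) (\<lambda>x. z * b x) = cscale z (cvec2 a b)"
    by (simp add: fun_eq_iff vec_eq_iff forall_2 cscale_def)
  have "eqv (cscale z f) (cvec2 (\<lambda>x. z * a x) (\<lambda>x. z * b x))"
    unfolding eq by (rule eqv_scale[OF ab(3)])
  then show "(cscale z f, cscale z h) \<in> canonical_relation H"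
    unfolding canonical_relation_iff
    using L2H_cscale[OF ab(1)] L2H_cscale[OF ab(2)] solves_scale[OF ab(4)] by blast
next
  fix f h f' h' assume fh: "(f, h) \<in> canonical_relation H" and e: "eqv f f'" "eqv h h'"
  obtain a b where ab: "eqv f (cvec2 a b)" "solves h a b"
    using fh unfolding canonical_relation_iff by blast
  have "f' \<in> L2H H" "h' \<in> L2H H" using e by (auto simp: eqv_def)
  then show "(f', h') \<in> canonical_relation H"
    unfolding canonical_relation_iff using eqv_trans[OF eqv_sym[OF e(1)] ab(1)] solves_cong[OF ab(2) e(2)] by blast
next
  fix f h g k assume "(f, h) \<in> canonical_relation H" "(g, k) \<in> canonical_relation H"
  then show "L2H_inner H f k = L2H_inner H h g" by (rule canonical_relation_symmetric)
qed

lemma sum_fun_apply: "(\<Sum>g\<in>F. f g) x = (\<Sum>g\<in>F. f g x)" for f :: "'b \<Rightarrow> 'c \<Rightarrow> 'd::comm_monoid_add"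
  by (induction F rule: infinite_finite_induct) auto

lemma ess_eq: "ess = essential_spectrum H"
proof -
  have z: "(\<lambda>x. 0) = (0 :: real \<Rightarrow> complex^2)" by (simp add: fun_eq_iff)
  have d: "(\<lambda>x. h x - c *s f x) = h - cscale c f" for h f c by (simp add: fun_eq_iff cscale_def)
  have sm: "(\<lambda>x. \<Sum>g\<in>F. c g *s g x) = (\<Sum>g\<in>F. cscale (c g) g)" for F and c :: "(real \<Rightarrow> complex^2) \<Rightarrow> complex"
    by (simp add: fun_eq_iff sum_fun_apply cscale_def)
  have mul: "mul = multivalued_part H" unfolding mul_def multivalued_part_def z ..
  have X: "X = operator_space H" unfolding X_def operator_space_def mul ..
  have A: "A = operator_part H" unfolding A_def operator_part_def X ..
  have "rho = resolvent_set H"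
    unfolding rho_def resolvent_set_def d A[symmetric] X[symmetric] eqv_eq nrm_eq ..
  then have spec: "spec = canonical_spectrum H" unfolding spec_def canonical_spectrum_def by (simp only:)
  have eig: "eig z = eigenspace H z" for z unfolding eig_def eigenspace_def A cscale_def ..
  have "disc = discrete_spectrum H"
    unfolding disc_def discrete_spectrum_def sm spec eqv_eq nrm_eq eig ..
  with spec show ?thesis unfolding ess_def essential_spectrum_def by (simp only:)
qed

section \<open>Test functions far out\<close>

definition p_tail where "p_tail x = (LINT t|half_line. p t) - integral {0..x} p"

lemma p_tail_nonneg: "p_tail x \<ge> 0"
proof -
  have "(LINT t|half_line. indicator {..x} t *\<^sub>R p t) \<le> (LINT t|half_line. p t)"
    using pq by (intro integral_mono half_line_integrable_upto p_int) (auto simp: indicator_def)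
  then show ?thesis
    using integral_unique[OF half_line_has_integral_upto[OF p_int, of x]] by (simp add: p_tail_def)
qed

lemma p_tail_eq:
  assumes "x \<ge> 0"
  shows "p_tail x = (LINT t|lebesgue_on {x<..}. (sin (\<phi> t))\<^sup>2)"
proof -
  have "p_tail x = (LINT t|half_line. p t) - (LINT t|half_line. indicator {..x} t *\<^sub>R p t)"
    using integral_unique[OF half_line_has_integral_upto[OF p_int, of x]] by (simp add: p_tail_def)
  also have "\<dots> = (LINT t|half_line. p t - indicator {..x} t *\<^sub>R p t)"
    by (intro Bochner_Integration.integral_diff[symmetric] p_int half_line_integrable_upto)
  also have "\<dots> = (LINT t|lebesgue. indicator {0<..} t *\<^sub>R (p t - indicator {..x} t *\<^sub>R p t))"
    by (subst integral_restrict_space) auto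
  also have "\<dots> = (LINT t|lebesgue. indicator {x<..} t *\<^sub>R p t)"
    using assms by (intro Bochner_Integration.integral_cong) (auto simp: indicator_def)
  also have "\<dots> = (LINT t|lebesgue_on {x<..}. p t)"
    by (subst integral_restrict_space) auto
  finally show ?thesis by (simp add: p_def)
qed

lemma p_tail_tendsto: "(p_tail \<longlongrightarrow> 0) at_top"
proof -
  have "((\<lambda>x. (LINT t|half_line. p t) - integral {0..x} p) \<longlongrightarrow> (LINT t|half_line. p t) - (LINT t|half_line. p t)) at_top"
    by (intro tendsto_intros half_line_integral_tendsto p_int)
  then show ?thesis by (simp add: p_tail_def[abs_def])
qed

lemma p_has_integral:
  assumes "0 \<le> x" "x \<le> y" shows "(p has_integral (p_tail x - p_tail y)) {x..y}"
  using half_line_integral_diff[OF p_int assms] by (simp add: p_tail_def)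

lemma q_has_integral:
  assumes "0 \<le> x" "x \<le> y" shows "(q has_integral (y - x - (p_tail x - p_tail y))) {x..y}"
proof -
  have "((\<lambda>t. 1 - p t) has_integral ((y - x) - (p_tail x - p_tail y))) {x..y}"
    using has_integral_const_real[of "1::real" x y] assms by (intro has_integral_diff p_has_integral) auto
  moreover have "(\<lambda>t. 1 - p t) = q" using pq(3) by (auto simp: fun_eq_iff algebra_simps)
  ultimately show ?thesis by simp
qed

text \<open>Since \<open>w\<close> is bounded, \<open>u\<close> is Lipschitz, and \<open>u' = q w\<close> almost everywhere by Lebesgue differentiation. Since \<open>w\<close>
  has bounded support, \<open>u\<close> is bounded and hence square integrable against the integrable weight \<open>p\<close>. The second
  scalar equation reads \<open>0 = 0\<close>.\<close>

lemma canonical_relation_of_slope: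
  fixes w :: "real \<Rightarrow> real"
  assumes w: "w \<in> borel_measurable borel" and C: "\<And>x. \<bar>w x\<bar> \<le> C" and z: "\<forall>x>b. w x = 0"
  defines "u \<equiv> \<lambda>x. integral {0..x} (\<lambda>t. q t * w t)"
  shows "(cvec2 (\<lambda>x. of_real (u x)) (\<lambda>_. 0), cvec2 (\<lambda>_. 0) (\<lambda>x. - of_real (w x))) \<in> canonical_relation H"
    and "weight (cvec2 (\<lambda>x. of_real (u x)) (\<lambda>_. 0)) x = p x * (u x)\<^sup>2"
    and "weight (cvec2 (\<lambda>_. 0) (\<lambda>x. - of_real (w x))) x = q x * (w x)\<^sup>2"
    and "loc_abs_cont u" and "AE x in half_line. (u has_vector_derivative q x * w x) (at x)"
    and "integrable half_line (\<lambda>t. q t * w t)"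
proof -
  have C0: "C \<ge> 0" using C[of 0] abs_ge_zero[of "w 0"] by linarith
  have [measurable]: "w \<in> borel_measurable half_line"
    using w by (intro measurable_restrict_space1 measurable_completion) simp
  have bd: "\<bar>q x * w x\<bar> \<le> C" for x
    using mult_mono[OF pq(5)[of x] C[of x]] pq(2)[of x] by (simp add: abs_mult)
  show g: "integrable half_line (\<lambda>t. q t * w t)"
    by (rule half_line_bounded_integrable[of _ C b]) (use bd z in auto)
  show lac: "loc_abs_cont u"
    unfolding u_def by (rule half_line_integral_abs_cont[OF g bd])
  show der: "AE x in half_line. (u has_vector_derivative q x * w x) (at x)"
    unfolding u_def by (rule half_line_indefinite_integral[OF g])
  show wf: "weight (cvec2 (\<lambda>x. of_real (u x)) (\<lambda>_. 0)) x = p x * (u x)\<^sup>2" for x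
    by (simp add: weight_def)
  show wh: "weight (cvec2 (\<lambda>_. 0) (\<lambda>x. - of_real (w x))) x = q x * (w x)\<^sup>2" for x
    by (simp add: weight_def)
  have cont: "continuous_on {0<..} u"
    unfolding continuous_on_iff
  proof (intro ballI allI impI)
    fix x e :: real assume x: "x \<in> {0<..}" and e: "e > 0"
    have "dist (u y) (u x) < e" if y: "y \<in> {0<..}" "dist y x < e / (C + 1)" for y
    proof -
      have "\<bar>u y - u x\<bar> \<le> C * \<bar>y - x\<bar>"
        using half_line_integral_Lipschitz[OF g bd, of x y] half_line_integral_Lipschitz[OF g bd, of y x] x y
        by (cases "x \<le> y") (auto simp: u_def abs_minus_commute)
      also have "\<dots> \<le> (C + 1) * \<bar>y - x\<bar>" by (intro mult_right_mono) auto
      also have "\<dots> < e" using y(2) C0 by (simp add: dist_real_def field_simps)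
      finally show ?thesis by (simp add: dist_real_def)
    qed
    then show "\<exists>d>0. \<forall>x'\<in>{0<..}. dist x' x < d \<longrightarrow> dist (u x') (u x) < e"
      using e C0 by (intro exI[of _ "e / (C + 1)"]) auto
  qed
  have u_meas [measurable]: "u \<in> borel_measurable half_line"
    by (rule continuous_imp_measurable_on_sets_lebesgue[OF cont]) simp
  have u_bd: "\<bar>u x\<bar> \<le> (LINT t|half_line. \<bar>q t * w t\<bar>)" for x
  proof -
    have "\<bar>u x\<bar> = \<bar>LINT y|half_line. indicator {..x} y *\<^sub>R (q y * w y)\<bar>"
      unfolding u_def using integral_unique[OF half_line_has_integral_upto[OF g, of x]] by simp
    also have "\<dots> \<le> (LINT y|half_line. \<bar>indicator {..x} y *\<^sub>R (q y * w y)\<bar>)"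
      using integral_norm_bound[of half_line "\<lambda>y. indicator {..x} y *\<^sub>R (q y * w y)"] by simp
    also have "\<dots> \<le> (LINT t|half_line. \<bar>q t * w t\<bar>)"
      using g half_line_integrable_upto[OF g, of x]
      by (intro integral_mono integrable_abs) (auto simp: indicator_def)
    finally show ?thesis .
  qed
  have f: "cvec2 (\<lambda>x. of_real (u x)) (\<lambda>_. 0) \<in> L2H H"
    unfolding L2H_iff
  proof
    show "cvec2 (\<lambda>x. of_real (u x)) (\<lambda>_. 0) \<in> borel_measurable half_line"
    proof (rule measurable_vec_2I)
      fix i :: 2 show "(\<lambda>x. cvec2 (\<lambda>x. complex_of_real (u x)) (\<lambda>_. 0) x $ i) \<in> borel_measurable half_line"
        using exhaust_2[of i] by auto
    qed
    have "integrable half_line (\<lambda>x. p x * (u x)\<^sup>2)"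
    proof (rule Bochner_Integration.integrable_bound)
      show "integrable half_line (\<lambda>x. p x * (LINT t|half_line. \<bar>q t * w t\<bar>)\<^sup>2)" using p_int by simp
      show "AE x in half_line. norm (p x * (u x)\<^sup>2) \<le> norm (p x * (LINT t|half_line. \<bar>q t * w t\<bar>)\<^sup>2)"
        using pq power_mono[OF u_bd abs_ge_zero, of _ 2] by (intro AE_I2) (auto simp: abs_mult intro!: mult_left_mono)
    qed measurable
    then show "integrable half_line (weight (cvec2 (\<lambda>x. of_real (u x)) (\<lambda>_. 0)))" by (simp add: wf[abs_def])
  qed
  have h: "cvec2 (\<lambda>_. 0) (\<lambda>x. - of_real (w x)) \<in> L2H H"
    unfolding L2H_iff
  proof
    show "cvec2 (\<lambda>_. 0) (\<lambda>x. - of_real (w x)) \<in> borel_measurable half_line"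
    proof (rule measurable_vec_2I)
      fix i :: 2 show "(\<lambda>x. cvec2 (\<lambda>_. 0) (\<lambda>x. - complex_of_real (w x)) x $ i) \<in> borel_measurable half_line"
        using exhaust_2[of i] by auto
    qed
    have "integrable half_line (\<lambda>x. q x * (w x)\<^sup>2)"
    proof (rule half_line_bounded_integrable[of _ "C\<^sup>2" b])
      fix x
      have "(w x)\<^sup>2 \<le> C\<^sup>2" using power_mono[OF C abs_ge_zero, of x 2] by simp
      then show "\<bar>q x * (w x)\<^sup>2\<bar> \<le> C\<^sup>2" using mult_mono[OF pq(5)[of x], of "(w x)\<^sup>2" "C\<^sup>2"] pq(2)[of x] by (simp add: abs_mult)
    qed (use z in auto)
    then show "integrable half_line (weight (cvec2 (\<lambda>_. 0) (\<lambda>x. - of_real (w x))))" by (simp add: wh[abs_def])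
  qed
  show "(cvec2 (\<lambda>x. of_real (u x)) (\<lambda>_. 0), cvec2 (\<lambda>_. 0) (\<lambda>x. - of_real (w x))) \<in> canonical_relation H"
    unfolding canonical_relation_iff
  proof (intro conjI exI f h)
    have "AE x in half_line. ((\<lambda>x. complex_of_real (u x)) has_vector_derivative
        - (of_real (q x) * cvec2 (\<lambda>_. 0) (\<lambda>x. - of_real (w x)) x $ 2)) (at x)"
      using der
    proof eventually_elim
      case (elim x)
      from bounded_linear.has_vector_derivative[OF bounded_linear_of_real elim, where 'a1 = complex] show ?case by simp
    qed
    then show "solves (cvec2 (\<lambda>_. 0) (\<lambda>x. - of_real (w x))) (\<lambda>x. complex_of_real (u x)) (\<lambda>_. 0)"
      using loc_abs_cont_linear[OF lac bounded_linear_of_real]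
      by (simp add: solves_def loc_abs_cont_const)
  qed (use f in simp)
qed

text \<open>The slope is \<open>1 / (2 sqrt x)\<close> on \<open>[a, b1]\<close>, then \<open>0\<close> on a stretch so long that \<open>p_tail\<close> becomes smaller than
  \<open>1 / b1\<close>, then the constant \<open>- \<kappa>\<close> on \<open>[b2 + 1, b3]\<close>, an interval long enough for \<open>u\<close> to return to \<open>0\<close> at a cost
  of at most \<open>1\<close>. With \<open>l = ln (b1 / a)\<close> this gives \<open>\<parallel>h\<parallel>\<^sup>2 \<le> l / 4 + 1\<close>. For \<open>\<parallel>f\<parallel>\<^sup>2\<close> only \<open>[0, b2]\<close> is used: there
  integration by parts turns \<open>p u\<^sup>2\<close> into \<open>2 p_tail u u'\<close>, up to the boundary term \<open>p_tail b2 u(b2)\<^sup>2 \<le> 1\<close>, and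
  \<open>p_tail x \<ge> c / x\<close> together with \<open>u \<ge> sqrt x - K\<close> gives \<open>\<parallel>f\<parallel>\<^sup>2 \<ge> c l - D - 1\<close>. The constants \<open>D\<close> and \<open>K\<close> collect
  the lower order terms and do not depend on \<open>b1\<close>, so a large \<open>l\<close> decides.\<close>

lemma test_pair:
  assumes c: "c > 0" and tail: "\<And>x. x \<ge> a \<Longrightarrow> c / x \<le> p_tail x" and a: "a > 0"
    and \<mu>: "\<mu>\<^sup>2 * c > 1 / 4" "\<mu> > 0"
  obtains b f h where "b > a" "(f, h) \<in> canonical_relation H" "nrm f \<noteq> 0" "nrm h \<le> \<mu> * nrm f"
    "\<And>x. x < a \<or> x > b \<Longrightarrow> f x = 0 \<and> h x = 0"
proof -
  define P0 where "P0 = p_tail 0"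
  have P0: "P0 \<ge> 0" by (simp add: P0_def p_tail_nonneg)
  define K where "K = sqrt a + P0 / (2 * sqrt a)"
  have K: "K > 0" using a P0 by (simp add: K_def add_pos_nonneg)
  define D where "D = c / a * P0 + c * K * (2 / sqrt a)"
  have D: "D \<ge> 0" using c a P0 K by (simp add: D_def)
  define \<beta> where "\<beta> = \<mu>\<^sup>2 * c - 1 / 4"
  have \<beta>: "\<beta> > 0" using \<mu> by (simp add: \<beta>_def)
  \<comment> \<open>the logarithm of \<open>b1 / a\<close> has to beat all the bounded error terms\<close>
  define l where "l = max ((\<mu>\<^sup>2 * (D + 1) + 1) / \<beta>) ((D + 2) / c)"
  have l: "\<beta> * l \<ge> \<mu>\<^sup>2 * (D + 1) + 1" "c * l \<ge> D + 2" "l > 0"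
  proof -
    have "(\<mu>\<^sup>2 * (D + 1) + 1) / \<beta> \<le> l" "(D + 2) / c \<le> l" by (auto simp: l_def)
    then show "\<beta> * l \<ge> \<mu>\<^sup>2 * (D + 1) + 1" "c * l \<ge> D + 2" using \<beta> c by (auto simp: field_simps)
    then show "l > 0" using c D by (smt (verit) mult_nonneg_nonpos)
  qed
  define b1 where "b1 = a * exp l"
  have b1: "b1 > a" "ln b1 - ln a = l" using a l by (auto simp: b1_def ln_mult)
  have "\<forall>\<^sub>F x in at_top. p_tail x < 1 / b1"
    using p_tail_tendsto b1 a by (intro order_tendstoD(2)) auto
  then obtain X where X: "\<And>x. x \<ge> X \<Longrightarrow> p_tail x < 1 / b1" by (auto simp: eventually_at_top_linorder)
  define b2 where "b2 = max X (b1 + 1)"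
  have b2: "b2 > b1" "p_tail b2 * b1 \<le> 1" using X[of b2] b1 a by (auto simp: b2_def field_simps)
  \<comment> \<open>makes the integral \<open>Q\<close> of \<open>q\<close> over \<open>[b2 + 1, b3]\<close> at least \<open>b1 + 1\<close>, which exceeds the squared height \<open>M\<^sup>2 \<le> b1\<close> of \<open>u\<close>\<close>
  define b3 where "b3 = b2 + 1 + b1 + P0 + 1"
  have b3: "b3 > b2 + 1" using b1 a P0 by (simp add: b3_def)
  define Q where "Q = b3 - (b2 + 1) - (p_tail (b2 + 1) - p_tail b3)"
  have Qi: "(q has_integral Q) {b2 + 1..b3}" unfolding Q_def using b1 b2 b3 a by (intro q_has_integral) auto
  have tail_le: "p_tail x \<le> P0" if "x \<ge> 0" for x
    using has_integral_nonneg[OF p_has_integral[of 0 x]] that pq by (auto simp: P0_def)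
  have Q: "Q \<ge> b1 + 1" using tail_le[of "b2 + 1"] p_tail_nonneg[of b3] b2 b1 a by (simp add: Q_def b3_def)
  \<comment> \<open>the derivative of \<open>u\<close> up to \<open>b2\<close>; the return slope is fixed only after \<open>M = u b2\<close> is known\<close>
  define v where "v x = (if x \<in> {a..b1} then q x * (1 / (2 * sqrt x)) else 0)" for x
  have v_int: "integrable half_line v"
  proof (rule half_line_bounded_integrable[of _ "1 / (2 * sqrt a)" b1])
    have "(\<lambda>x::real. if x \<in> {a..b1} then 1 / (2 * sqrt x) else 0) \<in> borel_measurable borel" by measurable
    then have m: "(\<lambda>x::real. if x \<in> {a..b1} then 1 / (2 * sqrt x) else 0) \<in> borel_measurable half_line"
      by (intro measurable_restrict_space1 measurable_completion) simp
    have "v = (\<lambda>x. q x * (if x \<in> {a..b1} then 1 / (2 * sqrt x) else 0))" by (auto simp: v_def)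
    then show "v \<in> borel_measurable half_line" using borel_measurable_times[OF q_meas m] by (simp only:)
    fix x :: real
    have "q x * (1 / (2 * sqrt x)) \<le> 1 * (1 / (2 * sqrt a))" if "a \<le> x"
      using that a pq by (intro mult_mono divide_left_mono) auto
    moreover have "0 \<le> q x * (1 / (2 * sqrt x))" if "a \<le> x" using that a pq by auto
    ultimately show "\<bar>v x\<bar> \<le> 1 / (2 * sqrt a)" using a by (auto simp: v_def)
  qed (auto simp: v_def)
  define M where "M = integral {0..b2} v"
  have v0: "v x \<ge> 0" for x using a pq by (auto simp: v_def)
  have v_upto: "(v has_integral integral {0..x} v) {0..x}" for x
    using half_line_has_integral_upto[OF v_int, of x] by (simp add: has_integral_iff)
  have M: "0 \<le> M" "M \<le> sqrt b1"
  proof -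
    show "0 \<le> M" unfolding M_def using v0 v_upto by (intro has_integral_nonneg[OF v_upto]) auto
    have "((\<lambda>x. if x \<in> {a..b1} then 1 / (2 * sqrt x) else 0) has_integral (sqrt b1 - sqrt a)) {0..b2}"
      using a b1 b2 by (subst has_integral_restrict) (auto intro!: has_integral_inverse_sqrt)
    then have "M \<le> sqrt b1 - sqrt a"
      unfolding M_def
    proof (rule has_integral_le[OF v_upto])
      fix x show "v x \<le> (if x \<in> {a..b1} then 1 / (2 * sqrt x) else 0)"
        using mult_right_mono[OF pq(5)[of x], of "1 / (2 * sqrt x)"] a by (auto simp: v_def)
    qed
    then show "M \<le> sqrt b1" using a by (simp add: order_trans)
  qed
  define \<kappa> where "\<kappa> = M / Q"
  have \<kappa>0: "\<kappa> \<ge> 0" using M Q b1 a by (simp add: \<kappa>_def)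
  define w where "w x = (if x \<in> {a..b1} then 1 / (2 * sqrt x) else if x \<in> {b2 + 1..b3} then - \<kappa> else 0)" for x
  define u where "u x = integral {0..x} (\<lambda>t. q t * w t)" for x
  have w_meas: "w \<in> borel_measurable borel" unfolding w_def by measurable
  have w_bd: "\<bar>w x\<bar> \<le> max (1 / (2 * sqrt a)) \<kappa>" for x
  proof (cases "x \<in> {a..b1}")
    case True
    then have "1 / (2 * sqrt x) \<le> 1 / (2 * sqrt a)" using a by (intro divide_left_mono) auto
    then show ?thesis using True a by (simp add: w_def)
  next
    case False
    then have "w x = - \<kappa> \<or> w x = 0" unfolding w_def by (simp only: if_False) simp
    then have "\<bar>w x\<bar> \<le> \<kappa>" using \<kappa>0 by auto
    then show ?thesis by (simp add: le_max_iff_disj)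
  qed
  have w0: "\<forall>x>b3. w x = 0" using b1 b2 b3 by (simp add: w_def)
  note test = canonical_relation_of_slope[OF w_meas w_bd w0, folded u_def]
  define f where "f = cvec2 (\<lambda>x. of_real (u x)) (\<lambda>_. 0)"
  define h where "h = cvec2 (\<lambda>_. 0) (\<lambda>x. - of_real (w x))"
  have fh: "(f, h) \<in> canonical_relation H" unfolding f_def h_def by (rule test(1))
  have wf: "weight f = (\<lambda>x. p x * (u x)\<^sup>2)" and wh: "weight h = (\<lambda>x. q x * (w x)\<^sup>2)"
    unfolding f_def h_def by (auto simp: fun_eq_iff test(2,3))
  have L2: "f \<in> L2H H" "h \<in> L2H H" using S_Y[OF fh] by auto
  have qw_low: "q x * w x = v x" if "x \<le> b2" for x
    using that b1 by (simp add: w_def v_def)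
  have u_low: "u x = integral {0..x} v" if "x \<le> b2" for x
    unfolding u_def using that qw_low by (intro integral_cong) auto
  have u_nonneg: "u x \<ge> 0" if "x \<le> b2" for x
    using has_integral_nonneg[OF v_upto] v0 by (simp add: u_low[OF that])
  have u_before: "u x = 0" if "x < a" for x
  proof -
    have "u x = integral {0..x} (\<lambda>_. 0)"
      unfolding u_def using that a b1 b2 by (intro integral_cong) (auto simp: w_def)
    then show ?thesis by simp
  qed
  have u_after: "u x = 0" if x: "x \<ge> b3" for x
  proof -
    have "((\<lambda>t. if t \<in> {b2 + 1..b3} then q t else 0) has_integral Q) {0..x}"
      using Qi b1 b2 a x by (subst has_integral_restrict) auto
    moreover have "(v has_integral M) {0..x}"
    proof -
      have "(v has_integral 0) {b2..x}" by (rule has_integral_is_0) (use b2 in \<open>auto simp: v_def\<close>)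
      then show ?thesis
        using has_integral_combine[OF _ _ v_upto[of b2], of x 0] b1 b2 b3 a x by (simp add: M_def)
    qed
    ultimately have "((\<lambda>t. v t - \<kappa> * (if t \<in> {b2 + 1..b3} then q t else 0)) has_integral (M - \<kappa> * Q)) {0..x}"
      by (intro has_integral_diff has_integral_mult_right)
    moreover have "(\<lambda>t. v t - \<kappa> * (if t \<in> {b2 + 1..b3} then q t else 0)) = (\<lambda>t. q t * w t)"
      using b1 b2 by (auto simp: fun_eq_iff v_def w_def)
    moreover have "M - \<kappa> * Q = 0" using Q b1 a by (simp add: \<kappa>_def)
    ultimately show ?thesis by (simp add: u_def integral_unique)
  qed
  have upper: "(nrm h)\<^sup>2 \<le> l / 4 + 1"
  proof -
    have "integrable half_line (\<lambda>x. q x * (w x)\<^sup>2)" using L2H_D(2)[OF L2(2)] by (simp add: wh)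
    then have "((\<lambda>x. q x * (w x)\<^sup>2) has_integral (nrm h)\<^sup>2) {0<..}"
      unfolding nrm_sq_weight[OF L2(2)] wh by (rule has_integral_integral_lebesgue_on) simp
    moreover have "((\<lambda>x. (if x \<in> {a..b1} then 1 / x else 0) * (1 / 4) + \<kappa>\<^sup>2 * (if x \<in> {b2 + 1..b3} then q x else 0))
        has_integral (l * (1 / 4) + \<kappa>\<^sup>2 * Q)) {0<..}"
    proof (intro has_integral_add has_integral_mult_left has_integral_mult_right)
      show "((\<lambda>x. if x \<in> {a..b1} then 1 / x else 0) has_integral l) {0<..}"
        using a b1 has_integral_inverse[of a b1] by (subst has_integral_restrict) auto
      show "((\<lambda>x. if x \<in> {b2 + 1..b3} then q x else 0) has_integral Q) {0<..}"
        using a b1 b2 Qi by (subst has_integral_restrict) auto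
    qed
    ultimately have "(nrm h)\<^sup>2 \<le> l * (1 / 4) + \<kappa>\<^sup>2 * Q"
    proof (rule has_integral_le)
      fix x :: real assume "x \<in> {0<..}"
      have "q x * (1 / (2 * sqrt x))\<^sup>2 \<le> 1 / x * (1 / 4)" if "x \<in> {a..b1}"
        using that a mult_right_mono[OF pq(5)[of x], of "1 / x * (1 / 4)"] by (simp add: power_divide power_mult_distrib)
      then show "q x * (w x)\<^sup>2 \<le> (if x \<in> {a..b1} then 1 / x else 0) * (1 / 4) + \<kappa>\<^sup>2 * (if x \<in> {b2 + 1..b3} then q x else 0)"
        using b1 b2 by (auto simp: w_def)
    qed
    also have "\<kappa>\<^sup>2 * Q = M\<^sup>2 / Q" using Q b1 a by (simp add: \<kappa>_def power2_eq_square)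
    also have "\<dots> \<le> 1"
    proof -
      have "M\<^sup>2 \<le> (sqrt b1)\<^sup>2" using M by (intro power_mono) auto
      then show ?thesis using Q b1 a by (simp add: divide_le_eq_1)
    qed
    finally show ?thesis by simp
  qed
  have lower: "(nrm f)\<^sup>2 \<ge> c * l - D - 1"
  proof -
    have b20: "0 \<le> b2" using a b1 b2 by simp
    have wint: "integrable half_line (\<lambda>x. p x * (u x)\<^sup>2)" using L2H_D(2)[OF L2(1)] by (simp add: wf)
    define N where "N = (LINT y|half_line. indicator {..b2} y *\<^sub>R (p y * (u y)\<^sup>2))"
    have N: "((\<lambda>x. p x * (u x)\<^sup>2) has_integral N) {0..b2}" unfolding N_def by (rule half_line_has_integral_upto[OF wint])
    have "N \<le> (nrm f)\<^sup>2"
      unfolding N_def nrm_sq_weight[OF L2(1)] wf using pq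
      by (intro integral_mono half_line_integrable_upto wint) (auto simp: indicator_def)
    \<comment> \<open>integration by parts turns the weight \<open>p\<close> into its tail integral\<close>
    have tail_ac: "loc_abs_cont p_tail"
    proof -
      have "loc_abs_cont (\<lambda>x. integral {0..x} p)"
        by (rule half_line_integral_abs_cont[OF p_int, of 1]) (use pq in auto)
      from loc_abs_cont_add[OF loc_abs_cont_const loc_abs_cont_linear[OF this bounded_linear_minus[OF bounded_linear_ident]]]
      show ?thesis by (simp add: p_tail_def[abs_def])
    qed
    have tail_der: "AE x in half_line. (p_tail has_vector_derivative - p x) (at x)"
      using half_line_indefinite_integral[OF p_int]
    proof eventually_elim
      case (elim x)
      show ?case unfolding p_tail_def[abs_def]
        by (rule has_vector_derivative_eq_rhs[OF has_vector_derivative_diff[OF has_vector_derivative_const elim]]) simp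
    qed
    have "AE x in half_line. ((\<lambda>x. p_tail x * (u x * u x)) has_vector_derivative
        p_tail x * (u x * (q x * w x) + (q x * w x) * u x) + - p x * (u x * u x)) (at x)"
      using tail_der test(5)
      by eventually_elim (intro has_vector_derivative_mult)
    then have "((\<lambda>x. p_tail x * (u x * (q x * w x) + (q x * w x) * u x) + - p x * (u x * u x)) has_integral
        (p_tail b2 * (u b2 * u b2) - p_tail 0 * (u 0 * u 0))) {0..b2}"
      by (intro loc_abs_cont_has_integral loc_abs_cont_mult tail_ac test(4) b20)
    from has_integral_add[OF this N]
    have "((\<lambda>x. p_tail x * (u x * (q x * w x) + (q x * w x) * u x)) has_integral (p_tail b2 * M\<^sup>2 + N)) {0..b2}"
      using u_before[OF a] u_low[of b2] by (simp add: M_def power2_eq_square)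
    then have parts: "((\<lambda>x. 2 * p_tail x * u x * v x) has_integral (p_tail b2 * M\<^sup>2 + N)) {0..b2}"
      by (rule has_integral_eq[rotated]) (simp add: qw_low)
    have low: "((\<lambda>x. c * (if x \<in> {a..b1} then 1 / x else 0) - c / a * p x - c * K * (if x \<in> {a..b1} then 1 / (x * sqrt x) else 0))
       has_integral (c * l - c / a * (P0 - p_tail b2) - c * K * (2 / sqrt a - 2 / sqrt b1))) {0..b2}"
    proof (intro has_integral_diff has_integral_mult_right)
      show "((\<lambda>x. if x \<in> {a..b1} then 1 / x else 0) has_integral l) {0..b2}"
        using a b1 b2 has_integral_inverse[of a b1] by (subst has_integral_restrict) auto
      show "(p has_integral (P0 - p_tail b2)) {0..b2}" unfolding P0_def by (rule p_has_integral[OF _ b20]) simp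
      show "((\<lambda>x. if x \<in> {a..b1} then 1 / (x * sqrt x) else 0) has_integral (2 / sqrt a - 2 / sqrt b1)) {0..b2}"
        using a b1 b2 has_integral_inverse_sqrt_cubed[of a b1] by (subst has_integral_restrict) auto
    qed
    have u_ge: "u x \<ge> sqrt x - K" if x: "x \<in> {a..b1}" for x
    proof -
      have "((\<lambda>t. if t \<in> {a..x} then 1 / (2 * sqrt t) else 0) has_integral (sqrt x - sqrt a)) {0..x}"
        using a x has_integral_inverse_sqrt[of a x] by (subst has_integral_restrict) auto
      then have "((\<lambda>t. (if t \<in> {a..x} then 1 / (2 * sqrt t) else 0) - 1 / (2 * sqrt a) * p t) has_integral
         ((sqrt x - sqrt a) - 1 / (2 * sqrt a) * (P0 - p_tail x))) {0..x}"
        using a x p_has_integral[of 0 x] by (intro has_integral_diff has_integral_mult_right) (auto simp: P0_def)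
      then have "(sqrt x - sqrt a) - 1 / (2 * sqrt a) * (P0 - p_tail x) \<le> u x"
        unfolding u_low[OF order_trans[of x b1 b2]]
      proof (rule has_integral_le)
        show "(v has_integral u x) {0..x}" using v_upto[of x] u_low[of x] x b2 by simp
        fix t :: real assume t: "t \<in> {0..x}"
        show "(if t \<in> {a..x} then 1 / (2 * sqrt t) else 0) - 1 / (2 * sqrt a) * p t \<le> v t"
        proof (cases "t \<in> {a..x}")
          case True
          have "p t * (1 / (2 * sqrt t)) \<le> p t * (1 / (2 * sqrt a))"
            using True a pq by (intro mult_left_mono divide_left_mono) auto
          moreover have "1 / (2 * sqrt t) = p t * (1 / (2 * sqrt t)) + q t * (1 / (2 * sqrt t))"
            using pq(3)[of t] by (metis distrib_right mult_1)
          moreover have "v t = q t * (1 / (2 * sqrt t))" using True x by (simp add: v_def)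
          ultimately have "1 / (2 * sqrt t) - p t * (1 / (2 * sqrt a)) \<le> v t" by linarith
          then show ?thesis using True by (simp add: mult.commute)
        next
          case False
          then show ?thesis using v0[of t] pq(1)[of t] a by (auto intro: order_trans[of _ 0])
        qed
      qed
      moreover have "1 / (2 * sqrt a) * (P0 - p_tail x) \<le> P0 / (2 * sqrt a)"
        using p_tail_nonneg[of x] a by (simp add: divide_right_mono)
      ultimately show ?thesis by (simp add: K_def)
    qed
    have "c * l - c / a * (P0 - p_tail b2) - c * K * (2 / sqrt a - 2 / sqrt b1) \<le> p_tail b2 * M\<^sup>2 + N"
    proof (rule has_integral_le[OF low parts])
      fix x assume x: "x \<in> {0..b2}"
      show "c * (if x \<in> {a..b1} then 1 / x else 0) - c / a * p x - c * K * (if x \<in> {a..b1} then 1 / (x * sqrt x) else 0)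
         \<le> 2 * p_tail x * u x * v x"
      proof (cases "x \<in> {a..b1}")
        case False
        show ?thesis using pq(1)[of x] c a unfolding v_def if_not_P[OF False] by simp
      next
        case True
        then have x0: "x > 0" "sqrt x > 0" using a by auto
        have "c / x * (q x * (u x / sqrt x)) \<le> p_tail x * (q x * (u x / sqrt x))"
          using tail[of x] True u_nonneg[of x] x pq x0 by (intro mult_right_mono) auto
        also have "\<dots> = 2 * p_tail x * u x * v x" using True by (simp add: v_def)
        finally have 1: "c / x * (q x * (u x / sqrt x)) \<le> 2 * p_tail x * u x * v x" .
        have "1 - K / sqrt x \<le> u x / sqrt x"
          using divide_right_mono[OF u_ge[OF True], of "sqrt x"] x0 by (simp add: diff_divide_distrib)
        then have "q x * (1 - K / sqrt x) \<le> q x * (u x / sqrt x)"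
          using pq by (intro mult_left_mono) auto
        moreover have "q x * (K / sqrt x) \<le> 1 * (K / sqrt x)" using pq K x0 by (intro mult_right_mono) auto
        ultimately have "q x - K / sqrt x \<le> q x * (u x / sqrt x)" by (simp add: right_diff_distrib)
        then have "c / x * (q x - K / sqrt x) \<le> c / x * (q x * (u x / sqrt x))"
          using c x0 by (intro mult_left_mono) auto
        moreover have "c / x * (q x - K / sqrt x) = c / x - c / x * p x - c * K * (1 / (x * sqrt x))"
        proof -
          have "q x = 1 - p x" using pq(3)[of x] by simp
          then show ?thesis by (simp add: right_diff_distrib)
        qed
        moreover have "c / x * p x \<le> c / a * p x"
          using c a True pq by (intro mult_right_mono divide_left_mono) auto
        ultimately show ?thesis using 1 True by simp
      qed
    qed
    moreover have "p_tail b2 * M\<^sup>2 \<le> 1"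
    proof -
      have "M\<^sup>2 \<le> (sqrt b1)\<^sup>2" using M by (intro power_mono) auto
      then have "p_tail b2 * M\<^sup>2 \<le> p_tail b2 * b1" using p_tail_nonneg b1 a by (intro mult_left_mono) auto
      then show ?thesis using b2 by simp
    qed
    moreover have "c / a * (P0 - p_tail b2) \<le> c / a * P0"
      using c a p_tail_nonneg by (intro mult_left_mono) auto
    moreover have "c * K * (2 / sqrt a - 2 / sqrt b1) \<le> c * K * (2 / sqrt a)"
      using c K b1 a by (intro mult_left_mono) auto
    ultimately show ?thesis using \<open>N \<le> (nrm f)\<^sup>2\<close> unfolding D_def by linarith
  qed
  have f_ne: "nrm f \<noteq> 0"
  proof
    assume "nrm f = 0"
    then show False using lower l by simp
  qed
  have "nrm h \<le> \<mu> * nrm f"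
  proof (rule power2_le_imp_le)
    have "l / 4 + 1 \<le> \<mu>\<^sup>2 * (c * l - D - 1)"
      using l(1) by (simp add: \<beta>_def algebra_simps)
    also have "\<dots> \<le> \<mu>\<^sup>2 * (nrm f)\<^sup>2" using lower by (intro mult_left_mono) auto
    finally show "(nrm h)\<^sup>2 \<le> (\<mu> * nrm f)\<^sup>2" using upper by (simp add: power_mult_distrib)
    show "0 \<le> \<mu> * nrm f" using \<mu> nrm_nonneg[OF L2(1)] by simp
  qed
  moreover have "f x = 0 \<and> h x = 0" if "x < a \<or> x > b3" for x
  proof -
    have "u x = 0" "w x = 0" using that u_before u_after[of x] b1 b2 b3 by (auto simp: w_def)
    then show ?thesis by (simp add: f_def h_def vec_eq_iff forall_2)
  qed
  ultimately show thesis using that[of b3 f h] fh f_ne b1 b2 b3 by simp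
qed

lemma ip_disjoint_support:
  assumes "\<And>x. f x = 0 \<or> g x = 0" shows "L2H_inner H f g = 0"
proof -
  have "herm_form (H x) (f x) (g x) = 0" for x using assms[of x] by (auto simp: herm_form_eq)
  then show ?thesis by (simp add: L2H_inner_def)
qed

text \<open>By induction on \<open>G\<close>: two test pairs with disjoint supports, both orthogonal to \<open>G\<close>, have a nontrivial
  combination that is also orthogonal to one further vector \<open>e\<close>. Since squared norms of disjointly supported
  functions add up, the bound by \<open>\<mu>\<close> survives.\<close>

lemma orthogonal_test_pair:
  assumes "finite G" "G \<subseteq> L2H H" and c: "c > 0" and a0: "a0 > 0"
    and tail: "\<And>x. x \<ge> a0 \<Longrightarrow> c / x \<le> p_tail x" and \<mu>: "\<mu>\<^sup>2 * c > 1 / 4" "\<mu> > 0" and "a \<ge> a0"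
  shows "\<exists>b f h. b > a \<and> (f, h) \<in> canonical_relation H \<and> nrm f \<noteq> 0 \<and> nrm h \<le> \<mu> * nrm f \<and>
    (\<forall>x. x < a \<or> x > b \<longrightarrow> f x = 0 \<and> h x = 0) \<and> (\<forall>e\<in>G. L2H_inner H e f = 0)"
  using assms(1,2) \<open>a \<ge> a0\<close>
proof (induction G arbitrary: a rule: finite_induct)
  case empty
  then have "\<And>x. x \<ge> a \<Longrightarrow> c / x \<le> p_tail x" "a > 0" using tail a0 by auto
  from test_pair[OF c this \<mu>] show ?case by (metis empty_iff)
next
  case (insert e G)
  obtain b f h where 1: "b > a" "(f, h) \<in> canonical_relation H" "nrm f \<noteq> 0" "nrm h \<le> \<mu> * nrm f"
    "\<forall>x. x < a \<or> x > b \<longrightarrow> f x = 0 \<and> h x = 0" "\<forall>e\<in>G. L2H_inner H e f = 0"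
    using insert.IH[of a] insert.prems by auto
  obtain b' g k where 2: "b' > b + 1" "(g, k) \<in> canonical_relation H" "nrm g \<noteq> 0" "nrm k \<le> \<mu> * nrm g"
    "\<forall>x. x < b + 1 \<or> x > b' \<longrightarrow> g x = 0 \<and> k x = 0" "\<forall>e\<in>G. L2H_inner H e g = 0"
    using insert.IH[of "b + 1"] insert.prems 1(1) by auto
  have Y: "f \<in> L2H H" "h \<in> L2H H" "g \<in> L2H H" "k \<in> L2H H" "e \<in> L2H H" "\<And>e. e \<in> G \<Longrightarrow> e \<in> L2H H"
    using S_Y[OF 1(2)] S_Y[OF 2(2)] insert.prems by auto
  show ?case
  proof (cases "L2H_inner H e f = 0")
    case True
    then show ?thesis using 1 by (intro exI[of _ b] exI[of _ f] exI[of _ h]) auto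
  next
    case False
    define \<alpha> where "\<alpha> = L2H_inner H e g"
    define \<beta> where "\<beta> = L2H_inner H e f"
    \<comment> \<open>the coefficients make \<open>F\<close> orthogonal to \<open>e\<close>\<close>
    define F where "F = cscale \<alpha> f - cscale \<beta> g"
    define E where "E = cscale \<alpha> h - cscale \<beta> k"
    have FE: "(F, E) \<in> canonical_relation H" unfolding F_def E_def by (intro S_diff S_scale 1 2)
    have perp: "L2H_inner H d F = \<alpha> * L2H_inner H d f - \<beta> * L2H_inner H d g" if "d \<in> L2H H" for d
      using that Y by (simp add: F_def ip_diff ip_scale)
    have orth: "L2H_inner H (cscale \<alpha> f) (cscale \<beta> g) = 0" "L2H_inner H (cscale \<alpha> h) (cscale \<beta> k) = 0"
    proof -
      have "x < b + 1 \<or> x > b" for x :: real by linarith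
      then have "(cscale \<alpha> f x = 0 \<or> cscale \<beta> g x = 0) \<and> (cscale \<alpha> h x = 0 \<or> cscale \<beta> k x = 0)" for x
        using spec[OF 1(5), of x] spec[OF 2(5), of x] unfolding cscale_def by fastforce
      then show "L2H_inner H (cscale \<alpha> f) (cscale \<beta> g) = 0" "L2H_inner H (cscale \<alpha> h) (cscale \<beta> k) = 0"
        by (auto intro!: ip_disjoint_support)
    qed
    have F2: "(nrm F)\<^sup>2 = (cmod \<alpha> * nrm f)\<^sup>2 + (cmod \<beta> * nrm g)\<^sup>2"
      unfolding F_def using Y orth(1) by (subst nrm_diff_sq) (auto simp: nrm_scale)
    have E2: "(nrm E)\<^sup>2 = (cmod \<alpha> * nrm h)\<^sup>2 + (cmod \<beta> * nrm k)\<^sup>2"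
      unfolding E_def using Y orth(2) by (subst nrm_diff_sq) (auto simp: nrm_scale)
    have "nrm E \<le> \<mu> * nrm F"
    proof (rule power2_le_imp_le)
      have "(cmod \<alpha> * nrm h)\<^sup>2 \<le> (cmod \<alpha> * (\<mu> * nrm f))\<^sup>2" "(cmod \<beta> * nrm k)\<^sup>2 \<le> (cmod \<beta> * (\<mu> * nrm g))\<^sup>2"
        using 1(4) 2(4) Y by (auto intro!: power_mono mult_left_mono)
      then show "(nrm E)\<^sup>2 \<le> (\<mu> * nrm F)\<^sup>2"
        unfolding power_mult_distrib[of \<mu>] F2 E2 by (simp add: power_mult_distrib algebra_simps)
      show "0 \<le> \<mu> * nrm F" using \<mu> S_Y[OF FE] by simp
    qed
    moreover have "nrm F \<noteq> 0"
    proof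
      assume "nrm F = 0"
      then have "(cmod \<beta> * nrm g)\<^sup>2 \<le> 0" using F2 zero_le_power2[of "cmod \<alpha> * nrm f"] by simp
      then show False using False 2(3) by (simp add: \<beta>_def)
    qed
    moreover have "F x = 0 \<and> E x = 0" if "x < a \<or> x > b'" for x
    proof -
      have "x < a \<or> x > b" "x < b + 1 \<or> x > b'" using that 1(1) 2(1) by auto
      then show ?thesis using 1(5) 2(5) by (auto simp: F_def E_def cscale_def)
    qed
    moreover have "L2H_inner H d F = 0" if "d \<in> insert e G" for d
      using that perp 1(6) 2(6) Y by (auto simp: \<alpha>_def \<beta>_def)
    moreover have "b' > a" using 1(1) 2(1) by simp
    ultimately show ?thesis using FE by blast
  qed
qed

lemma essential_spectrum_bound:
  assumes c: "c > 0" and tail: "\<forall>\<^sub>F x in at_top. c \<le> x * (LINT t|lebesgue_on {x<..}. (sin (\<phi> t))\<^sup>2)"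
    and \<mu>: "\<mu>\<^sup>2 * c > 1 / 4" "\<mu> > 0" and \<nu>: "\<mu> < \<nu>"
  shows "\<exists>z\<in>essential_spectrum H. cmod z \<le> \<nu>"
proof -
  obtain a where a: "\<And>x. x \<ge> a \<Longrightarrow> c \<le> x * (LINT t|lebesgue_on {x<..}. (sin (\<phi> t))\<^sup>2)"
    using tail by (auto simp: eventually_at_top_linorder)
  have tail': "c / x \<le> p_tail x" if "x \<ge> max a 1" for x
    using a[of x] p_tail_eq[of x] that by (simp add: pos_divide_le_eq mult.commute)
  have "\<exists>z\<in>ess. cmod z \<le> \<nu>"
  proof (rule ess_near_zero[OF _ \<nu>])
    fix G assume G: "finite G" "G \<subseteq> L2H H"
    have "max a 1 > 0" by simp
    from orthogonal_test_pair[OF G c this tail' \<mu> order_refl]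
    obtain f h where "(f, h) \<in> canonical_relation H" "nrm f \<noteq> 0" "nrm h \<le> \<mu> * nrm f" "\<forall>e\<in>G. L2H_inner H e f = 0"
      by blast
    then show "\<exists>(f, h)\<in>canonical_relation H. nrm f \<noteq> 0 \<and> nrm h \<le> \<mu> * nrm f \<and> (\<forall>e\<in>G. L2H_inner H e f = 0)"
      by (intro bexI[of _ "(f, h)"]) auto
  qed (use \<mu> in simp)
  then show ?thesis by (simp add: ess_eq)
qed

text \<open>The essential spectrum is closed, so the \<open>LEAST\<close> in the definition of \<open>min_abs_ess\<close> is attained.\<close>

lemma min_abs_ess_le:
  assumes "\<And>\<nu>. ereal \<nu> > R \<Longrightarrow> \<exists>z\<in>essential_spectrum H. cmod z \<le> \<nu>"
  shows "min_abs_ess H \<le> R"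
proof (cases "R = \<infinity>")
  case False
  then obtain \<nu> where "R < ereal \<nu>" using ereal_dense2[of R \<infinity>] by auto
  have closed: "closed (essential_spectrum H)" using closed_ess by (simp add: ess_eq)
  obtain z0 where z0: "z0 \<in> essential_spectrum H" "\<And>z. z \<in> essential_spectrum H \<Longrightarrow> cmod z0 \<le> cmod z"
    using distance_attains_inf[OF closed, of 0] assms[OF \<open>R < ereal \<nu>\<close>] by auto
  have "(LEAST r. r \<in> (\<lambda>t. ereal (cmod t)) ` essential_spectrum H) = ereal (cmod z0)"
    using z0 by (intro Least_equality) auto
  then have "min_abs_ess H = ereal (cmod z0)" using z0(1) by (auto simp: min_abs_ess_def)
  moreover have "ereal (cmod z0) \<le> R"
  proof (rule ccontr)
    assume "\<not> ?thesis"
    then have "R < ereal (cmod z0)" by simp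
    then obtain r where "R < ereal r" "ereal r < ereal (cmod z0)" using ereal_dense2 by blast
    then show False using assms[of r] z0(2) by fastforce
  qed
  ultimately show ?thesis by simp
qed simp

end

text \<open>For finite \<open>B\<close> the two constants are midpoints: \<open>\<mu>\<close> between \<open>1 / (2 sqrt B)\<close> and \<open>\<nu>\<close>, and \<open>c\<close> between
  \<open>1 / (4 \<mu>\<^sup>2)\<close> and \<open>B\<close>.\<close>

lemma exists_admissible_constants:
  assumes B: "B > 0" and \<nu>: "1 / (2 * ereal_sqrt B) < ereal \<nu>"
  obtains \<mu> c where "0 < \<mu>" "\<mu> < \<nu>" "0 < c" "ereal c < B" "\<mu>\<^sup>2 * c > 1 / 4"
proof (cases B)
  case PInf
  then have "\<nu> > 0" using \<nu> by (simp add: ereal_sqrt_def)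
  then show ?thesis using that[of "\<nu> / 2" "2 / \<nu>\<^sup>2"] PInf by (simp add: power_divide field_simps)
next
  case (real b)
  then have b: "b > 0" using B by simp
  define s where "s = 1 / (2 * sqrt b)"
  have s: "s > 0" "s < \<nu>" "s\<^sup>2 * b = 1 / 4"
    using \<nu> b real by (auto simp: ereal_sqrt_def s_def power_divide power_mult_distrib divide_ereal_def one_ereal_def field_simps)
  define \<mu> where "\<mu> = (s + \<nu>) / 2"
  have \<mu>: "0 < \<mu>" "\<mu> < \<nu>" "s < \<mu>" using s by (auto simp: \<mu>_def)
  have "s\<^sup>2 < \<mu>\<^sup>2" using s \<mu> by (intro power_strict_mono) auto
  then have lt: "1 / 4 < \<mu>\<^sup>2 * b" using s(3) b by (metis mult_strict_right_mono)
  define c where "c = (b + 1 / (4 * \<mu>\<^sup>2)) / 2"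
  have "1 / (4 * \<mu>\<^sup>2) < b" using lt \<mu>(1) by (simp add: field_simps)
  then have "c < b" "1 / (4 * \<mu>\<^sup>2) < c" "0 < c" using b \<mu>(1) by (auto simp: c_def add_pos_pos)
  moreover from this(2) have "\<mu>\<^sup>2 * c > 1 / 4" using \<mu>(1) by (simp add: field_simps)
  ultimately show ?thesis using that[of \<mu> c] \<mu> real by simp
qed (use B in auto)

theorem theorem1p4:
  fixes \<phi> :: "real \<Rightarrow> real" and B :: ereal
  assumes "\<phi> \<in> borel_measurable (lebesgue_on {0<..})"
    and "\<And>x. x > 0 \<Longrightarrow> \<phi> x \<in> {- pi / 2..<pi / 2}"
    and "integrable (lebesgue_on {0<..}) (\<lambda>x. (sin (\<phi> x))\<^sup>2)"
    and "B = Liminf at_top (\<lambda>x::real. ereal (x * (LINT t|lebesgue_on {x<..}. (sin (\<phi> t))\<^sup>2)))"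
  shows "min_abs_ess (H_diag \<phi>) \<le> 1 / (2 * ereal_sqrt B)"
proof -
  interpret diagonal_system \<phi> using assms(1,3) by unfold_locales
  have "\<forall>\<^sub>F x in at_top. (0::ereal) \<le> ereal (x * (LINT t|lebesgue_on {x<..}. (sin (\<phi> t))\<^sup>2))"
    using eventually_ge_at_top[of "0::real"]
    by eventually_elim (auto intro!: mult_nonneg_nonneg Bochner_Integration.integral_nonneg)
  then have B0: "B \<ge> 0" unfolding assms(4) by (rule Liminf_bounded)
  show ?thesis
  proof (cases "B = 0")
    case True
    then show ?thesis by (simp add: ereal_sqrt_def divide_ereal_def flip: zero_ereal_def)
  next
    case False
    with B0 have B: "B > 0" by simp
    show ?thesis
    proof (rule min_abs_ess_le)
      fix \<nu> :: real assume "1 / (2 * ereal_sqrt B) < ereal \<nu>"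
      from exists_admissible_constants[OF B this] obtain \<mu> c where
        \<mu>c: "0 < \<mu>" "\<mu> < \<nu>" "0 < c" "ereal c < B" "\<mu>\<^sup>2 * c > 1 / 4" .
      have "\<forall>\<^sub>F x in at_top. ereal c < ereal (x * (LINT t|lebesgue_on {x<..}. (sin (\<phi> t))\<^sup>2))"
        using \<mu>c(4) unfolding assms(4) by (rule less_LiminfD)
      then have "\<forall>\<^sub>F x in at_top. c \<le> x * (LINT t|lebesgue_on {x<..}. (sin (\<phi> t))\<^sup>2)"
        by eventually_elim simp
      then show "\<exists>z\<in>essential_spectrum (H_diag \<phi>). cmod z \<le> \<nu>"
        by (rule essential_spectrum_bound[OF \<mu>c(3) _ \<mu>c(5,1,2)])
    qed
  qed
qed

end
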